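(* Let $\Omega=\mathbb{R}^{\mathbb{N}}$, let $\mathbb{E}$ be a regular sublinear expectation on $(\Omega,C_b(\Omega))$, let $\Theta$ be the maximal set of probabilities representing $\mathbb{E}$ and $\Theta^e$ the set of extreme points of $\Theta$. Assume that the coordinate process $\{\xi_k\}_{k\ge1}$ is contained in $L^{\gamma}_{\mathbb{E}}(\Omega)$ for some $\gamma>1$ and is i.i.d. under $\mathbb{E}$. Write $\overline{\mu}=\mathbb{E}[\xi_1]$, $\underline{\mu}=-\mathbb{E}[-\xi_1]$. For $n\ge1$ let $\Theta_n=\{P\in\Theta: P\circ\theta_n^{-1}=P\}$, let $\Theta_\infty=\bigcup_{n\ge1}\Theta_n$, and let $\Theta^s=\Theta^e\cap\Theta_\infty$. Then: 1) For any $P\in\Theta^s$ and $A\in\mathcal{T}$, either $P(A)=0$ or $P(A)=1$. 2) For any $P\in\Theta^s$, $\xi_\infty^{\triangledown}=\xi_\infty^{\vartriangle}=m_P$, $P$-a.s., for some constant $m_P$; moreover, $\{m_P\}_{P\in\Theta^s}$ is dense in $[\underline{\mu},\overline{\mu}]$. 3) $\Theta^s$ is a set that represents $\mathbb{E}$: $\sup_{P\in\Theta^s}E_P[X]=\mathbb{E}[X]$ for $X\in C_b(\Omega)$.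
   Context: $\Omega=\mathbb{R}^{\mathbb{N}}$ carries the metric $d(x,y)=\sum_{k=1}^\infty 2^{-k}(|x(k)-y(k)|\wedge1)$ (a Polish space); $\xi_k(\omega)=\omega(k)$; $\theta_n:\Omega\to\Omega$ is the $n$-shift, $\theta_n(\xi_1,\xi_2,\dots)=(\xi_{n+1},\xi_{n+2},\dots)$. $\mathcal{G}_n=\sigma\{\xi_n,\xi_{n+1},\dots\}$ and $\mathcal{T}=\bigcap_n\mathcal{G}_n$ is the tail $\sigma$-algebra. $\bar{\xi}_n=\frac{\xi_1+\cdots+\xi_n}{n}$, $\xi_\infty^{\triangledown}=\limsup_{n\to\infty}\bar{\xi}_n$, $\xi_\infty^{\vartriangle}=\liminf_{n\to\infty}\bar{\xi}_n$. $\mathcal{M}_1(\Omega)$ denotes the Borel probability measures on $\Omega$, and $C_b(\Omega)$ the bounded continuous functions. A sublinear expectation on $(\Omega,C_b(\Omega))$ is a functional of the form $\mathbb{E}[X]=\sup_{P\in\Theta'}E_P[X]$ for some set $\Theta'\subset\mathcal{M}_1(\Omega)$ (such $\Theta'$ is said to represent $\mathbb{E}$). It is regular if $\mathbb{E}[X_n]\downarrow0$ whenever $X_n\in C_b(\Omega)$ and $X_n\downarrow0$ pointwise on $\Omega$. The maximal representing set is $\Theta=\{P\in\mathcal{M}_1(\Omega): E_P[X]\le\mathbb{E}[X]\ \text{for any } X\in C_b(\Omega)\}$. For $p\ge1$, $L^p_{\mathbb{E}}(\Omega)$ is the completion of $C_b(\Omega)$ under $\|X\|_p=(\mathbb{E}[|X|^p])^{1/p}$,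 identified with Borel functions $X$ for which there are $X_n\in C_b(\Omega)$ with $\sup_{P\in\Theta}E_P[|X-X_n|^p]\to0$ (modulo sets null under every $P\in\Theta$); for such $X$, $\mathbb{E}[X]=\sup_{P\in\Theta}E_P[X]$. $C_{b,Lip}(\mathbb{R}^n)$: bounded Lipschitz functions on $\mathbb{R}^n$. $\mathbf{X}$ ($m$-dimensional) is independent of $\mathbf{Y}$ ($n$-dimensional) under $\mathbb{E}$ if $\mathbb{E}[\varphi(\mathbf{Y},\mathbf{X})]=\mathbb{E}\big[\mathbb{E}[\varphi(\mathbf{y},\mathbf{X})]|_{\mathbf{y}=\mathbf{Y}}\big]$ for any $\varphi\in C_{b,Lip}(\mathbb{R}^{n+m})$. $\mathbf{X}\overset{d}{=}\mathbf{Y}$ means $\mathbb{E}[\varphi(\mathbf{X})]=\mathbb{E}[\varphi(\mathbf{Y})]$ for every bounded Lipschitz $\varphi$. $(X_i)_{i\ge1}$ is i.i.d. if, for each $i\ge1$, $X_{i+1}$ is independent of $(X_1,\dots,X_i)$ and $X_{i+1}\overset{d}{=}X_i$. *)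

theory Defs
  imports "HOL-Probability.Probability"
begin

section \<open>Sublinear expectations on bounded continuous functions\<close>

text \<open>The library set \<^const>\<open>bcontfun\<close> is the set of bounded continuous functions.\<close>

abbreviation Cb :: "('a::topological_space \<Rightarrow> real) set"
  where "Cb \<equiv> bcontfun"

definition prob_measures :: "('a::topological_space) measure set"
  where "prob_measures = {P. prob_space P \<and> sets P = sets borel}"

text \<open>
  The supremum over the empty set is an arbitrary number in type \<^typ>\<open>real\<close>, so a
  representing set is required to be nonempty. For nonempty sets the supremum is the genuine
  one, since the functions in \<^const>\<open>Cb\<close> are bounded.
\<close>

definition represents ::
    "('a::topological_space) measure set \<Rightarrow> (('a \<Rightarrow> real) \<Rightarrow> real) \<Rightarrow> bool"
  where "represents \<Theta> E \<longleftrightarrow>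
    \<Theta> \<subseteq> prob_measures \<and> \<Theta> \<noteq> {} \<and>
    (\<forall>X\<in>Cb. E X = (SUP P\<in>\<Theta>. integral\<^sup>L P X))"

text \<open>
  A functional on \<^const>\<open>Cb\<close> is modelled by a total function whose values outside
  \<^const>\<open>Cb\<close> are never used.
\<close>

definition sublinear_expectation :: "(('a::topological_space \<Rightarrow> real) \<Rightarrow> real) \<Rightarrow> bool"
  where "sublinear_expectation E \<longleftrightarrow> (\<exists>\<Theta>. represents \<Theta> E)"

definition regular_expectation :: "(('a::topological_space \<Rightarrow> real) \<Rightarrow> real) \<Rightarrow> bool"
  where "regular_expectation E \<longleftrightarrow>
    (\<forall>X :: nat \<Rightarrow> 'a \<Rightarrow> real.
      (\<forall>n. X n \<in> Cb) \<and> (\<forall>\<omega>. decseq (\<lambda>n. X n \<omega>) \<and> (\<lambda>n. X n \<omega>) \<longlonglongrightarrow> 0) \<longrightarrow>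
      decseq (\<lambda>n. E (X n)) \<and> (\<lambda>n. E (X n)) \<longlonglongrightarrow> 0)"

definition max_repr :: "(('a::topological_space \<Rightarrow> real) \<Rightarrow> real) \<Rightarrow> 'a measure set"
  where "max_repr E = {P \<in> prob_measures. \<forall>X\<in>Cb. integral\<^sup>L P X \<le> E X}"

text \<open>
  The type of measures is not a vector space, so the library notion of extreme point does not
  apply; convex combinations are written setwise.
\<close>

definition extreme_measures :: "'a measure set \<Rightarrow> 'a measure set"
  where "extreme_measures \<Theta> =
    {P \<in> \<Theta>. \<forall>Q\<in>\<Theta>. \<forall>R\<in>\<Theta>. \<forall>t::real.
       0 < t \<and> t < 1 \<and> (\<forall>A\<in>sets P. measure P A = t * measure Q A + (1 - t) * measure R A)
       \<longrightarrow> Q = P \<and> R = P}"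

definition Lp_space ::
    "(('a::topological_space \<Rightarrow> real) \<Rightarrow> real) \<Rightarrow> real \<Rightarrow> ('a \<Rightarrow> real) set"
  where "Lp_space E p =
    {X \<in> borel_measurable borel. \<exists>Y :: nat \<Rightarrow> 'a \<Rightarrow> real. (\<forall>n. Y n \<in> Cb) \<and>
      (\<lambda>n. SUP P\<in>max_repr E. \<integral>\<^sup>+\<omega>. ennreal (\<bar>X \<omega> - Y n \<omega>\<bar> powr p) \<partial>P) \<longlonglongrightarrow> 0}"

text \<open>The extension of \<open>E\<close> from \<^const>\<open>Cb\<close> to \<^term>\<open>Lp_space E p\<close> for \<open>p \<ge> 1\<close>:\<close>

definition ext_expectation ::
    "(('a::topological_space \<Rightarrow> real) \<Rightarrow> real) \<Rightarrow> ('a \<Rightarrow> real) \<Rightarrow> real"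
  where "ext_expectation E X = (SUP P\<in>max_repr E. integral\<^sup>L P X)"


section \<open>Independence and identical distribution\<close>

text \<open>
  A vector in \<open>n\<close>-dimensional Euclidean space is given by the components \<open>x i\<close>, \<open>i < n\<close>, of a
  function \<open>x\<close> on the natural numbers. The Lipschitz condition uses the Euclidean distance of
  these components only, and hence also forces \<open>\<phi>\<close> to ignore all other components.
\<close>

definition Cb_Lip :: "nat \<Rightarrow> ((nat \<Rightarrow> real) \<Rightarrow> real) set"
  where "Cb_Lip n =
    {\<phi>. bounded (range \<phi>) \<and>
        (\<exists>L. \<forall>x y. \<bar>\<phi> x - \<phi> y\<bar> \<le> L * L2_set (\<lambda>i. x i - y i) {..<n})}"

text \<open>The vector \<open>(y, x)\<close>, where \<open>y\<close> is \<open>n\<close>-dimensional:\<close>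

definition join_vec :: "nat \<Rightarrow> (nat \<Rightarrow> real) \<Rightarrow> (nat \<Rightarrow> real) \<Rightarrow> nat \<Rightarrow> real"
  where "join_vec n y x = (\<lambda>k. if k < n then y k else x (k - n))"

text \<open>The \<open>m\<close>-dimensional \<open>X\<close> is independent of the \<open>n\<close>-dimensional \<open>Y\<close>:\<close>

definition indep_of ::
    "(('a::topological_space \<Rightarrow> real) \<Rightarrow> real) \<Rightarrow>
      nat \<Rightarrow> ('a \<Rightarrow> nat \<Rightarrow> real) \<Rightarrow> nat \<Rightarrow> ('a \<Rightarrow> nat \<Rightarrow> real) \<Rightarrow> bool"
  where "indep_of E m X n Y \<longleftrightarrow>
    (\<forall>\<phi>\<in>Cb_Lip (n + m).
      ext_expectation E (\<lambda>\<omega>. \<phi> (join_vec n (Y \<omega>) (X \<omega>))) =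
      ext_expectation E (\<lambda>\<omega>. ext_expectation E (\<lambda>\<omega>'. \<phi> (join_vec n (Y \<omega>) (X \<omega>')))))"

definition ident_distr ::
    "(('a::topological_space \<Rightarrow> real) \<Rightarrow> real) \<Rightarrow>
      nat \<Rightarrow> ('a \<Rightarrow> nat \<Rightarrow> real) \<Rightarrow> ('a \<Rightarrow> nat \<Rightarrow> real) \<Rightarrow> bool"
  where "ident_distr E m X Y \<longleftrightarrow>
    (\<forall>\<phi>\<in>Cb_Lip m. ext_expectation E (\<lambda>\<omega>. \<phi> (X \<omega>)) = ext_expectation E (\<lambda>\<omega>. \<phi> (Y \<omega>)))"

text \<open>
  Sequences are indexed from 0. Real random variables enter as one-dimensional vectors, of which
  only component 0 matters; the first \<open>Suc i\<close> members form the vector \<open>\<lambda>\<omega> k. X k \<omega>\<close>.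
\<close>

definition iid_seq ::
    "(('a::topological_space \<Rightarrow> real) \<Rightarrow> real) \<Rightarrow> (nat \<Rightarrow> 'a \<Rightarrow> real) \<Rightarrow> bool"
  where "iid_seq E X \<longleftrightarrow>
    (\<forall>i. indep_of E 1 (\<lambda>\<omega> _. X (Suc i) \<omega>) (Suc i) (\<lambda>\<omega> k. X k \<omega>) \<and>
         ident_distr E 1 (\<lambda>\<omega> _. X (Suc i) \<omega>) (\<lambda>\<omega> _. X i \<omega>))"


section \<open>The sequence space\<close>

text \<open>
  The type \<^typ>\<open>nat \<Rightarrow> real\<close> carries the library's product topology, which is the topology of the
  metric \<open>\<Sum>k. 2\<^sup>-\<^sup>k * min \<bar>x k - y k\<bar> 1\<close>. Coordinates are numbered from 0, so
  \<open>coord k\<close> is the coordinate usually written \<open>\<xi>\<close> with index \<open>k + 1\<close>.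
\<close>

type_synonym seq_space = "nat \<Rightarrow> real"

definition coord :: "nat \<Rightarrow> seq_space \<Rightarrow> real"
  where "coord k \<omega> = \<omega> k"

definition shift_seq :: "nat \<Rightarrow> seq_space \<Rightarrow> seq_space"
  where "shift_seq n \<omega> = (\<lambda>k. \<omega> (k + n))"

definition tail_sigma :: "seq_space set set"
  where "tail_sigma =
    (\<Inter>n. sigma_sets UNIV {coord k -` B |k B. n \<le> k \<and> B \<in> sets borel})"

definition avg :: "nat \<Rightarrow> seq_space \<Rightarrow> real"
  where "avg n \<omega> = (\<Sum>k<n. coord k \<omega>) / real n"

definition upper_avg :: "seq_space \<Rightarrow> ereal"
  where "upper_avg \<omega> = limsup (\<lambda>n. ereal (avg n \<omega>))"

definition lower_avg :: "seq_space \<Rightarrow> ereal"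
  where "lower_avg \<omega> = liminf (\<lambda>n. ereal (avg n \<omega>))"

definition stationary_repr :: "((seq_space \<Rightarrow> real) \<Rightarrow> real) \<Rightarrow> nat \<Rightarrow> seq_space measure set"
  where "stationary_repr E n = {P \<in> max_repr E. distr P borel (shift_seq n) = P}"

definition periodic_repr :: "((seq_space \<Rightarrow> real) \<Rightarrow> real) \<Rightarrow> seq_space measure set"
  where "periodic_repr E = (\<Union>n\<in>{1..}. stationary_repr E n)"

definition extreme_periodic_repr :: "((seq_space \<Rightarrow> real) \<Rightarrow> real) \<Rightarrow> seq_space measure set"
  where "extreme_periodic_repr E = extreme_measures (max_repr E) \<inter> periodic_repr E"

end

theory Submission
  imports Defs
begin

text \<open>
  The heart of the matter is that a measure \<open>P\<close> that is extreme among the representing measures and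
  invariant under the \<open>n\<close>-shift has independent blocks of length \<open>n\<close>. If \<open>B\<close> is an event of the first
  \<open>n\<close> coordinates, then the conditional law of the shifted sequence given \<open>B\<close> is again a representing
  measure (\<open>cond_shift_max_repr\<close>): independence under \<open>E\<close> means that the best constant bound for the
  future does not depend on the past. Invariance exhibits \<open>P\<close> as the mixture of the conditional laws
  given \<open>B\<close> and given its complement, so extremality makes both equal to \<open>P\<close>
  (\<open>past_future_indep\<close>). As the same holds for all multiples of \<open>n\<close>, a tail event is independent of
  every past event, hence of itself (\<open>zero_one_law\<close>). In particular the \<open>n\<close>-shift is ergodic, and the
  ergodic theorem, applied to the sum of a block, shows that the averages converge to the
  expected average over a block (\<open>averages_tendsto\<close>).

  For the other direction one has to produce many extreme periodic measures. A representing measure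
  is one for which all conditional laws of a coordinate given the past lie in the set of the
  one-dimensional laws that are dominated by \<open>E\<close>. This set is weakly compact by regularity and
  Helly's theorem, so that every bounded continuous function attains its largest mean at an extreme
  point of it (\<open>ex_extreme_maximizer\<close>). Measures whose conditional laws are extreme are themselves
  extreme (\<open>law_extreme\<close>). They can be sampled from independent variables \<open>Z (k, i)\<close>, where \<open>Z (k, i)\<close>
  has the law \<open>\<mu> k i\<close>, by letting the past choose the index \<open>i\<close> that is used at time \<open>k\<close>; a countable
  choice suffices because optimal laws for one past are nearly optimal for all nearby pasts
  (\<open>countable_near_optimal_laws\<close>). If the choice restarts after each block of length \<open>n\<close>, the measure is
  invariant under the \<open>n\<close>-shift, and if it is nearly optimal for a given function of the first \<open>n\<close>
  coordinates, backward induction shows that its mean nearly attains \<open>E\<close>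
  (\<open>extreme_periodic_near_optimal\<close>). This is the representation of \<open>E\<close>, because every bounded continuous
  function can be approximated by Lipschitz functions of finitely many coordinates.

  Finally, choosing deterministically a law of nearly maximal mean in \<open>p\<close> of the \<open>n\<close> positions, and one
  of nearly minimal mean in the others, gives limits of averages that are dense in the interval
  between the lower and the upper mean (\<open>mean_limit_dense\<close>).
\<close>

section \<open>The ergodic theorem for an ergodic map\<close>

definition birkhoff_sum :: "('a \<Rightarrow> 'a) \<Rightarrow> ('a \<Rightarrow> real) \<Rightarrow> nat \<Rightarrow> 'a \<Rightarrow> real"
  where "birkhoff_sum T f n x = (\<Sum>j<n. f ((T ^^ j) x))"

lemma birkhoff_sum_0 [simp]: "birkhoff_sum T f 0 x = 0"
  by (simp add: birkhoff_sum_def)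

lemma birkhoff_sum_Suc: "birkhoff_sum T f (Suc n) x = f x + birkhoff_sum T f n (T x)"
  unfolding birkhoff_sum_def sum.lessThan_Suc_shift by (simp add: funpow_swap1)

text \<open>
  The maximum of the Birkhoff sums of length at most \<open>n\<close>, the empty sum included. In this recursive
  form the two properties used in the maximal inequality are immediate.
\<close>

fun birkhoff_max :: "('a \<Rightarrow> 'a) \<Rightarrow> ('a \<Rightarrow> real) \<Rightarrow> nat \<Rightarrow> 'a \<Rightarrow> real" where
  "birkhoff_max T f 0 x = 0"
| "birkhoff_max T f (Suc n) x = max 0 (f x + birkhoff_max T f n (T x))"

lemma birkhoff_max_nonneg: "0 \<le> birkhoff_max T f n x"
  by (cases n) auto

lemma birkhoff_max_mono_Suc: "birkhoff_max T f n x \<le> birkhoff_max T f (Suc n) x"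
proof (induction n arbitrary: x)
  case (Suc n)
  have "f x + birkhoff_max T f n (T x) \<le> f x + birkhoff_max T f (Suc n) (T x)"
    using Suc by (intro add_left_mono)
  then show ?case
    unfolding birkhoff_max.simps(2)[of T f n x] birkhoff_max.simps(2)[of T f "Suc n" x]
    by (intro max.mono) auto
qed simp

lemma birkhoff_sum_le_max: "k \<le> n \<Longrightarrow> birkhoff_sum T f k x \<le> birkhoff_max T f n x"
proof (induction n arbitrary: k x)
  case (Suc n)
  show ?case
  proof (cases k)
    case (Suc j)
    with Suc.prems Suc.IH[of j "T x"] show ?thesis
      by (simp add: birkhoff_sum_Suc le_max_iff_disj)
  qed (simp add: birkhoff_max_nonneg)
qed simp

locale measure_preserving = prob_space M for M +
  fixes T :: "'a \<Rightarrow> 'a"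
  assumes T_measurable [measurable]: "T \<in> measurable M M"
    and T_preserves: "distr M M T = M"
begin

lemma integral_comp_T: "f \<in> borel_measurable M \<Longrightarrow> (\<integral>x. f (T x) \<partial>M) = (\<integral>x. f x \<partial>M)" for f :: "'a \<Rightarrow> real"
  using integral_distr[OF T_measurable, of f] by (simp add: T_preserves)

lemma integrable_comp_T: "integrable M f \<Longrightarrow> integrable M (\<lambda>x. f (T x))" for f :: "'a \<Rightarrow> real"
  using integrable_distr[OF T_measurable, of f] by (simp add: T_preserves)

lemma T_pow_measurable [measurable]: "(T ^^ n) \<in> measurable M M"
  by (induction n) (auto intro: measurable_comp simp: id_def)

lemma birkhoff_sum_measurable [measurable]:
  "f \<in> borel_measurable M \<Longrightarrow> birkhoff_sum T f n \<in> borel_measurable M"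
  unfolding birkhoff_sum_def[abs_def]
  by (intro borel_measurable_sum measurable_compose[OF T_pow_measurable])

lemma birkhoff_max_integrable:
  assumes f: "integrable M f"
  shows "integrable M (birkhoff_max T f n)"
proof (induction n)
  case 0
  have "birkhoff_max T f 0 = (\<lambda>_. 0)" by auto
  then show ?case by simp
next
  case (Suc n)
  have "integrable M (\<lambda>x. max 0 (f x + birkhoff_max T f n (T x)))"
    by (intro integrable_max integrable_zero Bochner_Integration.integrable_add f
        integrable_comp_T[OF Suc])
  then show ?case by simp
qed

text \<open>
  Garsia's argument: where the maximum \<open>F (Suc n)\<close> of the Birkhoff sums is positive, it equals
  \<open>f + F n \<circ> T\<close>, so there \<open>f\<close> is at least \<open>F (Suc n) - F (Suc n) \<circ> T\<close>, a function of integral zero.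
\<close>

lemma maximal_ergodic:
  assumes f: "integrable M f" and pos: "AE x in M. \<exists>n. birkhoff_sum T f n x > 0"
  shows "0 \<le> (\<integral>x. f x \<partial>M)"
proof -
  define F where "F n = birkhoff_max T f n" for n
  have F_int: "integrable M (F n)" for n
    unfolding F_def by (rule birkhoff_max_integrable[OF f])
  note [measurable] = borel_measurable_integrable[OF f] borel_measurable_integrable[OF F_int]
  have nonneg: "0 \<le> (\<integral>x. indicator {y. F (Suc n) y > 0} x * f x \<partial>M)" for n
  proof -
    have "0 = (\<integral>x. F (Suc n) x - F (Suc n) (T x) \<partial>M)"
      by (subst Bochner_Integration.integral_diff)
         (auto simp: F_int integrable_comp_T integral_comp_T)
    also have "\<dots> \<le> (\<integral>x. indicator {y. F (Suc n) y > 0} x * f x \<partial>M)"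
    proof (rule integral_mono)
      show "integrable M (\<lambda>x. F (Suc n) x - F (Suc n) (T x))"
        by (intro Bochner_Integration.integrable_diff F_int integrable_comp_T)
      show "integrable M (\<lambda>x. indicator {y. F (Suc n) y > 0} x * f x)"
        by (rule Bochner_Integration.integrable_bound[OF f]) (auto simp: indicator_def)
      fix x
      show "F (Suc n) x - F (Suc n) (T x) \<le> indicator {y. F (Suc n) y > 0} x * f x"
      proof (cases "F (Suc n) x > 0")
        case True
        then have "F (Suc n) x = f x + F n (T x)" by (simp add: F_def max_def split: if_splits)
        then show ?thesis using True birkhoff_max_mono_Suc[of T f n "T x"] by (simp add: F_def)
      next
        case False
        then show ?thesis
          using birkhoff_max_nonneg[of T f "Suc n" "T x"] by (simp add: F_def)
      qed
    qed
    finally show ?thesis .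
  qed
  have "(\<lambda>n. \<integral>x. indicator {y. F (Suc n) y > 0} x * f x \<partial>M) \<longlonglongrightarrow> (\<integral>x. f x \<partial>M)"
  proof (rule integral_dominated_convergence[where w = "\<lambda>x. norm (f x)"])
    show "AE x in M. (\<lambda>n. indicator {y. F (Suc n) y > 0} x * f x) \<longlonglongrightarrow> f x"
      using pos
    proof eventually_elim
      case (elim x)
      then obtain k where k: "birkhoff_sum T f k x > 0" by auto
      have "eventually (\<lambda>n. indicator {y. F (Suc n) y > 0} x * f x = f x) sequentially"
        using eventually_ge_at_top[of k]
      proof eventually_elim
        case (elim n)
        then have "F (Suc n) x > 0"
          using birkhoff_sum_le_max[of k "Suc n" T f x] k by (simp add: F_def del: birkhoff_max.simps)
        then show ?case by simp
      qed
      then show ?case by (rule tendsto_eventually)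
    qed
  qed (use f in \<open>auto simp: indicator_def\<close>)
  then show ?thesis
    by (rule LIMSEQ_le_const) (use nonneg in auto)
qed

end

locale ergodic = measure_preserving +
  assumes invariant_trivial: "A \<in> sets M \<Longrightarrow> T -` A \<inter> space M = A \<Longrightarrow> prob A = 0 \<or> prob A = 1"
begin

text \<open>
  The event that the Birkhoff sums exceed \<open>c * n\<close> by arbitrarily large amounts is visibly
  invariant, unlike events about \<open>limsup\<close>, whose invariance needs a limit argument. If it had
  probability one, the maximal inequality for \<open>f - c\<close> would give \<open>c \<le> \<integral>f\<close>.
\<close>

lemma birkhoff_sum_upper:
  assumes f: "integrable M f" and c: "(\<integral>x. f x \<partial>M) < c"
  shows "AE x in M. \<exists>K::nat. \<forall>n. birkhoff_sum T f n x \<le> c * n + K"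
proof -
  note [measurable] = borel_measurable_integrable[OF f]
  define A where "A = {x \<in> space M. \<forall>K::nat. \<exists>n. birkhoff_sum T f n x > c * n + K}"
  have [measurable]: "A \<in> sets M" unfolding A_def by measurable
  have Tspace: "x \<in> space M \<Longrightarrow> T x \<in> space M" for x
    using measurable_space[OF T_measurable] by auto
  have inv: "T x \<in> A \<longleftrightarrow> x \<in> A" if x: "x \<in> space M" for x
  proof
    assume "T x \<in> A"
    show "x \<in> A" unfolding A_def
    proof (intro CollectI conjI allI x)
      fix K :: nat
      obtain L :: nat where L: "L \<ge> K + \<bar>c\<bar> + \<bar>f x\<bar>" using real_arch_simple by blast
      from \<open>T x \<in> A\<close> obtain n where "birkhoff_sum T f n (T x) > c * n + L"
        by (auto simp: A_def)
      then have "birkhoff_sum T f (Suc n) x > c * real (Suc n) + real K"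
        using L by (simp add: birkhoff_sum_Suc algebra_simps)
      then show "\<exists>n. birkhoff_sum T f n x > c * n + K" by blast
    qed
  next
    assume "x \<in> A"
    show "T x \<in> A" unfolding A_def
    proof (intro CollectI conjI allI Tspace x)
      fix K :: nat
      obtain L :: nat where L: "L \<ge> K + \<bar>c\<bar> + \<bar>f x\<bar>" using real_arch_simple by blast
      from \<open>x \<in> A\<close> obtain n where n: "birkhoff_sum T f n x > c * n + L"
        by (auto simp: A_def)
      then obtain m where m: "n = Suc m" by (cases n) auto
      from n have "birkhoff_sum T f m (T x) > c * real m + real K"
        using L by (simp add: m birkhoff_sum_Suc algebra_simps)
      then show "\<exists>n. birkhoff_sum T f n (T x) > c * n + K" by blast
    qed
  qed
  have "T -` A \<inter> space M = A"
    using inv sets.sets_into_space[of A M] by (auto dest: inv[THEN iffD1] inv[THEN iffD2])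
  then have "prob A = 0 \<or> prob A = 1" by (intro invariant_trivial) auto
  moreover have "prob A \<noteq> 1"
  proof
    assume "prob A = 1"
    then have "AE x in M. x \<in> A" by (simp add: prob_eq_1)
    then have "AE x in M. \<exists>n. birkhoff_sum T (\<lambda>x. f x - c) n x > 0"
    proof eventually_elim
      case (elim x)
      then obtain n where "birkhoff_sum T f n x > c * n + (0::nat)" unfolding A_def by blast
      then have "birkhoff_sum T (\<lambda>x. f x - c) n x > 0"
        by (simp add: birkhoff_sum_def sum_subtractf mult.commute)
      then show ?case by blast
    qed
    from maximal_ergodic[OF _ this] f have "0 \<le> (\<integral>x. f x - c \<partial>M)" by simp
    with f c show False by (simp add: prob_space)
  qed
  ultimately have "AE x in M. x \<notin> A" by (simp add: prob_eq_0)
  then show ?thesis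
    by (rule AE_mp) (auto intro!: AE_I2 simp: A_def not_less)
qed

text \<open>
  The bound by a line of slope slightly above the mean, for \<open>f\<close> and for \<open>- f\<close>.
\<close>

theorem birkhoff_average_tendsto:
  assumes f: "integrable M f"
  shows "AE x in M. (\<lambda>n. birkhoff_sum T f n x / n) \<longlonglongrightarrow> (\<integral>x. f x \<partial>M)"
proof -
  define a where "a = (\<integral>x. f x \<partial>M)"
  have up: "AE x in M. \<forall>j::nat. \<exists>K::nat. \<forall>n. birkhoff_sum T f n x \<le> (a + 1 / Suc j) * n + K"
    unfolding AE_all_countable a_def
    by (intro allI birkhoff_sum_upper f) simp
  have lo: "AE x in M. \<forall>j::nat. \<exists>K::nat. \<forall>n. birkhoff_sum T (\<lambda>x. - f x) n x \<le> (- a + 1 / Suc j) * n + K"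
    unfolding AE_all_countable a_def
    by (intro allI birkhoff_sum_upper Bochner_Integration.integrable_minus f) simp
  from up lo show ?thesis unfolding a_def[symmetric]
  proof eventually_elim
    case (elim x)
    show ?case
    proof (rule LIMSEQ_I)
      fix r :: real assume "r > 0"
      then obtain j :: nat where "inverse (real (Suc j)) < r / 2" using reals_Archimedean[of "r/2"] by auto
      then have j: "1 / real (Suc j) < r / 2" by (simp add: inverse_eq_divide)
      from elim obtain K1 K2 :: nat where
        K1: "\<And>n. birkhoff_sum T f n x \<le> (a + 1 / Suc j) * n + K1" and
        K2: "\<And>n. birkhoff_sum T (\<lambda>x. - f x) n x \<le> (- a + 1 / Suc j) * n + K2" by meson
      obtain N :: nat where N: "real N > (K1 + K2) / (r / 2)" using reals_Archimedean2 by blast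
      show "\<exists>N. \<forall>n\<ge>N. norm (birkhoff_sum T f n x / real n - a) < r"
      proof (intro exI allI impI)
        fix n assume n: "n \<ge> Suc N"
        then have npos: "real n > 0" by simp
        have "real n > (K1 + K2) / (r / 2)" using N n by simp
        then have KK: "K1 + K2 < n * (r / 2)" using \<open>r > 0\<close> by (simp add: field_simps)
        have e: "1 / real (Suc j) * n < r / 2 * n" using j npos by (intro mult_strict_right_mono)
        have b: "birkhoff_sum T (\<lambda>x. - f x) n x = - birkhoff_sum T f n x"
          by (simp add: birkhoff_sum_def sum_negf)
        have s: "(c + 1 / Suc j) * n = c * n + 1 / real (Suc j) * n" for c :: real
          by (rule distrib_right)
        have e': "r * n = r / 2 * n + n * (r / 2)" by simp
        have "birkhoff_sum T f n x - a * n < r * n" "- (birkhoff_sum T f n x - a * n) < r * n"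
          using K1[of n] K2[of n] KK e unfolding b s mult_minus_left of_nat_add e' by linarith+
        then have "\<bar>birkhoff_sum T f n x - a * n\<bar> < r * n" by simp
        moreover have "birkhoff_sum T f n x / n - a = (birkhoff_sum T f n x - a * n) / n"
          using npos by (simp add: field_simps)
        ultimately show "norm (birkhoff_sum T f n x / n - a) < r"
          using npos by (simp add: field_simps abs_divide)
      qed
    qed
  qed
qed

end

section \<open>Extreme points of weakly compact sets of laws on the line\<close>

text \<open>
  A mixture of measures is only known through its values on sets; the usual passage through simple
  functions extends this to integrals.
\<close>

lemma nn_integral_convex_comb:
  assumes sets: "sets Q = sets P" "sets R = sets P" and t: "0 \<le> a" "0 \<le> b"
    and comb: "\<And>A. A \<in> sets P \<Longrightarrow> emeasure P A = ennreal a * emeasure Q A + ennreal b * emeasure R A"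
    and g: "g \<in> borel_measurable P"
  shows "(\<integral>\<^sup>+x. g x \<partial>P) = ennreal a * (\<integral>\<^sup>+x. g x \<partial>Q) + ennreal b * (\<integral>\<^sup>+x. g x \<partial>R)"
  using g
proof (induction rule: borel_measurable_induct)
  case (cong f g)
  have sp: "space Q = space P" "space R = space P" using sets by (auto dest: sets_eq_imp_space_eq)
  have "(\<integral>\<^sup>+x. f x \<partial>P) = (\<integral>\<^sup>+x. g x \<partial>P)" "(\<integral>\<^sup>+x. f x \<partial>Q) = (\<integral>\<^sup>+x. g x \<partial>Q)"
    "(\<integral>\<^sup>+x. f x \<partial>R) = (\<integral>\<^sup>+x. g x \<partial>R)"
    by (rule nn_integral_cong; use cong(3) sp in simp)+
  then show ?case using cong by simp
next
  case (set A)
  then show ?case using comb sets by simp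
next
  case (mult u c)
  then have "u \<in> borel_measurable Q" "u \<in> borel_measurable R"
    using sets by (auto cong: measurable_cong_sets)
  then show ?case using mult by (simp add: nn_integral_cmult distrib_left mult_ac)
next
  case (add u v)
  then have "u \<in> borel_measurable Q" "u \<in> borel_measurable R" "v \<in> borel_measurable Q" "v \<in> borel_measurable R"
    using sets by (auto cong: measurable_cong_sets)
  then show ?case using add by (simp add: nn_integral_add distrib_left add_ac)
next
  case (seq U)
  have m: "U i \<in> borel_measurable Q" "U i \<in> borel_measurable R" for i
    using seq(1)[of i] sets by (auto cong: measurable_cong_sets)
  have lim: "(\<lambda>i. \<integral>\<^sup>+x. U i x \<partial>M) \<longlonglongrightarrow> (\<integral>\<^sup>+x. (SUP i. U i) x \<partial>M)"
    if "\<And>i. U i \<in> borel_measurable M" for M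
  proof -
    have "(\<integral>\<^sup>+x. (SUP i. U i) x \<partial>M) = (SUP i. \<integral>\<^sup>+x. U i x \<partial>M)"
      using nn_integral_monotone_convergence_SUP[OF \<open>incseq U\<close>, of M] that by (simp add: image_image)
    moreover have "incseq (\<lambda>i. \<integral>\<^sup>+x. U i x \<partial>M)"
      using \<open>incseq U\<close> by (auto simp: incseq_def le_fun_def intro!: nn_integral_mono)
    ultimately show ?thesis using LIMSEQ_SUP by metis
  qed
  have "(\<lambda>i. ennreal a * (\<integral>\<^sup>+x. U i x \<partial>Q) + ennreal b * (\<integral>\<^sup>+x. U i x \<partial>R)) \<longlonglongrightarrow>
      ennreal a * (\<integral>\<^sup>+x. (SUP i. U i) x \<partial>Q) + ennreal b * (\<integral>\<^sup>+x. (SUP i. U i) x \<partial>R)"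
    by (intro tendsto_add ennreal_tendsto_cmult lim m) auto
  with seq.IH have "(\<lambda>i. \<integral>\<^sup>+x. U i x \<partial>P) \<longlonglongrightarrow>
      ennreal a * (\<integral>\<^sup>+x. (SUP i. U i) x \<partial>Q) + ennreal b * (\<integral>\<^sup>+x. (SUP i. U i) x \<partial>R)" by simp
  from LIMSEQ_unique[OF lim[OF seq(1)] this] show ?case by simp
qed

lemma integral_convex_comb:
  fixes g :: "'a \<Rightarrow> real"
  assumes "prob_space P" "prob_space Q" "prob_space R"
    and sets: "sets Q = sets P" "sets R = sets P" and t: "0 < t" "t < 1"
    and comb: "\<And>A. A \<in> sets P \<Longrightarrow> measure P A = t * measure Q A + (1 - t) * measure R A"
    and g [measurable]: "g \<in> borel_measurable P" and bd: "\<And>x. \<bar>g x\<bar> \<le> B"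
  shows "(\<integral>x. g x \<partial>P) = t * (\<integral>x. g x \<partial>Q) + (1 - t) * (\<integral>x. g x \<partial>R)"
proof -
  have gQ [measurable]: "g \<in> borel_measurable Q" and gR [measurable]: "g \<in> borel_measurable R"
    using g sets by (auto cong: measurable_cong_sets)
  have nn: "0 \<le> g x + B" for x using bd[of x] by linarith
  have nb: "g x + B \<le> 2 * B" for x using bd[of x] by linarith
  have B: "0 \<le> B" using bd[of undefined] by linarith
  have *: "integrable M g \<and> (\<integral>\<^sup>+x. ennreal (g x + B) \<partial>M) = ennreal ((\<integral>x. g x \<partial>M) + B)
       \<and> 0 \<le> (\<integral>x. g x \<partial>M) + B"
    if M: "prob_space M" and [measurable]: "g \<in> borel_measurable M" for M
  proof -
    interpret prob_space M by fact
    have i: "integrable M g" by (rule integrable_const_bound[where B = B]) (use bd in auto)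
    then have i': "integrable M (\<lambda>x. g x + B)" by simp
    have e: "(\<integral>x. g x + B \<partial>M) = (\<integral>x. g x \<partial>M) + B" using i by (simp add: prob_space)
    have "0 \<le> (\<integral>x. g x + B \<partial>M)" using nn by (intro integral_nonneg_AE) auto
    with nn_integral_eq_integral[OF i'] nn i show ?thesis unfolding e by simp
  qed
  have em: "emeasure P A = ennreal t * emeasure Q A + ennreal (1 - t) * emeasure R A" if A: "A \<in> sets P" for A
  proof -
    interpret P: prob_space P by fact
    interpret Q: prob_space Q by fact
    interpret R: prob_space R by fact
    show ?thesis
      using t comb[OF A]
      by (simp add: P.emeasure_eq_measure Q.emeasure_eq_measure R.emeasure_eq_measure
          flip: ennreal_mult ennreal_plus)
  qed
  have "(\<integral>\<^sup>+x. ennreal (g x + B) \<partial>P) =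
      ennreal t * (\<integral>\<^sup>+x. ennreal (g x + B) \<partial>Q) + ennreal (1 - t) * (\<integral>\<^sup>+x. ennreal (g x + B) \<partial>R)"
    by (rule nn_integral_convex_comb) (use sets em t in auto)
  then have "ennreal ((\<integral>x. g x \<partial>P) + B) =
      ennreal (t * ((\<integral>x. g x \<partial>Q) + B) + (1 - t) * ((\<integral>x. g x \<partial>R) + B))"
    using * [OF assms(1)] *[OF assms(2) gQ] *[OF assms(3) gR] t
    by (simp flip: ennreal_mult ennreal_plus)
  then have "(\<integral>x. g x \<partial>P) + B = t * ((\<integral>x. g x \<partial>Q) + B) + (1 - t) * ((\<integral>x. g x \<partial>R) + B)"
    using * [OF assms(1)] *[OF assms(2) gQ] *[OF assms(3) gR] t
    by (subst (asm) ennreal_inj) auto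
  then show ?thesis by (simp add: algebra_simps)
qed

lemma attains_sup_if_sequentially_compact:
  fixes F :: "'a \<Rightarrow> real"
  assumes ne: "S \<noteq> {}" and bd: "\<And>x. x \<in> S \<Longrightarrow> F x \<le> B"
    and compact: "\<And>u :: nat \<Rightarrow> 'a. (\<And>n. u n \<in> S) \<Longrightarrow>
      \<exists>r x. strict_mono (r :: nat \<Rightarrow> nat) \<and> x \<in> S \<and> (\<lambda>n. F (u (r n))) \<longlonglongrightarrow> F x"
  obtains x where "x \<in> S" "\<And>y. y \<in> S \<Longrightarrow> F y \<le> F x" "F x = (SUP x\<in>S. F x)"
proof -
  have bdd: "bdd_above (F ` S)" using bd by (auto intro!: bdd_aboveI)
  define s where "s = (SUP x\<in>S. F x)"
  have "\<exists>x\<in>S. F x > s - 1 / Suc n" for n :: nat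
  proof -
    have "s - 1 / Suc n < (SUP x\<in>S. F x)" unfolding s_def by simp
    then show ?thesis using less_cSUP_iff[OF ne bdd] by auto
  qed
  then obtain u where u: "\<And>n. u n \<in> S" "\<And>n. F (u n) > s - 1 / Suc n" by metis
  obtain r x where r: "strict_mono (r :: nat \<Rightarrow> nat)" "x \<in> S" "(\<lambda>n. F (u (r n))) \<longlonglongrightarrow> F x"
    using compact[of u] u(1) by blast
  have up: "F y \<le> s" if "y \<in> S" for y unfolding s_def using that bdd by (rule cSUP_upper)
  have "(\<lambda>n. F (u n)) \<longlonglongrightarrow> s"
  proof (rule tendsto_sandwich)
    show "(\<lambda>n. s - 1 / Suc n) \<longlonglongrightarrow> s"
      using tendsto_diff[OF tendsto_const[of s] LIMSEQ_Suc[OF lim_1_over_n]] by simp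
      show "\<forall>\<^sub>F n in sequentially. s - 1 / Suc n \<le> F (u n)"
      using u(2) by (intro always_eventually allI less_imp_le)
    show "\<forall>\<^sub>F n in sequentially. F (u n) \<le> s" by (intro always_eventually allI up u(1))
  qed simp
  from LIMSEQ_subseq_LIMSEQ[OF this r(1)] have "(\<lambda>n. F (u (r n))) \<longlonglongrightarrow> s" by (simp add: o_def)
  from LIMSEQ_unique[OF this r(3)] have "F x = s" by simp
  then show thesis using that[OF r(2)] up s_def by auto
qed

text \<open>
  Compactness is meant sequentially, in the form provided by Helly's selection theorem.
\<close>

definition weakly_compact :: "real measure set \<Rightarrow> bool"
  where "weakly_compact S \<longleftrightarrow> (\<forall>\<mu>\<in>S. real_distribution \<mu>) \<and>
    (\<forall>u. (\<forall>n. u n \<in> S) \<longrightarrow> (\<exists>r \<mu>. strict_mono (r :: nat \<Rightarrow> nat) \<and> \<mu> \<in> S \<and> weak_conv_m (\<lambda>n. u (r n)) \<mu>))"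

lemma weak_conv_m_integral:
  fixes \<psi> :: "real \<Rightarrow> real"
  assumes "\<And>n. real_distribution (u n)" "real_distribution \<mu>" "weak_conv_m u \<mu>" "\<psi> \<in> Cb"
  shows "(\<lambda>n. integral\<^sup>L (u n) \<psi>) \<longlonglongrightarrow> integral\<^sup>L \<mu> \<psi>"
proof -
  obtain B where B: "\<And>x. norm (\<psi> x) \<le> B"
    using assms(4) unfolding bcontfun_def by (auto simp: bounded_iff)
  have "\<And>x. isCont \<psi> x" using assms(4) unfolding bcontfun_def by (auto simp: continuous_on_eq_continuous_at)
  then show ?thesis by (rule weak_conv_imp_integral_bdd_continuous_conv[OF assms(1-3) _ B])
qed

lemma weakly_compact_attains_sup:
  assumes S: "weakly_compact S" "S \<noteq> {}" and \<psi>: "\<psi> \<in> Cb"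
  obtains \<mu> where "\<mu> \<in> S" "\<And>\<nu>. \<nu> \<in> S \<Longrightarrow> integral\<^sup>L \<nu> \<psi> \<le> integral\<^sup>L \<mu> \<psi>"
    "integral\<^sup>L \<mu> \<psi> = (SUP \<mu>\<in>S. integral\<^sup>L \<mu> \<psi>)"
proof -
  obtain B where B: "\<And>x. \<bar>\<psi> x\<bar> \<le> B"
    using \<psi> unfolding bcontfun_def by (auto simp: bounded_iff)
  have [measurable]: "\<psi> \<in> borel_measurable borel"
    using \<psi> unfolding bcontfun_def by (auto intro: borel_measurable_continuous_onI)
  have le: "integral\<^sup>L \<mu> \<psi> \<le> B" if "\<mu> \<in> S" for \<mu>
  proof -
    interpret real_distribution \<mu> using S(1) that by (auto simp: weakly_compact_def)
    show ?thesis
      using B by (intro integral_le_const integrable_const_bound[where B = B]) (auto simp: abs_le_iff)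
  qed
  show thesis
  proof (rule attains_sup_if_sequentially_compact[of S "\<lambda>\<mu>. integral\<^sup>L \<mu> \<psi>", OF S(2) le])
    fix u :: "nat \<Rightarrow> real measure" assume u: "\<And>n. u n \<in> S"
    then obtain r \<mu> where r: "strict_mono (r :: nat \<Rightarrow> nat)" "\<mu> \<in> S" "weak_conv_m (\<lambda>n. u (r n)) \<mu>"
      using S(1) unfolding weakly_compact_def by blast
    have "(\<lambda>n. integral\<^sup>L (u (r n)) \<psi>) \<longlonglongrightarrow> integral\<^sup>L \<mu> \<psi>"
      by (rule weak_conv_m_integral[OF _ _ r(3) \<psi>]) (use S(1) u r in \<open>auto simp: weakly_compact_def\<close>)
    with r show "\<exists>r \<mu>. strict_mono (r :: nat \<Rightarrow> nat) \<and> \<mu> \<in> S \<and> (\<lambda>n. integral\<^sup>L (u (r n)) \<psi>) \<longlonglongrightarrow> integral\<^sup>L \<mu> \<psi>"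
      by blast
  qed (use that in auto)
qed

text \<open>
  A weakly continuous and strictly convex function of the law. It is a sum of squared moduli of the
  affine functions \<open>\<mu> \<mapsto> char \<mu> q\<close>, where \<open>q\<close> runs through the rationals, and the values of a
  characteristic function at the rationals determine the law.
\<close>

definition char_energy :: "real measure \<Rightarrow> real"
  where "char_energy \<mu> = (\<Sum>k. (1/2) ^ k * (cmod (char \<mu> (real_of_rat (from_nat k))))\<^sup>2)"

lemma char_energy_summable:
  assumes "real_distribution \<mu>"
  shows "summable (\<lambda>k. (1/2) ^ k * (cmod (char \<mu> (real_of_rat (from_nat k))))\<^sup>2)"
proof (rule summable_comparison_test')
  show "summable (\<lambda>k. (1/2 :: real) ^ k)" by (rule summable_geometric) simp
  show "norm ((1/2) ^ k * (cmod (char \<mu> (real_of_rat (from_nat k))))\<^sup>2) \<le> (1/2) ^ k" if "k \<ge> 0" for k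
    using real_distribution.cmod_char_le_1[OF assms]
    by (auto simp: abs_mult mult_left_le power_le_one)
qed

lemma char_energy_le:
  assumes "real_distribution \<mu>"
  shows "char_energy \<mu> \<le> 2"
proof -
  have "char_energy \<mu> \<le> (\<Sum>k. (1/2) ^ k)" unfolding char_energy_def
    using real_distribution.cmod_char_le_1[OF assms]
    by (intro suminf_le char_energy_summable assms summable_geometric) (auto simp: mult_left_le power_le_one)
  also have "\<dots> = 2" using suminf_geometric[of "1/2::real"] by simp
  finally show ?thesis .
qed

text \<open>
  Each term converges by the continuity of characteristic functions, and the geometric weights
  dominate all of the sums.
\<close>

lemma char_energy_tendsto:
  assumes "\<And>n. real_distribution (u n)" "real_distribution \<mu>" "weak_conv_m u \<mu>"
  shows "(\<lambda>n. char_energy (u n)) \<longlonglongrightarrow> char_energy \<mu>"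
proof -
  let ?q = "\<lambda>k. real_of_rat (from_nat k)"
  have "(\<lambda>n. \<Sum>k. (1/2) ^ k * (cmod (char (u n) (?q k)))\<^sup>2) \<longlonglongrightarrow>
        (\<Sum>k. (1/2) ^ k * (cmod (char \<mu> (?q k)))\<^sup>2)"
  proof (rule tannerys_theorem[THEN conjunct2, THEN conjunct2])
    show "(\<lambda>n. (1/2) ^ k * (cmod (char (u n) (?q k)))\<^sup>2) \<longlonglongrightarrow> (1/2) ^ k * (cmod (char \<mu> (?q k)))\<^sup>2" for k
      by (intro tendsto_intros levy_continuity1 assms)
    show "\<forall>\<^sub>F (k, n) in sequentially \<times>\<^sub>F sequentially.
        norm ((1/2) ^ k * (cmod (char (u n) (?q k)))\<^sup>2) \<le> (1/2) ^ k"
      using real_distribution.cmod_char_le_1[OF assms(1)]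
      by (intro always_eventually) (auto simp: abs_mult mult_left_le power_le_one)
    show "summable (\<lambda>k. (1/2 :: real) ^ k)" by (rule summable_geometric) simp
  qed simp
  then show ?thesis by (simp add: char_energy_def)
qed

text \<open>
  The last term measures the strictness of the convexity of the squared modulus.
\<close>

lemma cmod_square_convex_comb:
  "(cmod (complex_of_real t * z + complex_of_real (1 - t) * w))\<^sup>2 =
     t * (cmod z)\<^sup>2 + (1 - t) * (cmod w)\<^sup>2 - t * (1 - t) * (cmod (z - w))\<^sup>2"
  unfolding cmod_power2 by (simp add: power2_eq_square algebra_simps)

lemma char_eqI_rat:
  assumes \<mu>: "real_distribution \<mu>" and \<nu>: "real_distribution \<nu>"
    and eq: "\<And>k. char \<mu> (real_of_rat (from_nat k)) = char \<nu> (real_of_rat (from_nat k))"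
  shows "\<mu> = \<nu>"
proof (rule Levy_uniqueness[OF \<mu> \<nu>], rule ext)
  fix x :: real
  have "closed {t. char \<mu> t = char \<nu> t}"
    using \<mu> \<nu> by (intro closed_Collect_eq continuous_at_imp_continuous_on ballI real_distribution.isCont_char)
  moreover have "\<rat> \<subseteq> {t. char \<mu> t = char \<nu> t}"
  proof
    fix t :: real assume "t \<in> \<rat>"
    then obtain q where "t = real_of_rat q" by (auto elim: Rats_cases)
    then show "t \<in> {t. char \<mu> t = char \<nu> t}" using eq[of "to_nat q"] by simp
  qed
  ultimately have "closure \<rat> \<subseteq> {t. char \<mu> t = char \<nu> t}" by (intro closure_minimal)
  then show "char \<mu> x = char \<nu> x" by (auto simp: Rats_closure_real)
qed

lemma char_convex_comb:
  assumes "real_distribution P" "real_distribution Q" "real_distribution R"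
    and t: "0 < t" "t < 1"
    and comb: "\<And>A. A \<in> sets borel \<Longrightarrow> measure P A = t * measure Q A + (1 - t) * measure R A"
  shows "char P s = complex_of_real t * char Q s + complex_of_real (1 - t) * char R s"
proof -
  have c: "Re (char M s) = (\<integral>x. cos (s * x) \<partial>M)" "Im (char M s) = (\<integral>x. sin (s * x) \<partial>M)"
    if "real_distribution M" for M
  proof -
    interpret real_distribution M by fact
    have i: "complex_integrable M (\<lambda>x. iexp (s * x))" by (rule integrable_iexp) auto
    show "Re (char M s) = (\<integral>x. cos (s * x) \<partial>M)" "Im (char M s) = (\<integral>x. sin (s * x) \<partial>M)"
      unfolding char_def using integral_Re[OF i] integral_Im[OF i] by (simp_all add: Re_exp Im_exp)
  qed
  interpret P: real_distribution P by fact
  interpret Q: real_distribution Q by fact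
  interpret R: real_distribution R by fact
  have "(\<integral>x. g x \<partial>P) = t * (\<integral>x. g x \<partial>Q) + (1 - t) * (\<integral>x. g x \<partial>R)"
    if "g \<in> borel_measurable borel" "\<And>x. \<bar>g x\<bar> \<le> 1" for g :: "real \<Rightarrow> real"
    by (rule integral_convex_comb[where B = 1])
       (use that t comb in \<open>auto intro: P.prob_space_axioms Q.prob_space_axioms R.prob_space_axioms\<close>)
  from this[of "\<lambda>x. cos (s * x)"] this[of "\<lambda>x. sin (s * x)"] show ?thesis
    by (intro complex_eqI) (auto simp: c assms)
qed

text \<open>
  An instance of Bauer's maximum principle. The maximizers of \<open>\<psi>\<close> form a face \<open>F\<close> of \<open>S\<close>, and a strictly convex function attains its maximum over
  \<open>F\<close> only at points that are extreme in \<open>F\<close>, hence extreme in \<open>S\<close>.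
\<close>

lemma ex_extreme_maximizer:
  assumes S: "weakly_compact S" "S \<noteq> {}" and \<psi>: "\<psi> \<in> Cb"
  obtains \<mu> where "\<mu> \<in> extreme_measures S" "integral\<^sup>L \<mu> \<psi> = (SUP \<nu>\<in>S. integral\<^sup>L \<nu> \<psi>)"
proof -
  have rd: "real_distribution \<mu>" if "\<mu> \<in> S" for \<mu> using S(1) that by (auto simp: weakly_compact_def)
  obtain \<mu>0 where \<mu>0: "\<mu>0 \<in> S" "\<And>\<nu>. \<nu> \<in> S \<Longrightarrow> integral\<^sup>L \<nu> \<psi> \<le> integral\<^sup>L \<mu>0 \<psi>"
    "integral\<^sup>L \<mu>0 \<psi> = (SUP \<mu>\<in>S. integral\<^sup>L \<mu> \<psi>)"
    using weakly_compact_attains_sup[OF S \<psi>] by blast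
  define s where "s = integral\<^sup>L \<mu>0 \<psi>"
  define F where "F = {\<mu>\<in>S. integral\<^sup>L \<mu> \<psi> = s}"
  \<comment> \<open>The face is again sequentially compact, so the energy attains its maximum on it.\<close>
  obtain \<mu> where \<mu>: "\<mu> \<in> F" "\<And>\<nu>. \<nu> \<in> F \<Longrightarrow> char_energy \<nu> \<le> char_energy \<mu>"
  proof (rule attains_sup_if_sequentially_compact[of F char_energy])
    show "F \<noteq> {}" using \<mu>0 by (auto simp: F_def s_def)
    show "char_energy \<mu> \<le> 2" if "\<mu> \<in> F" for \<mu>
      by (rule char_energy_le) (use that rd in \<open>auto simp: F_def\<close>)
    fix u :: "nat \<Rightarrow> real measure" assume u: "\<And>n. u n \<in> F"
    then obtain r \<mu> where r: "strict_mono (r :: nat \<Rightarrow> nat)" "\<mu> \<in> S" "weak_conv_m (\<lambda>n. u (r n)) \<mu>"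
      using S(1) unfolding weakly_compact_def F_def by blast
    have rdu: "real_distribution (u (r n))" for n using u[of "r n"] rd by (auto simp: F_def)
    have "(\<lambda>n. integral\<^sup>L (u (r n)) \<psi>) \<longlonglongrightarrow> integral\<^sup>L \<mu> \<psi>"
      by (rule weak_conv_m_integral[OF rdu rd r(3) \<psi>]) fact
    moreover have "integral\<^sup>L (u (r n)) \<psi> = s" for n using u[of "r n"] by (simp add: F_def)
    ultimately have "integral\<^sup>L \<mu> \<psi> = s" by (simp add: LIMSEQ_const_iff)
    then have "\<mu> \<in> F" using r by (simp add: F_def)
    moreover have "(\<lambda>n. char_energy (u (r n))) \<longlonglongrightarrow> char_energy \<mu>"
      by (rule char_energy_tendsto[OF rdu rd r(3)]) fact
    ultimately show "\<exists>r \<mu>. strict_mono (r :: nat \<Rightarrow> nat) \<and> \<mu> \<in> F \<and> (\<lambda>n. char_energy (u (r n))) \<longlonglongrightarrow> char_energy \<mu>"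
      using r(1) by blast
  qed blast
  have \<mu>S: "\<mu> \<in> S" "integral\<^sup>L \<mu> \<psi> = s" using \<mu> by (auto simp: F_def)
  have "\<mu> \<in> extreme_measures S" unfolding extreme_measures_def
  proof (intro CollectI conjI ballI allI impI \<mu>S(1))
    fix Q R :: "real measure" and t :: real
    assume Q: "Q \<in> S" and R: "R \<in> S"
    assume t: "0 < t \<and> t < 1 \<and> (\<forall>A\<in>sets \<mu>. measure \<mu> A = t * measure Q A + (1 - t) * measure R A)"
    interpret M: real_distribution \<mu> using \<mu>S rd by simp
    interpret Q: real_distribution Q using Q rd by simp
    interpret R: real_distribution R using R rd by simp
    have comb: "measure \<mu> A = t * measure Q A + (1 - t) * measure R A" if "A \<in> sets borel" for A
      using t that by simp
    obtain B where B: "\<And>x. \<bar>\<psi> x\<bar> \<le> B"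
      using \<psi> unfolding bcontfun_def by (auto simp: bounded_iff)
    have [measurable]: "\<psi> \<in> borel_measurable borel"
      using \<psi> by (auto intro: borel_measurable_continuous_onI simp: bcontfun_def)
    have "integral\<^sup>L \<mu> \<psi> = t * integral\<^sup>L Q \<psi> + (1 - t) * integral\<^sup>L R \<psi>"
      by (rule integral_convex_comb[where B = B])
         (use t comb B in \<open>auto intro: M.prob_space_axioms Q.prob_space_axioms R.prob_space_axioms\<close>)
    then have eq: "t * (s - integral\<^sup>L Q \<psi>) + (1 - t) * (s - integral\<^sup>L R \<psi>) = 0"
      by (simp add: \<mu>S algebra_simps)
    have nn: "0 \<le> t * (s - integral\<^sup>L Q \<psi>)" "0 \<le> (1 - t) * (s - integral\<^sup>L R \<psi>)"
      using t \<mu>0(2)[OF Q] \<mu>0(2)[OF R] by (auto simp: s_def)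
    from eq nn have "t * (s - integral\<^sup>L Q \<psi>) = 0" "(1 - t) * (s - integral\<^sup>L R \<psi>) = 0" by linarith+
    then have "Q \<in> F" "R \<in> F" using t Q R by (auto simp: F_def)
    let ?q = "\<lambda>k. real_of_rat (from_nat k)"
    let ?d = "\<lambda>k. (1/2) ^ k * (cmod (char Q (?q k) - char R (?q k)))\<^sup>2"
    have e: "(1/2) ^ k * (cmod (char \<mu> (?q k)))\<^sup>2 =
        t * ((1/2) ^ k * (cmod (char Q (?q k)))\<^sup>2) + (1 - t) * ((1/2) ^ k * (cmod (char R (?q k)))\<^sup>2)
        - t * (1 - t) * ?d k" for k
    proof -
      have "char \<mu> (?q k) = complex_of_real t * char Q (?q k) + complex_of_real (1 - t) * char R (?q k)"
        by (rule char_convex_comb) (use t comb in \<open>auto intro: M.real_distribution_axioms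
          Q.real_distribution_axioms R.real_distribution_axioms\<close>)
      then show ?thesis by (simp only: cmod_square_convex_comb) (simp add: algebra_simps)
    qed
    note sm = char_energy_summable[OF M.real_distribution_axioms]
      char_energy_summable[OF Q.real_distribution_axioms] char_energy_summable[OF R.real_distribution_axioms]
    have sd: "summable (\<lambda>k. t * (1 - t) * ?d k)"
    proof -
      have "summable (\<lambda>k. t * ((1/2) ^ k * (cmod (char Q (?q k)))\<^sup>2)
          + (1 - t) * ((1/2) ^ k * (cmod (char R (?q k)))\<^sup>2) - (1/2) ^ k * (cmod (char \<mu> (?q k)))\<^sup>2)"
        by (intro summable_add summable_diff summable_mult sm)
      then show ?thesis by (simp add: e)
    qed
    have "char_energy \<mu> = (\<Sum>k. t * ((1/2) ^ k * (cmod (char Q (?q k)))\<^sup>2)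
        + (1 - t) * ((1/2) ^ k * (cmod (char R (?q k)))\<^sup>2) - t * (1 - t) * ?d k)"
      unfolding char_energy_def by (simp only: e)
    also have "\<dots> = t * char_energy Q + (1 - t) * char_energy R - (\<Sum>k. t * (1 - t) * ?d k)"
      unfolding char_energy_def using sm sd
      by (simp add: suminf_diff[symmetric] suminf_add[symmetric] suminf_mult[symmetric]
          summable_add summable_mult)
    finally have "char_energy \<mu> = t * char_energy Q + (1 - t) * char_energy R - (\<Sum>k. t * (1 - t) * ?d k)" .
    moreover have "t * char_energy Q + (1 - t) * char_energy R \<le> t * char_energy \<mu> + (1 - t) * char_energy \<mu>"
      using t \<mu>(2)[OF \<open>Q \<in> F\<close>] \<mu>(2)[OF \<open>R \<in> F\<close>] by (intro add_mono mult_left_mono) auto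
    ultimately have le0: "(\<Sum>k. t * (1 - t) * ?d k) \<le> 0" by (simp add: algebra_simps)
    have nn: "0 \<le> t * (1 - t) * ?d k" for k using t by simp
    have "(\<Sum>k. t * (1 - t) * ?d k) = 0" using le0 suminf_nonneg[OF sd nn] by linarith
    then have "t * (1 - t) * ?d k = 0" for k using suminf_eq_zero_iff[OF sd nn] by blast
    then have "char Q (?q k) = char R (?q k)" for k using t by simp
    then have "Q = R" by (intro char_eqI_rat Q.real_distribution_axioms R.real_distribution_axioms)
    moreover have "\<mu> = Q"
    proof (rule measure_eqI)
      fix A assume "A \<in> sets \<mu>"
      then have "measure \<mu> A = measure Q A" using comb[of A] \<open>Q = R\<close> by (simp add: algebra_simps)
      then show "emeasure \<mu> A = emeasure Q A" by (simp add: M.emeasure_eq_measure Q.emeasure_eq_measure)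
    qed simp
    ultimately show "Q = \<mu> " "R = \<mu>" by auto
  qed
  then show thesis using that \<mu>S \<mu>0(3) by (simp add: s_def)
qed

section \<open>The sequence space and its finite-dimensional distances\<close>

definition prefix_dist :: "nat \<Rightarrow> seq_space \<Rightarrow> seq_space \<Rightarrow> real"
  where "prefix_dist n x y = L2_set (\<lambda>i. x i - y i) {..<n}"

lemma prefix_dist_nonneg [simp]: "0 \<le> prefix_dist n x y"
  by (simp add: prefix_dist_def)

lemma prefix_dist_self [simp]: "prefix_dist n x x = 0"
  by (simp add: prefix_dist_def L2_set_def)

lemma prefix_dist_commute: "prefix_dist n x y = prefix_dist n y x"
  unfolding prefix_dist_def L2_set_def by (simp add: power2_commute)

lemma prefix_dist_triangle: "prefix_dist n x z \<le> prefix_dist n x y + prefix_dist n y z"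
  using L2_set_triangle_ineq[of "\<lambda>i. x i - y i" "\<lambda>i. y i - z i" "{..<n}"] by (simp add: prefix_dist_def)

lemma prefix_dist_mono: "n \<le> m \<Longrightarrow> prefix_dist n x y \<le> prefix_dist m x y"
  unfolding prefix_dist_def L2_set_def by (auto intro!: sum_mono2)

lemma prefix_dist_eq_0: "(\<And>i. i < n \<Longrightarrow> x i = y i) \<Longrightarrow> prefix_dist n x y = 0"
  unfolding prefix_dist_def by (rule L2_set_0') auto

lemma sum_lessThan_add: "sum f {..<n + m} = sum f {..<n} + (\<Sum>i<m. f (n + i))"
  for f :: "nat \<Rightarrow> real"
  by (induction m) (auto simp: add_ac)

lemma prefix_dist_join_right: "prefix_dist (n + m) (join_vec n y x) (join_vec n y x') = prefix_dist m x x'"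
  unfolding prefix_dist_def L2_set_def sum_lessThan_add by (simp add: join_vec_def)

lemma prefix_dist_join_left: "prefix_dist (n + m) (join_vec n y x) (join_vec n y' x) = prefix_dist n y y'"
  unfolding prefix_dist_def L2_set_def sum_lessThan_add by (simp add: join_vec_def)

lemma prefix_dist_shift: "prefix_dist m (shift_seq n x) (shift_seq n y) \<le> prefix_dist (n + m) x y"
  unfolding prefix_dist_def L2_set_def sum_lessThan_add by (simp add: shift_seq_def add.commute sum_nonneg)

text \<open>
  Overwriting the coordinates from \<open>n\<close> on by zero turns statements about the first \<open>n\<close> coordinates
  into statements about a continuous map of the sequence space to itself.
\<close>

definition truncate_seq :: "nat \<Rightarrow> seq_space \<Rightarrow> seq_space"
  where "truncate_seq n \<omega> = (\<lambda>k. if k < n then \<omega> k else 0)"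

lemma prefix_dist_truncate: "prefix_dist m (truncate_seq n x) (truncate_seq n y) \<le> prefix_dist n x y"
proof -
  have "(\<Sum>i<m. (truncate_seq n x i - truncate_seq n y i)\<^sup>2) = (\<Sum>i\<in>{..<m} \<inter> {..<n}. (x i - y i)\<^sup>2)"
    by (rule sum.mono_neutral_cong_right) (auto simp: truncate_seq_def)
  also have "\<dots> \<le> (\<Sum>i<n. (x i - y i)\<^sup>2)" by (rule sum_mono2) auto
  finally show ?thesis unfolding prefix_dist_def L2_set_def by simp
qed

lemma continuous_coord: "continuous_on UNIV (\<lambda>\<omega> :: seq_space. \<omega> k)"
  using continuous_on_product_then_coordinatewise[OF continuous_on_id, of UNIV k] by simp

lemma measurable_coord [measurable]: "(\<lambda>\<omega> :: seq_space. \<omega> k) \<in> borel_measurable borel"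
  by (rule borel_measurable_continuous_onI[OF continuous_coord])

lemma measurable_coord' [measurable]: "coord k \<in> borel_measurable borel"
  unfolding coord_def[abs_def] by measurable

lemma continuous_shift_seq: "continuous_on UNIV (shift_seq n)"
  unfolding shift_seq_def[abs_def]
  by (rule continuous_on_coordinatewise_then_product) (rule continuous_coord)

lemma measurable_shift_seq [measurable]: "shift_seq n \<in> measurable borel borel"
  by (rule borel_measurable_continuous_onI[OF continuous_shift_seq])

lemma continuous_truncate_seq: "continuous_on UNIV (truncate_seq n)"
  unfolding truncate_seq_def[abs_def]
proof (rule continuous_on_coordinatewise_then_product)
  show "continuous_on UNIV (\<lambda>\<omega> :: seq_space. if k < n then \<omega> k else 0)" for k
    by (cases "k < n") (auto intro: continuous_coord)
qed

lemma measurable_truncate_seq [measurable]: "truncate_seq n \<in> measurable borel borel"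
  by (rule borel_measurable_continuous_onI[OF continuous_truncate_seq])

lemma measurable_seqI:
  assumes "\<And>k. (\<lambda>x. f x k) \<in> borel_measurable M"
  shows "f \<in> measurable M (borel :: seq_space measure)"
  using measurable_coordinatewise_then_product[of f M, OF assms] .

text \<open>
  A basic neighbourhood in the product topology restricts only finitely many coordinates.
\<close>

lemma open_contains_cylinder:
  assumes "open U" "\<omega> \<in> U"
  obtains K \<delta> where "\<delta> > 0" "\<And>\<eta>. prefix_dist K \<omega> \<eta> < \<delta> \<Longrightarrow> \<eta> \<in> U"
proof -
  have "openin (product_topology (\<lambda>i. euclidean) UNIV) U"
    using assms(1) by (simp add: open_fun_def)
  from product_topology_open_contains_basis[OF this assms(2)]
  obtain X where X: "\<omega> \<in> (\<Pi>\<^sub>E i\<in>UNIV. X i)" "\<And>i. open (X i)" "finite {i. X i \<noteq> UNIV}"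
    "(\<Pi>\<^sub>E i\<in>UNIV. X i) \<subseteq> U" by auto
  let ?I = "{i. X i \<noteq> UNIV}"
  have "\<exists>d>0. \<forall>y. \<bar>y - \<omega> i\<bar> < d \<longrightarrow> y \<in> X i" for i
    using X(2)[of i] X(1) unfolding open_dist dist_real_def by (auto simp: PiE_def Pi_def)
  then obtain d where d: "\<And>i. d i > 0" "\<And>i y. \<bar>y - \<omega> i\<bar> < d i \<Longrightarrow> y \<in> X i" by metis
  define \<delta> where "\<delta> = Min (insert 1 (d ` ?I))"
  obtain K where K: "\<And>i. i \<in> ?I \<Longrightarrow> i < K"
    using finite_nat_bounded[OF X(3)] by auto
  show thesis
  proof (rule that[of \<delta> K])
    show "\<delta> > 0" unfolding \<delta>_def using X(3) d(1) by (subst Min_gr_iff) auto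
    fix \<eta> :: seq_space assume less: "prefix_dist K \<omega> \<eta> < \<delta>"
    have "\<eta> i \<in> X i" for i
    proof (cases "i \<in> ?I")
      case True
      then have "i < K" using K by blast
      have "\<bar>\<omega> i - \<eta> i\<bar> \<le> prefix_dist K \<omega> \<eta>"
        using member_le_L2_set[of "{..<K}" i "\<lambda>i. \<bar>\<omega> i - \<eta> i\<bar>"] \<open>i < K\<close> by (simp add: prefix_dist_def L2_set_def)
      also have "\<dots> < \<delta>" by fact
      also have "\<delta> \<le> d i" unfolding \<delta>_def using True X(3) by (intro Min_le) auto
      finally show ?thesis by (intro d(2)) (simp add: abs_minus_commute)
    qed simp
    then show "\<eta> \<in> U" using X(4) by (auto simp: PiE_def Pi_def)
  qed
qed

section \<open>Bounded continuous functions and Lipschitz cylinder functions\<close>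

lemma CbI: "continuous_on UNIV X \<Longrightarrow> (\<And>\<omega>. \<bar>X \<omega>\<bar> \<le> B) \<Longrightarrow> X \<in> Cb" for X :: "'a::topological_space \<Rightarrow> real"
  unfolding bcontfun_def by (auto simp: bounded_iff)

lemma CbE:
  fixes X :: "'a::topological_space \<Rightarrow> real"
  assumes "X \<in> Cb"
  obtains B where "B \<ge> 0" "\<And>\<omega>. \<bar>X \<omega>\<bar> \<le> B" "continuous_on UNIV X" "X \<in> borel_measurable borel"
proof -
  obtain B where B: "\<And>\<omega>. \<bar>X \<omega>\<bar> \<le> B" using assms unfolding bcontfun_def by (auto simp: bounded_iff)
  moreover have "B \<ge> 0" using B[of undefined] by linarith
  ultimately show thesis
    using that assms by (auto simp: bcontfun_def intro: borel_measurable_continuous_onI)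
qed

lemma Cb_measurable: "X \<in> Cb \<Longrightarrow> X \<in> borel_measurable borel" for X :: "'a::topological_space \<Rightarrow> real"
  by (auto elim: CbE)

lemma Cb_const [simp]: "(\<lambda>_. c) \<in> Cb" for c :: real
  by (rule const_bcontfun)

lemma Cb_add:
  fixes X Y :: "'a::topological_space \<Rightarrow> real"
  assumes "X \<in> Cb" "Y \<in> Cb" shows "(\<lambda>\<omega>. X \<omega> + Y \<omega>) \<in> Cb"
proof -
  obtain B where B: "\<And>\<omega>. \<bar>X \<omega>\<bar> \<le> B" "continuous_on UNIV X" using CbE[OF assms(1)] by metis
  obtain C where C: "\<And>\<omega>. \<bar>Y \<omega>\<bar> \<le> C" "continuous_on UNIV Y" using CbE[OF assms(2)] by metis
  have "\<bar>X \<omega> + Y \<omega>\<bar> \<le> B + C" for \<omega> using B(1)[of \<omega>] C(1)[of \<omega>] by linarith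
  then show ?thesis using B C by (auto intro!: CbI[of _ "B + C"] continuous_intros)
qed

lemma Cb_cmult:
  fixes X :: "'a::topological_space \<Rightarrow> real"
  assumes "X \<in> Cb" shows "(\<lambda>\<omega>. c * X \<omega>) \<in> Cb"
proof -
  obtain B where B: "\<And>\<omega>. \<bar>X \<omega>\<bar> \<le> B" "continuous_on UNIV X" using CbE[OF assms(1)] by metis
  then show ?thesis
    by (auto intro!: CbI[of _ "\<bar>c\<bar> * B"] continuous_intros mult_left_mono simp: abs_mult)
qed

lemma Cb_minus: "X \<in> Cb \<Longrightarrow> (\<lambda>\<omega>. - X \<omega>) \<in> Cb" for X :: "'a::topological_space \<Rightarrow> real"
  using Cb_cmult[of X "-1"] by simp

lemma Cb_diff: "X \<in> Cb \<Longrightarrow> Y \<in> Cb \<Longrightarrow> (\<lambda>\<omega>. X \<omega> - Y \<omega>) \<in> Cb" for X Y :: "'a::topological_space \<Rightarrow> real"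
  using Cb_add[OF _ Cb_minus, of X Y] by simp

lemma Cb_comp: "X \<in> Cb \<Longrightarrow> continuous_on UNIV f \<Longrightarrow> (\<lambda>\<omega>. X (f \<omega>)) \<in> Cb"
  for X :: "'a::topological_space \<Rightarrow> real" and f :: "'b::topological_space \<Rightarrow> 'a"
  by (elim CbE) (auto intro!: CbI intro: continuous_on_compose2)

lemma Cb_LipI:
  assumes "\<And>\<omega>. \<bar>\<phi> \<omega>\<bar> \<le> B" "\<And>x y. \<bar>\<phi> x - \<phi> y\<bar> \<le> L * prefix_dist n x y"
  shows "\<phi> \<in> Cb_Lip n"
  using assms unfolding Cb_Lip_def prefix_dist_def[symmetric] by (auto simp: bounded_iff)

lemma Cb_LipE:
  assumes "\<phi> \<in> Cb_Lip n"
  obtains B L where "B \<ge> 0" "\<And>\<omega>. \<bar>\<phi> \<omega>\<bar> \<le> B" "L \<ge> 0" "\<And>x y. \<bar>\<phi> x - \<phi> y\<bar> \<le> L * prefix_dist n x y"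
proof -
  obtain B where B: "\<And>\<omega>. \<bar>\<phi> \<omega>\<bar> \<le> B" using assms unfolding Cb_Lip_def prefix_dist_def[symmetric] by (auto simp: bounded_iff)
  obtain L where L: "\<And>x y. \<bar>\<phi> x - \<phi> y\<bar> \<le> L * prefix_dist n x y" using assms unfolding Cb_Lip_def prefix_dist_def[symmetric] by auto
  have "\<bar>\<phi> x - \<phi> y\<bar> \<le> \<bar>L\<bar> * prefix_dist n x y" for x y
    using L[of x y] mult_right_mono[OF abs_ge_self[of L] prefix_dist_nonneg] order_trans by blast
  moreover have "B \<ge> 0" using B[of undefined] by linarith
  ultimately show thesis using that[of B "\<bar>L\<bar>"] B by auto
qed

lemma Cb_Lip_cong:
  assumes "\<phi> \<in> Cb_Lip n" "\<And>i. i < n \<Longrightarrow> x i = y i"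
  shows "\<phi> x = \<phi> y"
proof -
  obtain L where "\<bar>\<phi> x - \<phi> y\<bar> \<le> L * prefix_dist n x y" using Cb_LipE[OF assms(1)] by metis
  then show ?thesis using prefix_dist_eq_0[of n x y] assms(2) by simp
qed

lemma continuous_prefix_dist: "continuous_on UNIV (\<lambda>y. prefix_dist n x y)"
  unfolding prefix_dist_def L2_set_def by (intro continuous_intros continuous_coord)

lemma Cb_Lip_imp_Cb:
  assumes "\<phi> \<in> Cb_Lip n"
  shows "\<phi> \<in> Cb"
proof -
  obtain B L where *: "\<And>\<omega>. \<bar>\<phi> \<omega>\<bar> \<le> B" "\<And>x y. \<bar>\<phi> x - \<phi> y\<bar> \<le> L * prefix_dist n x y"
    using Cb_LipE[OF assms] by metis
  have "continuous_on UNIV \<phi>"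
  proof (intro continuous_at_imp_continuous_on ballI)
    fix x
    have "(prefix_dist n x \<longlongrightarrow> prefix_dist n x x) (at x)"
      using continuous_prefix_dist[of n x] unfolding continuous_on_def by blast
    then have 0: "((\<lambda>y. L * prefix_dist n x y) \<longlongrightarrow> 0) (at x)"
      using tendsto_mult_right_zero by simp
    have "((\<lambda>y. \<phi> y - \<phi> x) \<longlongrightarrow> 0) (at x)"
      by (rule Lim_null_comparison[OF _ 0])
         (auto intro!: always_eventually simp: *(2) prefix_dist_commute[of n x])
    then show "isCont \<phi> x" unfolding isCont_def using LIM_zero_cancel by blast
  qed
  then show ?thesis using *(1) by (rule CbI)
qed

lemma Cb_Lip_mono:
  assumes "\<phi> \<in> Cb_Lip n" "n \<le> m" shows "\<phi> \<in> Cb_Lip m"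
proof -
  obtain B L where *: "\<And>\<omega>. \<bar>\<phi> \<omega>\<bar> \<le> B" "L \<ge> 0" "\<And>x y. \<bar>\<phi> x - \<phi> y\<bar> \<le> L * prefix_dist n x y"
    using Cb_LipE[OF assms(1)] by metis
  show ?thesis
  proof (rule Cb_LipI[of _ B L])
    show "\<bar>\<phi> x - \<phi> y\<bar> \<le> L * prefix_dist m x y" for x y
      using *(3)[of x y] mult_left_mono[OF prefix_dist_mono[OF assms(2)] *(2)] order_trans by blast
  qed (rule *)
qed

lemma Cb_Lip_const [simp]: "(\<lambda>_. c) \<in> Cb_Lip n"
  by (rule Cb_LipI[of _ "\<bar>c\<bar>" 0]) auto

lemma Cb_Lip_add:
  assumes "\<phi> \<in> Cb_Lip n" "\<psi> \<in> Cb_Lip n" shows "(\<lambda>x. \<phi> x + \<psi> x) \<in> Cb_Lip n"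
proof -
  obtain B L where *: "\<And>\<omega>. \<bar>\<phi> \<omega>\<bar> \<le> B" "\<And>x y. \<bar>\<phi> x - \<phi> y\<bar> \<le> L * prefix_dist n x y"
    using Cb_LipE[OF assms(1)] by metis
  obtain C K where **: "\<And>\<omega>. \<bar>\<psi> \<omega>\<bar> \<le> C" "\<And>x y. \<bar>\<psi> x - \<psi> y\<bar> \<le> K * prefix_dist n x y"
    using Cb_LipE[OF assms(2)] by metis
  show ?thesis
  proof (rule Cb_LipI[of _ "B + C" "L + K"])
    show "\<bar>\<phi> x + \<psi> x\<bar> \<le> B + C" for x using *(1)[of x] **(1)[of x] by linarith
    show "\<bar>\<phi> x + \<psi> x - (\<phi> y + \<psi> y)\<bar> \<le> (L + K) * prefix_dist n x y" for x y
      using *(2)[of x y] **(2)[of x y] unfolding distrib_right by linarith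
  qed
qed

lemma Cb_Lip_mult:
  assumes "\<phi> \<in> Cb_Lip n" "\<psi> \<in> Cb_Lip n" shows "(\<lambda>x. \<phi> x * \<psi> x) \<in> Cb_Lip n"
proof -
  obtain B L where *: "B \<ge> 0" "\<And>\<omega>. \<bar>\<phi> \<omega>\<bar> \<le> B" "\<And>x y. \<bar>\<phi> x - \<phi> y\<bar> \<le> L * prefix_dist n x y"
    using Cb_LipE[OF assms(1)] by metis
  obtain C K where **: "C \<ge> 0" "\<And>\<omega>. \<bar>\<psi> \<omega>\<bar> \<le> C" "\<And>x y. \<bar>\<psi> x - \<psi> y\<bar> \<le> K * prefix_dist n x y"
    using Cb_LipE[OF assms(2)] by metis
  show ?thesis
  proof (rule Cb_LipI[of _ "B * C" "B * K + L * C"])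
    show "\<bar>\<phi> x * \<psi> x\<bar> \<le> B * C" for x using * ** by (simp add: abs_mult mult_mono)
    fix x y
    have "\<phi> x * \<psi> x - \<phi> y * \<psi> y = \<phi> x * (\<psi> x - \<psi> y) + (\<phi> x - \<phi> y) * \<psi> y" by (simp add: algebra_simps)
    then have "\<bar>\<phi> x * \<psi> x - \<phi> y * \<psi> y\<bar> \<le> \<bar>\<phi> x\<bar> * \<bar>\<psi> x - \<psi> y\<bar> + \<bar>\<phi> x - \<phi> y\<bar> * \<bar>\<psi> y\<bar>"
      using abs_triangle_ineq by (simp flip: abs_mult)
    also have "\<dots> \<le> B * (K * prefix_dist n x y) + (L * prefix_dist n x y) * C"
      using * ** by (intro add_mono mult_mono) (auto intro: order_trans[OF abs_ge_zero])
    finally show "\<bar>\<phi> x * \<psi> x - \<phi> y * \<psi> y\<bar> \<le> (B * K + L * C) * prefix_dist n x y"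
      by (simp add: algebra_simps)
  qed
qed

lemma Cb_Lip_shift:
  assumes "\<phi> \<in> Cb_Lip m" shows "(\<lambda>\<omega>. \<phi> (shift_seq n \<omega>)) \<in> Cb_Lip (n + m)"
proof -
  obtain B L where *: "\<And>\<omega>. \<bar>\<phi> \<omega>\<bar> \<le> B" "L \<ge> 0" "\<And>x y. \<bar>\<phi> x - \<phi> y\<bar> \<le> L * prefix_dist m x y"
    using Cb_LipE[OF assms] by metis
  show ?thesis
    by (rule Cb_LipI[of _ B L]) (auto intro: * order_trans[OF *(3)] mult_left_mono[OF prefix_dist_shift])
qed

lemma Cb_Lip_join_right:
  assumes "\<phi> \<in> Cb_Lip (n + m)" shows "(\<lambda>x. \<phi> (join_vec n y x)) \<in> Cb_Lip m"
proof -
  obtain B L where *: "\<And>\<omega>. \<bar>\<phi> \<omega>\<bar> \<le> B" "\<And>x y. \<bar>\<phi> x - \<phi> y\<bar> \<le> L * prefix_dist (n + m) x y"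
    using Cb_LipE[OF assms] by metis
  show ?thesis using * *(2)[of "join_vec n y _" "join_vec n y _"]
    by (intro Cb_LipI[of _ B L]) (auto simp: prefix_dist_join_right)
qed

lemma join_vec_assoc: "join_vec n y (join_vec m z x) = join_vec (n + m) (join_vec n y z) x"
  by (auto simp: join_vec_def fun_eq_iff)

lemma shift_join_vec [simp]: "shift_seq n (join_vec n y x) = x"
  by (auto simp: join_vec_def shift_seq_def fun_eq_iff)

section \<open>Approximation by Lipschitz cylinder functions from above\<close>

text \<open>
  The smallest majorant of \<open>X\<close> that is \<open>c\<close>-Lipschitz for the distance of the first \<open>n\<close> coordinates.
\<close>

definition sup_conv :: "nat \<Rightarrow> real \<Rightarrow> (seq_space \<Rightarrow> real) \<Rightarrow> seq_space \<Rightarrow> real"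
  where "sup_conv n c X \<omega> = (SUP \<eta>. X \<eta> - c * prefix_dist n \<omega> \<eta>)"

context
  fixes X :: "seq_space \<Rightarrow> real" and B :: real
  assumes bd: "\<And>\<omega>. \<bar>X \<omega>\<bar> \<le> B"
begin

lemma sup_conv_bdd: "c \<ge> 0 \<Longrightarrow> bdd_above (range (\<lambda>\<eta>. X \<eta> - c * prefix_dist n \<omega> \<eta>))"
  using bd by (intro bdd_aboveI[of _ B]) (auto simp: abs_le_iff intro: order_trans[OF diff_left_mono[of 0]])

lemma sup_conv_ge: "c \<ge> 0 \<Longrightarrow> X \<omega> \<le> sup_conv n c X \<omega>"
  unfolding sup_conv_def
  using cSUP_upper[OF UNIV_I[of \<omega>] sup_conv_bdd[of c n \<omega>]] by (simp add: prefix_dist_eq_0)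

lemma sup_conv_le:
  "(\<And>\<eta>. X \<eta> - c * prefix_dist n \<omega> \<eta> \<le> u) \<Longrightarrow> sup_conv n c X \<omega> \<le> u"
  unfolding sup_conv_def by (rule cSUP_least) auto

lemma sup_conv_abs_le:
  assumes "c \<ge> 0" shows "\<bar>sup_conv n c X \<omega>\<bar> \<le> B"
proof -
  have "sup_conv n c X \<omega> \<le> B"
  proof (rule sup_conv_le)
    fix \<eta>
    have "0 \<le> c * prefix_dist n \<omega> \<eta>" using assms by simp
    then show "X \<eta> - c * prefix_dist n \<omega> \<eta> \<le> B" using bd[of \<eta>] by linarith
  qed
  then show ?thesis using sup_conv_ge[OF assms, of \<omega> n] bd[of \<omega>] by linarith
qed

lemma sup_conv_Cb_Lip:
  assumes c: "c \<ge> 0" shows "sup_conv n c X \<in> Cb_Lip n"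
proof (rule Cb_LipI[of _ B c])
  have le: "sup_conv n c X x \<le> sup_conv n c X y + c * prefix_dist n x y" for x y
  proof (rule sup_conv_le)
    fix \<eta>
    have "X \<eta> - c * prefix_dist n y \<eta> \<le> sup_conv n c X y"
      unfolding sup_conv_def by (rule cSUP_upper[OF UNIV_I sup_conv_bdd[OF c]])
    moreover have "c * prefix_dist n y \<eta> \<le> c * (prefix_dist n x y + prefix_dist n x \<eta>)"
      using prefix_dist_triangle[of n y \<eta> x] c by (intro mult_left_mono) (auto simp: prefix_dist_commute)
    ultimately show "X \<eta> - c * prefix_dist n x \<eta> \<le> sup_conv n c X y + c * prefix_dist n x y"
      by (simp add: algebra_simps)
  qed
  show "\<bar>sup_conv n c X x - sup_conv n c X y\<bar> \<le> c * prefix_dist n x y" for x y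
    using le[of x y] le[of y x] by (simp add: abs_le_iff prefix_dist_commute[of n y])
qed (use sup_conv_abs_le c in auto)

lemma sup_conv_antimono:
  assumes "0 \<le> c" "c \<le> c'" "n \<le> n'"
  shows "sup_conv n' c' X \<omega> \<le> sup_conv n c X \<omega>"
proof (rule sup_conv_le)
  fix \<eta>
  have "c * prefix_dist n \<omega> \<eta> \<le> c' * prefix_dist n' \<omega> \<eta>"
    using assms by (intro mult_mono prefix_dist_mono) auto
  moreover have "X \<eta> - c * prefix_dist n \<omega> \<eta> \<le> sup_conv n c X \<omega>"
    unfolding sup_conv_def by (rule cSUP_upper[OF UNIV_I sup_conv_bdd[OF assms(1)]])
  ultimately show "X \<eta> - c' * prefix_dist n' \<omega> \<eta> \<le> sup_conv n c X \<omega>" by linarith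
qed

lemma sup_conv_near:
  assumes "\<And>\<eta>. prefix_dist n \<omega> \<eta> < \<delta> \<Longrightarrow> X \<eta> \<le> X \<omega> + \<epsilon>" "2 * B \<le> c * \<delta>" "0 \<le> c" "0 \<le> \<epsilon>"
  shows "sup_conv n c X \<omega> \<le> X \<omega> + \<epsilon>"
proof (rule sup_conv_le)
  fix \<eta>
  have nn: "0 \<le> c * prefix_dist n \<omega> \<eta>" using assms by simp
  show "X \<eta> - c * prefix_dist n \<omega> \<eta> \<le> X \<omega> + \<epsilon>"
  proof (cases "prefix_dist n \<omega> \<eta> < \<delta>")
    case True then show ?thesis using assms(1)[of \<eta>] nn by linarith
  next
    case False
    then have "c * \<delta> \<le> c * prefix_dist n \<omega> \<eta>" using assms by (intro mult_left_mono) auto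
    then show ?thesis using bd[of \<eta>] bd[of \<omega>] assms by linarith
  qed
qed

text \<open>
  As the Lipschitz constant grows, only points close to \<open>\<omega>\<close> contribute to the supremum. Upper
  semicontinuity of \<open>X\<close> is thus enough, and the lemma applies to indicators of closed sets as well
  as to continuous functions. The sequence \<open>n\<close> of dimensions may be constant.
\<close>

lemma sup_conv_tendsto:
  assumes usc: "\<And>\<omega> \<epsilon>. \<epsilon> > 0 \<Longrightarrow> \<exists>K \<delta>. \<delta> > 0 \<and> (\<forall>\<eta>. prefix_dist K \<omega> \<eta> < \<delta> \<longrightarrow> X \<eta> \<le> X \<omega> + \<epsilon>) \<and> (\<forall>\<^sub>F j in sequentially. K \<le> n j)"
  shows "(\<lambda>j. sup_conv (n j) (real j) X \<omega>) \<longlonglongrightarrow> X \<omega>"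
proof (rule LIMSEQ_I)
  fix \<epsilon> :: real assume "\<epsilon> > 0"
  then obtain K \<delta> where K: "\<delta> > 0" "\<And>\<eta>. prefix_dist K \<omega> \<eta> < \<delta> \<Longrightarrow> X \<eta> \<le> X \<omega> + \<epsilon> / 2"
    "\<forall>\<^sub>F j in sequentially. K \<le> n j" using usc[of "\<epsilon>/2" \<omega>] by auto
  obtain J :: nat where J: "2 * B / \<delta> \<le> J" using real_arch_simple by blast
  have "\<forall>\<^sub>F j in sequentially. norm (sup_conv (n j) (real j) X \<omega> - X \<omega>) < \<epsilon>"
    using K(3) eventually_ge_at_top[of J]
  proof eventually_elim
    case (elim j)
    have "2 * B \<le> real J * \<delta>" using J K(1) by (simp add: field_simps)
    also have "\<dots> \<le> real j * \<delta>" using elim K(1) by (intro mult_right_mono) auto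
    finally have "sup_conv (n j) (real j) X \<omega> \<le> X \<omega> + \<epsilon> / 2"
      using K(2) \<open>\<epsilon> > 0\<close> prefix_dist_mono[OF elim(1), of \<omega>]
      by (intro sup_conv_near[of "n j" \<omega> \<delta>]) (auto intro: le_less_trans)
    then show ?case using sup_conv_ge[of "real j" \<omega> "n j"] \<open>\<epsilon> > 0\<close> by auto
  qed
  then show "\<exists>no. \<forall>j\<ge>no. norm (sup_conv (n j) (real j) X \<omega> - X \<omega>) < \<epsilon>"
    by (simp add: eventually_sequentially)
qed

end

text \<open>
  The approximation is monotone, so that regularity applies to it.
\<close>

lemma Cb_approx_Cb_Lip:
  assumes "X \<in> Cb"
  obtains Y where "\<And>n. Y n \<in> Cb_Lip n" "\<And>\<omega>. decseq (\<lambda>n. Y n \<omega>)" "\<And>\<omega>. (\<lambda>n. Y n \<omega>) \<longlonglongrightarrow> X \<omega>"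
    "\<And>n \<omega>. X \<omega> \<le> Y n \<omega>"
proof -
  obtain B where B: "\<And>\<omega>. \<bar>X \<omega>\<bar> \<le> B" and cont: "continuous_on UNIV X" using CbE[OF assms] by metis
  show thesis
  proof (rule that[of "\<lambda>n. sup_conv n (real n) X"])
    show "(\<lambda>n. sup_conv n (real n) X \<omega>) \<longlonglongrightarrow> X \<omega>" for \<omega>
    proof (rule sup_conv_tendsto[OF B])
      fix \<omega> and \<epsilon> :: real assume "\<epsilon> > 0"
      have "open {\<eta>. X \<eta> < X \<omega> + \<epsilon>}" by (intro open_Collect_less cont continuous_on_const)
      then obtain K \<delta> where "\<delta> > 0" "\<And>\<eta>. prefix_dist K \<omega> \<eta> < \<delta> \<Longrightarrow> \<eta> \<in> {\<eta>. X \<eta> < X \<omega> + \<epsilon>}"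
        using open_contains_cylinder[of _ \<omega>] \<open>\<epsilon> > 0\<close> by (metis (mono_tags, lifting) less_add_same_cancel1 mem_Collect_eq)
      then show "\<exists>K \<delta>. \<delta> > 0 \<and> (\<forall>\<eta>. prefix_dist K \<omega> \<eta> < \<delta> \<longrightarrow> X \<eta> \<le> X \<omega> + \<epsilon>) \<and> (\<forall>\<^sub>F j in sequentially. K \<le> j)"
        using eventually_ge_at_top by (intro exI[of _ K] exI[of _ \<delta>]) (auto intro: less_imp_le)
    qed
  qed (auto intro!: sup_conv_Cb_Lip[OF B] sup_conv_ge[OF B] sup_conv_antimono[OF B] simp: decseq_def)
qed

section \<open>Events determined by finitely many coordinates\<close>

text \<open>
  The Borel sets that do not change when the coordinates from \<open>n\<close> on are replaced by zero, i.e. the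
  \<open>\<sigma>\<close>-algebra of the first \<open>n\<close> coordinates.
\<close>

definition past :: "nat \<Rightarrow> seq_space set set"
  where "past n = {B \<in> sets borel. \<forall>\<omega>. truncate_seq n \<omega> \<in> B \<longleftrightarrow> \<omega> \<in> B}"

lemma past_borel: "B \<in> past n \<Longrightarrow> B \<in> sets borel"
  by (simp add: past_def)

lemma truncate_truncate: "truncate_seq n (truncate_seq m \<omega>) = truncate_seq (min n m) \<omega>"
  by (auto simp: truncate_seq_def fun_eq_iff)

lemma past_mono: assumes "B \<in> past n" "n \<le> m" shows "B \<in> past m"
proof -
  have "truncate_seq m \<omega> \<in> B \<longleftrightarrow> \<omega> \<in> B" for \<omega>
  proof -
    have "truncate_seq m \<omega> \<in> B \<longleftrightarrow> truncate_seq n (truncate_seq m \<omega>) \<in> B" using assms(1) by (simp add: past_def)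
    also have "\<dots> \<longleftrightarrow> \<omega> \<in> B" using assms by (simp add: past_def truncate_truncate min_def)
    finally show ?thesis .
  qed
  then show ?thesis using assms by (simp add: past_def)
qed

lemma past_vimage_truncate: "B \<in> sets borel \<Longrightarrow> truncate_seq n -` B \<in> past n"
  using measurable_sets[OF measurable_truncate_seq[of n], of B]
  by (simp add: past_def truncate_truncate)

lemma past_Int: "A \<in> past n \<Longrightarrow> B \<in> past n \<Longrightarrow> A \<inter> B \<in> past n"
  by (auto simp: past_def)

lemma past_Compl: "A \<in> past n \<Longrightarrow> UNIV - A \<in> past n"
  using sets.compl_sets[of A "borel :: seq_space measure"] by (auto simp: past_def)

lemma past_UNIV: "UNIV \<in> past n"
  by (simp add: past_def)

lemma past_coord: "k < n \<Longrightarrow> A \<in> sets borel \<Longrightarrow> {\<omega>. \<omega> k \<in> A} \<in> past n"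
  by (simp add: past_def truncate_seq_def measurable_sets_borel[OF measurable_coord, unfolded vimage_def])

lemma borel_seq_eq_sigma_coord:
  "sets (borel :: seq_space measure) = sigma_sets UNIV {{\<omega>. \<omega> k \<in> A} | k A. A \<in> sets borel}"
proof -
  have "sets (borel :: seq_space measure) = sets (Pi\<^sub>M UNIV (\<lambda>_. borel :: real measure))"
    by (rule sets_PiM_equal_borel[symmetric])
  also have "\<dots> = sigma_sets UNIV {{\<omega>. \<omega> k \<in> A} | k A. A \<in> sets borel}"
    unfolding sets_PiM_single by simp
  finally show ?thesis .
qed

lemma prob_eq_on_pastI:
  assumes P: "prob_space P" "sets P = sets borel" and Q: "prob_space Q" "sets Q = sets borel"
    and eq: "\<And>n B. B \<in> past n \<Longrightarrow> measure P B = measure Q B"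
  shows "P = (Q :: seq_space measure)"
proof -
  interpret P: prob_space P by fact
  interpret Q: prob_space Q by fact
  let ?E = "\<Union>n. past n"
  have gen: "sigma_sets UNIV ?E = sets (borel :: seq_space measure)"
  proof
    show "sigma_sets UNIV ?E \<subseteq> sets borel"
      using sets.sigma_sets_subset[of ?E borel] past_borel by auto
    show "sets borel \<subseteq> sigma_sets UNIV ?E"
      unfolding borel_seq_eq_sigma_coord
    proof (rule sigma_sets_mono', clarify)
      fix k and A :: "real set" assume "A \<in> sets borel"
      then show "{\<omega>. \<omega> k \<in> A} \<in> (\<Union>n. past n)" using past_coord[of k "Suc k" A] by blast
    qed
  qed
  show ?thesis
  proof (rule measure_eqI_generator_eq[where E = ?E and \<Omega> = UNIV and A = "\<lambda>_. UNIV"])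
    show "Int_stable ?E"
    proof (rule Int_stableI)
      fix a b assume "a \<in> ?E" "b \<in> ?E"
      then obtain n m where "a \<in> past n" "b \<in> past m" by auto
      then have "a \<inter> b \<in> past (max n m)" by (intro past_Int) (auto intro: past_mono)
      then show "a \<inter> b \<in> ?E" by blast
    qed
    show "sets P = sigma_sets UNIV ?E" "sets Q = sigma_sets UNIV ?E" by (simp_all add: gen P Q)
    show "emeasure P X = emeasure Q X" if "X \<in> ?E" for X
      using that eq by (auto simp: P.emeasure_eq_measure Q.emeasure_eq_measure)
  qed (auto simp: past_UNIV)
qed

text \<open>
  The image of \<open>P\<close> under truncation is inner regular, and preimages of compact sets under truncation
  are closed and depend on the first \<open>n\<close> coordinates only.
\<close>

lemma past_inner_regular:
  assumes P: "prob_space P" "sets P = sets borel" and B: "B \<in> past n" and "\<epsilon> > 0"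
  obtains C where "closed C" "C \<in> past n" "C \<subseteq> B" "measure P B \<le> measure P C + \<epsilon>"
proof -
  interpret P: prob_space P by fact
  have [measurable]: "truncate_seq n \<in> measurable P borel"
    using measurable_truncate_seq P(2) by (simp cong: measurable_cong_sets)
  interpret D: prob_space "distr P borel (truncate_seq n)" by (rule P.prob_space_distr) simp
  let ?D = "distr P borel (truncate_seq n)"
  have Bb: "B \<in> sets borel" using B by (rule past_borel)
  have v: "truncate_seq n -` B = B" using B by (auto simp: past_def)
  have sp: "space P = UNIV" using P(2) by (auto dest: sets_eq_imp_space_eq)
  have "emeasure ?D B = (SUP K\<in>{K. K \<subseteq> B \<and> compact K}. emeasure ?D K)"
    using Bb by (intro inner_regular) (auto simp: D.emeasure_eq_measure)
  then obtain K where K: "K \<subseteq> B" "compact K" "emeasure ?D B \<le> emeasure ?D K + ennreal \<epsilon>"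
  proof (cases "measure ?D B \<le> \<epsilon>")
    case True
    then show thesis using that[of "{}"] \<open>\<epsilon> > 0\<close> by (simp add: D.emeasure_eq_measure)
  next
    case False
    assume S: "emeasure ?D B = (SUP K\<in>{K. K \<subseteq> B \<and> compact K}. emeasure ?D K)"
    have "ennreal (measure ?D B - \<epsilon>) < emeasure ?D B"
      using False \<open>\<epsilon> > 0\<close> by (simp add: D.emeasure_eq_measure ennreal_less_iff)
    then obtain K where "K \<subseteq> B" "compact K" "ennreal (measure ?D B - \<epsilon>) < emeasure ?D K"
      unfolding S less_SUP_iff by auto
    then show thesis using that[of K] False \<open>\<epsilon> > 0\<close>
      by (auto simp: D.emeasure_eq_measure ennreal_less_iff simp flip: ennreal_plus)
  qed
  have cK: "closed K" using K(2) by (rule compact_imp_closed)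
  have mD: "measure ?D A = measure P (truncate_seq n -` A)" if "A \<in> sets borel" for A
    using that by (subst measure_distr) (auto simp: sp)
  show thesis
  proof (rule that[of "truncate_seq n -` K"])
    show "closed (truncate_seq n -` K)" using cK continuous_truncate_seq by (rule closed_vimage)
    show "truncate_seq n -` K \<in> past n" using cK by (intro past_vimage_truncate) auto
    show "truncate_seq n -` K \<subseteq> B" using K(1) v by blast
    have "measure ?D B \<le> measure ?D K + \<epsilon>"
      using K(3) \<open>\<epsilon> > 0\<close> by (simp add: D.emeasure_eq_measure flip: ennreal_plus)
    then show "measure P B \<le> measure P (truncate_seq n -` K) + \<epsilon>"
      using Bb cK by (simp add: mD v)
  qed
qed

lemma closed_past_indicator_usc:
  assumes "closed C" "C \<in> past n" "\<epsilon> > 0"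
  shows "\<exists>\<delta>>0. \<forall>\<eta>. prefix_dist n \<omega> \<eta> < \<delta> \<longrightarrow> indicator C \<eta> \<le> (indicator C \<omega> + \<epsilon> :: real)"
proof (cases "\<omega> \<in> C")
  case True then show ?thesis using assms(3) by (intro exI[of _ 1]) (auto simp: indicator_def)
next
  case False
  then have "truncate_seq n \<omega> \<in> - C" using assms(2) by (simp add: past_def)
  then obtain K \<delta> where K: "\<delta> > 0" "\<And>\<eta>. prefix_dist K (truncate_seq n \<omega>) \<eta> < \<delta> \<Longrightarrow> \<eta> \<in> - C"
    using open_contains_cylinder[of "- C" "truncate_seq n \<omega>"] assms(1) by blast
  have "\<eta> \<notin> C" if "prefix_dist n \<omega> \<eta> < \<delta>" for \<eta>
  proof -
    have "truncate_seq n \<eta> \<in> - C"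
      using K(2)[of "truncate_seq n \<eta>"] prefix_dist_truncate[of K n \<omega> \<eta>] that by linarith
    then show ?thesis using assms(2) by (simp add: past_def)
  qed
  then show ?thesis using K(1) assms(3) by (intro exI[of _ \<delta>]) auto
qed

section \<open>Sublinear expectations and their representing measures\<close>

lemma integrable_Cb:
  fixes X :: "'a::topological_space \<Rightarrow> real"
  assumes "P \<in> prob_measures" "X \<in> Cb"
  shows "integrable P X"
proof -
  interpret prob_space P using assms by (simp add: prob_measures_def)
  have [measurable_cong]: "sets P = sets borel" using assms by (simp add: prob_measures_def)
  obtain B where B: "\<And>\<omega>. \<bar>X \<omega>\<bar> \<le> B" and [measurable]: "X \<in> borel_measurable borel"
    using CbE[OF assms(2)] by metis
  show ?thesis by (rule integrable_const_bound[where B = B]) (use B in auto)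
qed

lemma prob_measures_measure_space [simp]: "P \<in> prob_measures \<Longrightarrow> measure P (space P) = 1"
  by (simp add: prob_measures_def prob_space.prob_space)

lemma prob_measures_space: "P \<in> prob_measures \<Longrightarrow> space P = UNIV"
  by (auto simp: prob_measures_def dest: sets_eq_imp_space_eq)

lemma integral_Cb_mono:
  fixes X Y :: "'a::topological_space \<Rightarrow> real"
  assumes "P \<in> prob_measures" "X \<in> Cb" "Y \<in> Cb" "\<And>\<omega>. X \<omega> \<le> Y \<omega>"
  shows "integral\<^sup>L P X \<le> integral\<^sup>L P Y"
  using assms by (intro integral_mono integrable_Cb)

lemma max_repr_prob: "P \<in> max_repr E \<Longrightarrow> P \<in> prob_measures"
  by (simp add: max_repr_def)

lemma max_repr_le: "P \<in> max_repr E \<Longrightarrow> X \<in> Cb \<Longrightarrow> integral\<^sup>L P X \<le> E X"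
  by (simp add: max_repr_def)

locale sublinear =
  fixes E :: "(seq_space \<Rightarrow> real) \<Rightarrow> real"
  assumes sublinear: "sublinear_expectation E"
begin

text \<open>
  Any representing set is contained in the maximal one, so the maximal one represents \<open>E\<close> as well.
\<close>

lemma max_repr_nonempty: "max_repr E \<noteq> {}"
  and max_repr_SUP: "X \<in> Cb \<Longrightarrow> E X = (SUP P\<in>max_repr E. integral\<^sup>L P X)"
proof -
  obtain \<Theta> where \<Theta>: "represents \<Theta> E" using sublinear by (auto simp: sublinear_expectation_def)
  have bdd: "bdd_above ((\<lambda>P. integral\<^sup>L P X) ` \<Theta>)" if X: "X \<in> Cb" for X
  proof -
    obtain B where B: "\<And>\<omega>. \<bar>X \<omega>\<bar> \<le> B" using CbE[OF X] by metis
    have "integral\<^sup>L P X \<le> B" if "P \<in> \<Theta>" for P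
    proof -
      have P: "P \<in> prob_measures" using that \<Theta> by (auto simp: represents_def)
      have "integral\<^sup>L P X \<le> (\<integral>_. B \<partial>P)" using B by (intro integral_Cb_mono P X Cb_const) (auto simp: abs_le_iff)
      then show ?thesis using P by simp
    qed
    then show ?thesis by (auto intro!: bdd_aboveI)
  qed
  have sub: "\<Theta> \<subseteq> max_repr E"
    using \<Theta> bdd by (auto simp: max_repr_def represents_def intro!: cSUP_upper)
  moreover have "\<Theta> \<noteq> {}" using \<Theta> by (simp add: represents_def)
  ultimately show ne: "max_repr E \<noteq> {}" by blast
  assume X: "X \<in> Cb"
  show "E X = (SUP P\<in>max_repr E. integral\<^sup>L P X)"
  proof (rule antisym)
    have "E X = (SUP P\<in>\<Theta>. integral\<^sup>L P X)" using \<Theta> X by (simp add: represents_def)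
    also have "\<dots> \<le> (SUP P\<in>max_repr E. integral\<^sup>L P X)"
      using sub X \<open>\<Theta> \<noteq> {}\<close> by (intro cSUP_subset_mono) (auto intro!: bdd_aboveI[of _ "E X"] max_repr_le)
    finally show "E X \<le> (SUP P\<in>max_repr E. integral\<^sup>L P X)" .
    show "(SUP P\<in>max_repr E. integral\<^sup>L P X) \<le> E X"
      using ne X by (intro cSUP_least max_repr_le)
  qed
qed

lemma ext_expectation_Cb: "X \<in> Cb \<Longrightarrow> ext_expectation E X = E X"
  by (simp add: ext_expectation_def max_repr_SUP)

lemma E_least:
  "X \<in> Cb \<Longrightarrow> (\<And>P. P \<in> max_repr E \<Longrightarrow> integral\<^sup>L P X \<le> c) \<Longrightarrow> E X \<le> c"
  using max_repr_nonempty by (auto simp: max_repr_SUP intro!: cSUP_least)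

lemma E_mono: "X \<in> Cb \<Longrightarrow> Y \<in> Cb \<Longrightarrow> (\<And>\<omega>. X \<omega> \<le> Y \<omega>) \<Longrightarrow> E X \<le> E Y"
  by (rule E_least) (auto intro: order_trans[OF integral_Cb_mono] max_repr_prob max_repr_le)

lemma E_const [simp]: "E (\<lambda>_. c) = c"
proof -
  have "E (\<lambda>_. c) = (SUP P\<in>max_repr E. c)"
    by (subst max_repr_SUP) (auto intro!: SUP_cong simp: max_repr_prob)
  then show ?thesis using max_repr_nonempty by simp
qed

lemma E_subadd: "X \<in> Cb \<Longrightarrow> Y \<in> Cb \<Longrightarrow> E (\<lambda>\<omega>. X \<omega> + Y \<omega>) \<le> E X + E Y"
  by (rule E_least)
     (auto simp: Cb_add integrable_Cb[OF max_repr_prob] intro!: add_mono max_repr_le)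

lemma E_add_const: 
  assumes "X \<in> Cb" shows "E (\<lambda>\<omega>. X \<omega> + c) = E X + c"
proof (rule antisym)
  show "E (\<lambda>\<omega>. X \<omega> + c) \<le> E X + c" using E_subadd[OF assms Cb_const[of c]] by simp
  show "E X + c \<le> E (\<lambda>\<omega>. X \<omega> + c)"
    using E_subadd[OF Cb_add[OF assms Cb_const[of c]] Cb_const[of "- c"]] by simp
qed

lemma E_cmult_nonneg:
  assumes "X \<in> Cb" "0 \<le> c" shows "E (\<lambda>\<omega>. c * X \<omega>) = c * E X"
proof -
  have le: "E (\<lambda>\<omega>. c * X \<omega>) \<le> c * E X" if "X \<in> Cb" "0 \<le> c" for c X
    using that by (intro E_least Cb_cmult) (auto intro!: mult_left_mono max_repr_le)
  show ?thesis
  proof (cases "c = 0")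
    case False
    then have "c > 0" using assms by simp
    then have "E (\<lambda>\<omega>. inverse c * (c * X \<omega>)) \<le> inverse c * E (\<lambda>\<omega>. c * X \<omega>)"
      by (intro le Cb_cmult assms) auto
    then have "E X \<le> inverse c * E (\<lambda>\<omega>. c * X \<omega>)" using \<open>c > 0\<close> by (simp add: mult.assoc[symmetric])
    then show ?thesis using le[OF assms] \<open>c > 0\<close> by (simp add: field_simps)
  qed simp
qed

lemma E_close:
  assumes "X \<in> Cb" "Y \<in> Cb" "\<And>\<omega>. \<bar>X \<omega> - Y \<omega>\<bar> \<le> c"
  shows "\<bar>E X - E Y\<bar> \<le> c"
proof -
  have le: "E X \<le> E Y + c" if "X \<in> Cb" "Y \<in> Cb" "\<And>\<omega>. \<bar>X \<omega> - Y \<omega>\<bar> \<le> c" for X Y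
  proof -
    have "E X \<le> E (\<lambda>\<omega>. Y \<omega> + c)"
    proof (intro E_mono that Cb_add Cb_const)
      show "X \<omega> \<le> Y \<omega> + c" for \<omega> using that(3)[of \<omega>] by (simp add: abs_le_iff)
    qed
    then show ?thesis using E_add_const that by simp
  qed
  have "\<bar>Y \<omega> - X \<omega>\<bar> \<le> c" for \<omega> using assms(3)[of \<omega>] by (simp add: abs_minus_commute)
  then show ?thesis using le[OF assms] le[OF assms(2,1)] by (simp add: abs_le_iff)
qed

lemma Cb_Lip_partial_E:
  assumes "\<phi> \<in> Cb_Lip (n + m)" shows "(\<lambda>y. E (\<lambda>\<omega>. \<phi> (join_vec n y \<omega>))) \<in> Cb_Lip n"
proof -
  obtain B L where *: "\<And>\<omega>. \<bar>\<phi> \<omega>\<bar> \<le> B" "\<And>x y. \<bar>\<phi> x - \<phi> y\<bar> \<le> L * prefix_dist (n + m) x y"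
    using Cb_LipE[OF assms] by metis
  have C: "(\<lambda>\<omega>. \<phi> (join_vec n y \<omega>)) \<in> Cb" for y
    by (rule Cb_Lip_imp_Cb[OF Cb_Lip_join_right[OF assms]])
  show ?thesis
  proof (rule Cb_LipI[of _ B L])
    show "\<bar>E (\<lambda>\<omega>. \<phi> (join_vec n y \<omega>))\<bar> \<le> B" for y
      using E_close[OF C[of y] Cb_const[of 0], of B] *(1) by simp
    show "\<bar>E (\<lambda>\<omega>. \<phi> (join_vec n x \<omega>)) - E (\<lambda>\<omega>. \<phi> (join_vec n y \<omega>))\<bar> \<le> L * prefix_dist n x y" for x y
      using *(2) by (intro E_close C) (metis prefix_dist_join_left)
  qed
qed

end

locale regular_sublinear = sublinear +
  assumes regular: "regular_expectation E"
begin

text \<open>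
  Regularity is a statement about limits that are zero; subadditivity extends it to all limits in
  \<^const>\<open>Cb\<close>.
\<close>

lemma E_decseq_tendsto:
  assumes Y: "\<And>n. Y n \<in> Cb" "\<And>\<omega>. decseq (\<lambda>n. Y n \<omega>)" "\<And>\<omega>. (\<lambda>n. Y n \<omega>) \<longlonglongrightarrow> X \<omega>" and X: "X \<in> Cb"
  shows "(\<lambda>n. E (Y n)) \<longlonglongrightarrow> E X"
proof -
  have "(\<lambda>n. E (\<lambda>\<omega>. Y n \<omega> - X \<omega>)) \<longlonglongrightarrow> 0"
  proof (rule regular[unfolded regular_expectation_def, rule_format, THEN conjunct2], intro conjI allI)
    show "(\<lambda>\<omega>. Y n \<omega> - X \<omega>) \<in> Cb" for n by (intro Cb_diff Y X)
    show "decseq (\<lambda>n. Y n \<omega> - X \<omega>)" for \<omega> using Y(2)[of \<omega>] by (auto simp: decseq_def)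
    show "(\<lambda>n. Y n \<omega> - X \<omega>) \<longlonglongrightarrow> 0" for \<omega> using Y(3)[of \<omega>] by (simp add: LIM_zero)
  qed
  then have lim: "(\<lambda>n. E X + E (\<lambda>\<omega>. Y n \<omega> - X \<omega>)) \<longlonglongrightarrow> E X"
    using tendsto_add[OF tendsto_const[of "E X"]] by fastforce
  show ?thesis
  proof (rule tendsto_sandwich[OF _ _ tendsto_const lim])
    show "\<forall>\<^sub>F n in sequentially. E X \<le> E (Y n)"
      using decseq_ge[OF Y(2,3)] by (intro always_eventually allI E_mono Y X)
    show "\<forall>\<^sub>F n in sequentially. E (Y n) \<le> E X + E (\<lambda>\<omega>. Y n \<omega> - X \<omega>)"
    proof (intro always_eventually allI)
      show "E (Y n) \<le> E X + E (\<lambda>\<omega>. Y n \<omega> - X \<omega>)" for n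
        using E_subadd[OF X Cb_diff[OF Y(1)[of n] X]] by simp
    qed
  qed
qed

text \<open>
  Independence speaks about Lipschitz functions of finitely many coordinates only. Approximation from
  above and regularity make such functions sufficient for testing membership.
\<close>

lemma max_repr_if_le_on_Cb_Lip:
  assumes P: "P \<in> prob_measures"
    and le: "\<And>n \<phi>. \<phi> \<in> Cb_Lip n \<Longrightarrow> integral\<^sup>L P \<phi> \<le> E \<phi>"
  shows "P \<in> max_repr E"
  unfolding max_repr_def
proof (intro CollectI conjI ballI P)
  fix X :: "seq_space \<Rightarrow> real" assume X: "X \<in> Cb"
  obtain Y where Y: "\<And>n. Y n \<in> Cb_Lip n" "\<And>\<omega>. decseq (\<lambda>n. Y n \<omega>)" "\<And>\<omega>. (\<lambda>n. Y n \<omega>) \<longlonglongrightarrow> X \<omega>"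
    "\<And>n \<omega>. X \<omega> \<le> Y n \<omega>" using Cb_approx_Cb_Lip[OF X] by metis
  have Yb: "Y n \<in> Cb" for n using Y(1) by (rule Cb_Lip_imp_Cb)
  have "integral\<^sup>L P X \<le> E (Y n)" for n
    using integral_Cb_mono[OF P X Yb Y(4)] le[OF Y(1)] by (rule order_trans)
  then show "integral\<^sup>L P X \<le> E X"
    by (intro LIMSEQ_le_const[OF E_decseq_tendsto[OF Yb Y(2,3) X]]) auto
qed

lemma Cb_Lip_approx_below:
  assumes X: "X \<in> Cb" and "\<epsilon> > 0"
  obtains n \<phi> where "\<phi> \<in> Cb_Lip n" "\<And>\<omega>. \<phi> \<omega> \<le> X \<omega>" "E X \<le> E \<phi> + \<epsilon>"
proof -
  obtain Y where Y: "\<And>n. Y n \<in> Cb_Lip n" "\<And>\<omega>. decseq (\<lambda>n. Y n \<omega>)" "\<And>\<omega>. (\<lambda>n. Y n \<omega>) \<longlonglongrightarrow> - X \<omega>"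
    "\<And>n \<omega>. - X \<omega> \<le> Y n \<omega>" using Cb_approx_Cb_Lip[OF Cb_minus[OF X]] by metis
  have Yb: "Y n \<in> Cb" for n using Y(1) by (rule Cb_Lip_imp_Cb)
  have "(\<lambda>n. E (\<lambda>\<omega>. X \<omega> + Y n \<omega>)) \<longlonglongrightarrow> E (\<lambda>_. 0)"
  proof (rule E_decseq_tendsto)
    show "(\<lambda>\<omega>. X \<omega> + Y n \<omega>) \<in> Cb" for n by (intro Cb_add X Yb)
    show "decseq (\<lambda>n. X \<omega> + Y n \<omega>)" for \<omega> using Y(2)[of \<omega>] by (auto simp: decseq_def)
    show "(\<lambda>n. X \<omega> + Y n \<omega>) \<longlonglongrightarrow> 0" for \<omega>
      using tendsto_add[OF tendsto_const[of "X \<omega>"] Y(3)[of \<omega>]] by simp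
  qed simp
  then have "(\<lambda>n. E (\<lambda>\<omega>. X \<omega> + Y n \<omega>)) \<longlonglongrightarrow> 0" by simp
  then have "\<forall>\<^sub>F n in sequentially. E (\<lambda>\<omega>. X \<omega> + Y n \<omega>) < \<epsilon>"
    using \<open>\<epsilon> > 0\<close> by (rule order_tendstoD)
  then obtain n where n: "E (\<lambda>\<omega>. X \<omega> + Y n \<omega>) < \<epsilon>" by (auto simp: eventually_sequentially)
  have L: "(\<lambda>\<omega>. - Y n \<omega>) \<in> Cb_Lip n" using Cb_Lip_mult[OF Cb_Lip_const[of "-1"] Y(1)[of n]] by simp
  show thesis
  proof (rule that[OF L])
    show "- Y n \<omega> \<le> X \<omega>" for \<omega> using Y(4)[of \<omega> n] by simp
    have "E (\<lambda>\<omega>. - Y n \<omega> + (X \<omega> + Y n \<omega>)) \<le> E (\<lambda>\<omega>. - Y n \<omega>) + E (\<lambda>\<omega>. X \<omega> + Y n \<omega>)"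
      by (intro E_subadd Cb_Lip_imp_Cb[OF L] Cb_add X Yb)
    then show "E X \<le> E (\<lambda>\<omega>. - Y n \<omega>) + \<epsilon>" using n by simp
  qed
qed

end

section \<open>Independence of blocks\<close>

locale iid_sublinear = regular_sublinear +
  assumes iid: "iid_seq E coord"
begin

lemma coord_ident:
  assumes "\<psi> \<in> Cb_Lip 1" shows "E (\<lambda>\<omega>. \<psi> (\<lambda>_. \<omega> k)) = E (\<lambda>\<omega>. \<psi> (\<lambda>_. \<omega> 0))"
proof (induction k)
  case (Suc k)
  have C: "(\<lambda>\<omega>. \<psi> (\<lambda>_. \<omega> j)) \<in> Cb" for j
    using Cb_Lip_imp_Cb[OF assms] 
    by (rule Cb_comp) (auto intro: continuous_on_coordinatewise_then_product continuous_coord)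
  have "ident_distr E 1 (\<lambda>\<omega> _. coord (Suc k) \<omega>) (\<lambda>\<omega> _. coord k \<omega>)"
    using iid by (simp add: iid_seq_def)
  then have "E (\<lambda>\<omega>. \<psi> (\<lambda>_. \<omega> (Suc k))) = E (\<lambda>\<omega>. \<psi> (\<lambda>_. \<omega> k))"
    using assms by (auto simp: ident_distr_def coord_def ext_expectation_Cb C)
  with Suc show ?case by simp
qed simp

text \<open>
  For a first coordinate there is nothing to prove; otherwise this is independence of the next
  coordinate, in which identical distribution replaces coordinate \<open>n\<close> by coordinate \<open>0\<close>.
\<close>

lemma one_step_indep:
  assumes \<phi>: "\<phi> \<in> Cb_Lip (Suc n)"
  shows "E \<phi> = E (\<lambda>y. E (\<lambda>\<omega>. \<phi> (join_vec n y \<omega>)))"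
proof (cases n)
  case 0
  then show ?thesis by (simp add: join_vec_def)
next
  case (Suc i)
  have \<phi>': "\<phi> \<in> Cb_Lip (n + 1)" using \<phi> by simp
  have ext: "\<phi> (join_vec n \<omega> (\<lambda>_. \<omega> n)) = \<phi> \<omega>" for \<omega>
    by (rule Cb_Lip_cong[OF \<phi>]) (auto simp: join_vec_def less_Suc_eq)
  have Cb1: "\<psi> \<in> Cb_Lip 1 \<Longrightarrow> (\<lambda>\<omega>. \<psi> (\<lambda>_. \<omega> j)) \<in> Cb" for j \<psi>
    by (rule Cb_comp[OF Cb_Lip_imp_Cb]) (auto intro: continuous_on_coordinatewise_then_product continuous_coord)
  have inner: "E (\<lambda>\<omega>'. \<phi> (join_vec n y (\<lambda>_. \<omega>' n))) = E (\<lambda>\<omega>. \<phi> (join_vec n y \<omega>))"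
    (is "?l = ?r") for y
  proof -
    have L: "(\<lambda>x. \<phi> (join_vec n y x)) \<in> Cb_Lip 1" by (rule Cb_Lip_join_right[OF \<phi>'])
    have "?l = E (\<lambda>\<omega>'. \<phi> (join_vec n y (\<lambda>_. \<omega>' 0)))" using coord_ident[OF L] .
    also have "\<dots> = ?r"
      by (intro arg_cong[of _ _ E] HOL.ext Cb_Lip_cong[OF \<phi>]) (auto simp: join_vec_def less_Suc_eq)
    finally show ?thesis .
  qed
  have "indep_of E 1 (\<lambda>\<omega> _. coord (Suc i) \<omega>) (Suc i) (\<lambda>\<omega> k. coord k \<omega>)"
    using iid by (simp add: iid_seq_def)
  then have "ext_expectation E (\<lambda>\<omega>. \<phi> (join_vec n (\<lambda>k. \<omega> k) (\<lambda>_. \<omega> n))) =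
      ext_expectation E (\<lambda>\<omega>. ext_expectation E (\<lambda>\<omega>'. \<phi> (join_vec n (\<lambda>k. \<omega> k) (\<lambda>_. \<omega>' n))))"
    using \<phi>' unfolding indep_of_def coord_def Suc by auto
  also have "(\<lambda>\<omega>. \<phi> (join_vec n (\<lambda>k. \<omega> k) (\<lambda>_. \<omega> n))) = \<phi>" by (simp add: ext)
  finally have "ext_expectation E \<phi> =
      ext_expectation E (\<lambda>\<omega>. ext_expectation E (\<lambda>\<omega>'. \<phi> (join_vec n \<omega> (\<lambda>_. \<omega>' n))))" by simp
  also have "(\<lambda>\<omega>. ext_expectation E (\<lambda>\<omega>'. \<phi> (join_vec n \<omega> (\<lambda>_. \<omega>' n)))) =
      (\<lambda>y. E (\<lambda>\<omega>. \<phi> (join_vec n y \<omega>)))"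
    by (simp add: ext_expectation_Cb[OF Cb1[OF Cb_Lip_join_right[OF \<phi>']]] inner)
  finally show ?thesis
    by (simp add: ext_expectation_Cb Cb_Lip_imp_Cb[OF \<phi>] Cb_Lip_imp_Cb[OF Cb_Lip_partial_E[OF \<phi>']])
qed

text \<open>
  Independence of single coordinates from the preceding ones gives, by induction on the length of the
  block, independence of the entire future from the past, with the future distributed like the
  whole sequence.
\<close>

lemma block_indep:
  "\<phi> \<in> Cb_Lip (n + m) \<Longrightarrow> E \<phi> = E (\<lambda>y. E (\<lambda>\<omega>. \<phi> (join_vec n y \<omega>)))"
proof (induction m arbitrary: \<phi> n)
  case 0
  have "\<phi> (join_vec n y \<omega>) = \<phi> y" for y \<omega>
    using 0 by (intro Cb_Lip_cong[of \<phi> n]) (auto simp: join_vec_def)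
  then show ?case by simp
next
  case (Suc m)
  define T where "T = (\<lambda>z. E (\<lambda>\<omega>. \<phi> (join_vec (n + m) z \<omega>)))"
  have \<phi>: "\<phi> \<in> Cb_Lip (Suc (n + m))" "\<phi> \<in> Cb_Lip ((n + m) + 1)" "\<phi> \<in> Cb_Lip (n + Suc m)"
    using Suc.prems by simp_all
  have T: "T \<in> Cb_Lip (n + m)" unfolding T_def by (rule Cb_Lip_partial_E[OF \<phi>(2)])
  have "E \<phi> = E T" unfolding T_def by (rule one_step_indep[OF \<phi>(1)])
  also have "\<dots> = E (\<lambda>y. E (\<lambda>\<omega>. T (join_vec n y \<omega>)))" by (rule Suc.IH[OF T])
  also have "(\<lambda>y. E (\<lambda>\<omega>. T (join_vec n y \<omega>))) = (\<lambda>y. E (\<lambda>\<omega>. \<phi> (join_vec n y \<omega>)))"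
  proof
    fix y
    have "E (\<lambda>\<omega>. \<phi> (join_vec n y \<omega>)) =
        E (\<lambda>\<omega>. E (\<lambda>\<omega>'. \<phi> (join_vec n y (join_vec m \<omega> \<omega>'))))"
      by (rule one_step_indep[OF Cb_Lip_join_right[OF \<phi>(3)]])
    then show "E (\<lambda>\<omega>. T (join_vec n y \<omega>)) = E (\<lambda>\<omega>. \<phi> (join_vec n y \<omega>))"
      by (simp add: T_def join_vec_assoc)
  qed
  finally show ?case .
qed

subsection \<open>Conditioning on the past\<close>

text \<open>
  The function \<open>f \<cdot> (X \<circ> \<theta> - E X)\<close> has sublinear expectation zero: given the past, \<open>f\<close> is a
  nonnegative constant, which can be taken out of \<open>E\<close>.
\<close>

lemma past_shift_Cb_Lip_le:
  assumes P: "P \<in> max_repr E" and f: "f \<in> Cb_Lip n" "\<And>\<omega>. 0 \<le> f \<omega>" and X: "X \<in> Cb"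
  shows "(\<integral>\<omega>. f \<omega> * X (shift_seq n \<omega>) \<partial>P) \<le> (\<integral>\<omega>. f \<omega> \<partial>P) * E X"
proof -
  note Pp = max_repr_prob[OF P]
  have fb: "f \<in> Cb" using f(1) by (rule Cb_Lip_imp_Cb)
  have mult: "(\<lambda>\<omega>. f \<omega> * Y (shift_seq n \<omega>)) \<in> Cb" if Y: "Y \<in> Cb" for Y
  proof -
    obtain B where B: "0 \<le> B" "\<And>\<omega>. \<bar>f \<omega>\<bar> \<le> B" "continuous_on UNIV f" using CbE[OF fb] by metis
    obtain C where C: "\<And>\<omega>. \<bar>Y (shift_seq n \<omega>)\<bar> \<le> C" "continuous_on UNIV (\<lambda>\<omega>. Y (shift_seq n \<omega>))"
      using CbE[OF Cb_comp[OF Y continuous_shift_seq[of n]]] by metis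
    show ?thesis using B C
      by (intro CbI[of _ "B * C"] continuous_intros) (auto simp: abs_mult intro!: mult_mono)
  qed
  have lip: "(\<integral>\<omega>. f \<omega> * Y (shift_seq n \<omega>) \<partial>P) \<le> (\<integral>\<omega>. f \<omega> \<partial>P) * E Y" if Y: "Y \<in> Cb_Lip m" for Y m
  proof -
    have Yb: "Y \<in> Cb" using Y by (rule Cb_Lip_imp_Cb)
    define \<phi> where "\<phi> = (\<lambda>\<omega>. f \<omega> * (Y (shift_seq n \<omega>) + (- E Y)))"
    have \<phi>: "\<phi> \<in> Cb_Lip (n + m)" unfolding \<phi>_def
      by (intro Cb_Lip_mult Cb_Lip_add Cb_Lip_shift Y Cb_Lip_const Cb_Lip_mono[OF f(1)]) simp
    have "f (join_vec n y \<omega>) = f y" for y \<omega>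
      by (rule Cb_Lip_cong[OF f(1)]) (auto simp: join_vec_def)
    then have "E (\<lambda>\<omega>. \<phi> (join_vec n y \<omega>)) = 0" for y
      using f(2) Yb unfolding \<phi>_def
      by (simp add: E_cmult_nonneg[OF Cb_add[OF Yb Cb_const[of "- E Y"]]] E_add_const[OF Yb, of "- E Y"] del: add_uminus_conv_diff)
    then have "E \<phi> = 0" using block_indep[OF \<phi>] by simp
    then have "0 \<ge> integral\<^sup>L P \<phi>" using max_repr_le[OF P Cb_Lip_imp_Cb[OF \<phi>]] by simp
    also have "integral\<^sup>L P \<phi> = (\<integral>\<omega>. f \<omega> * Y (shift_seq n \<omega>) - E Y * f \<omega> \<partial>P)"
      by (simp add: \<phi>_def algebra_simps)
    also have "\<dots> = (\<integral>\<omega>. f \<omega> * Y (shift_seq n \<omega>) \<partial>P) - E Y * (\<integral>\<omega>. f \<omega> \<partial>P)"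
      using integrable_Cb[OF Pp mult[OF Yb]] integrable_Cb[OF Pp fb] by simp
    finally show ?thesis by (simp add: mult.commute)
  qed
  obtain Y where Y: "\<And>n. Y n \<in> Cb_Lip n" "\<And>\<omega>. decseq (\<lambda>n. Y n \<omega>)" "\<And>\<omega>. (\<lambda>n. Y n \<omega>) \<longlonglongrightarrow> X \<omega>"
    "\<And>n \<omega>. X \<omega> \<le> Y n \<omega>" using Cb_approx_Cb_Lip[OF X] by metis
  have Yb: "Y n \<in> Cb" for n using Y(1) by (rule Cb_Lip_imp_Cb)
  have "(\<integral>\<omega>. f \<omega> * X (shift_seq n \<omega>) \<partial>P) \<le> (\<integral>\<omega>. f \<omega> \<partial>P) * E (Y k)" for k
  proof -
    have "(\<integral>\<omega>. f \<omega> * X (shift_seq n \<omega>) \<partial>P) \<le> (\<integral>\<omega>. f \<omega> * Y k (shift_seq n \<omega>) \<partial>P)"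
      using f(2) Y(4) by (intro integral_Cb_mono Pp mult X Yb mult_left_mono)
    also have "\<dots> \<le> (\<integral>\<omega>. f \<omega> \<partial>P) * E (Y k)" by (rule lip[OF Y(1)])
    finally show ?thesis .
  qed
  then show ?thesis
    by (intro LIMSEQ_le_const[OF tendsto_mult_left[OF E_decseq_tendsto[OF Yb Y(2,3) X]]]) auto
qed

text \<open>
  Extension from Lipschitz weights to indicators, through closed sets (limits of Lipschitz weights
  from above) and inner regularity.
\<close>

lemma past_shift_le:
  assumes P: "P \<in> max_repr E" and B: "B \<in> past n" and X: "X \<in> Cb"
  shows "(\<integral>\<omega>. indicator B \<omega> * X (shift_seq n \<omega>) \<partial>P) \<le> measure P B * E X"
proof -
  note Pp = max_repr_prob[OF P]
  interpret prob_space P using Pp by (simp add: prob_measures_def)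
  have sP [measurable_cong]: "sets P = sets borel" using Pp by (simp add: prob_measures_def)
  obtain K where K: "0 \<le> K" "\<And>\<omega>. \<bar>X \<omega>\<bar> \<le> K" and [measurable]: "X \<in> borel_measurable borel"
    using CbE[OF X] by metis
  have EX: "\<bar>E X\<bar> \<le> K" using E_close[OF X Cb_const[of 0], of K] K by simp
  have int: "integrable P (\<lambda>\<omega>. indicator A \<omega> * X (shift_seq n \<omega>))" if [measurable]: "A \<in> sets borel" for A
    using K by (intro integrable_const_bound[where B = K]) (auto simp: abs_mult indicator_def)
  have closed: "(\<integral>\<omega>. indicator C \<omega> * X (shift_seq n \<omega>) \<partial>P) \<le> measure P C * E X"
    if C: "closed C" "C \<in> past n" for C
  proof -
    have [measurable]: "C \<in> sets borel" using C by (auto simp: past_def)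
    define f where "f j = sup_conv n (real j) (indicator C)" for j
    have bd: "\<bar>indicator C \<omega> :: real\<bar> \<le> 1" for \<omega> by (simp add: indicator_def)
    have fL: "f j \<in> Cb_Lip n" for j unfolding f_def by (rule sup_conv_Cb_Lip[OF bd]) simp
    have [measurable]: "f j \<in> borel_measurable borel" for j
      by (rule Cb_measurable[OF Cb_Lip_imp_Cb[OF fL]])
    have f1: "\<bar>f j \<omega>\<bar> \<le> 1" for j \<omega> unfolding f_def by (rule sup_conv_abs_le[OF bd]) simp
    have f0: "0 \<le> f j \<omega>" for j \<omega>
      using sup_conv_ge[OF bd, where c = "real j" and \<omega> = \<omega> and n = n] unfolding f_def
      by (rule order_trans[rotated]) (auto simp: indicator_def)
    have lim: "(\<lambda>j. f j \<omega>) \<longlonglongrightarrow> indicator C \<omega>" for \<omega>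
      unfolding f_def
    proof (rule sup_conv_tendsto[OF bd])
      fix \<omega> and \<epsilon> :: real assume "\<epsilon> > 0"
      from closed_past_indicator_usc[OF C this, of \<omega>]
      show "\<exists>K \<delta>. \<delta> > 0 \<and> (\<forall>\<eta>. prefix_dist K \<omega> \<eta> < \<delta> \<longrightarrow> indicator C \<eta> \<le> (indicator C \<omega> + \<epsilon> :: real)) \<and> (\<forall>\<^sub>F j in sequentially. K \<le> n)"
        by (intro exI[of _ n]) auto
    qed
    have "(\<lambda>j. \<integral>\<omega>. f j \<omega> * X (shift_seq n \<omega>) \<partial>P) \<longlonglongrightarrow> (\<integral>\<omega>. indicator C \<omega> * X (shift_seq n \<omega>) \<partial>P)"
    proof (rule integral_dominated_convergence[where w = "\<lambda>_. K"])
      show "AE \<omega> in P. (\<lambda>j. f j \<omega> * X (shift_seq n \<omega>)) \<longlonglongrightarrow> indicator C \<omega> * X (shift_seq n \<omega>)"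
        by (intro AE_I2 tendsto_mult lim tendsto_const)
      show "AE \<omega> in P. norm (f j \<omega> * X (shift_seq n \<omega>)) \<le> K" for j
        using mult_mono[OF f1 K(2)] by (intro AE_I2) (simp add: abs_mult)
    qed auto
    moreover have "(\<lambda>j. (\<integral>\<omega>. f j \<omega> \<partial>P) * E X) \<longlonglongrightarrow> (\<integral>\<omega>. indicator C \<omega> \<partial>P) * E X"
    proof (intro tendsto_mult tendsto_const integral_dominated_convergence[where w = "\<lambda>_. 1"])
      show "AE \<omega> in P. norm (f j \<omega>) \<le> 1" for j using f1 by simp
    qed (use lim in auto)
    ultimately have "(\<integral>\<omega>. indicator C \<omega> * X (shift_seq n \<omega>) \<partial>P) \<le> (\<integral>\<omega>. indicator C \<omega> \<partial>P) * E X"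
      by (rule LIMSEQ_le) (use past_shift_Cb_Lip_le[OF P fL f0 X] in auto)
    then show ?thesis by simp
  qed
  have Bm [measurable]: "B \<in> sets borel" using B by (rule past_borel)
  show ?thesis
  proof (rule field_le_epsilon)
    fix e :: real assume "e > 0"
    \<comment> \<open>Two errors of size \<open>\<epsilon> * K\<close> occur; the summand 1 excludes division by zero.\<close>
    define \<epsilon> where "\<epsilon> = e / (2 * K + 1)"
    have \<epsilon>: "\<epsilon> > 0" "2 * K * \<epsilon> \<le> e" using \<open>e > 0\<close> K(1) by (auto simp: \<epsilon>_def field_simps)
    obtain C where C: "closed C" "C \<in> past n" "C \<subseteq> B" "measure P B \<le> measure P C + \<epsilon>"
      using past_inner_regular[OF prob_space_axioms sP B \<epsilon>(1)] by metis
    have Cm [measurable]: "C \<in> sets borel" using C(2) by (rule past_borel)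
    have md: "measure P (B - C) = measure P B - measure P C"
      using C(3) by (intro finite_measure_Diff) (auto simp: sP)
    have "(\<integral>\<omega>. indicator B \<omega> * X (shift_seq n \<omega>) \<partial>P) - (\<integral>\<omega>. indicator C \<omega> * X (shift_seq n \<omega>) \<partial>P) =
        (\<integral>\<omega>. indicator B \<omega> * X (shift_seq n \<omega>) - indicator C \<omega> * X (shift_seq n \<omega>) \<partial>P)"
      by (rule Bochner_Integration.integral_diff[symmetric]) (auto intro!: int)
    also have "\<dots> \<le> (\<integral>\<omega>. indicator (B - C) \<omega> * K \<partial>P)"
    proof (rule integral_mono)
      show "indicator B \<omega> * X (shift_seq n \<omega>) - indicator C \<omega> * X (shift_seq n \<omega>) \<le> indicator (B - C) \<omega> * K" for \<omega>
        using C(3) K(2)[of "shift_seq n \<omega>"] by (auto simp: indicator_def abs_le_iff)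
    qed (auto intro!: int Bochner_Integration.integrable_diff integrable_mult_left integrable_real_indicator
        simp: sP emeasure_eq_measure)
    also have "\<dots> = measure P (B - C) * K" by (simp add: sP)
    also have "\<dots> \<le> \<epsilon> * K" using C(4) md K(1) by (intro mult_right_mono) auto
    finally have 1: "(\<integral>\<omega>. indicator B \<omega> * X (shift_seq n \<omega>) \<partial>P) \<le> measure P C * E X + \<epsilon> * K"
      using closed[OF C(1,2)] by simp
    have "(measure P C - measure P B) * E X \<le> \<bar>measure P C - measure P B\<bar> * \<bar>E X\<bar>"
      by (metis abs_ge_self abs_mult)
    also have "\<dots> \<le> \<epsilon> * K"
      using C(4) md EX measure_nonneg[of P "B - C"] by (intro mult_mono) auto
    finally have "measure P C * E X \<le> measure P B * E X + \<epsilon> * K" by (simp add: algebra_simps)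
    with 1 show "(\<integral>\<omega>. indicator B \<omega> * X (shift_seq n \<omega>) \<partial>P) \<le> measure P B * E X + e"
      using \<epsilon>(2) by (simp add: algebra_simps)
  qed
qed

text \<open>
  The conditional law of the shifted sequence, given the event \<open>B\<close>.
\<close>

definition cond_shift :: "seq_space measure \<Rightarrow> nat \<Rightarrow> seq_space set \<Rightarrow> seq_space measure"
  where "cond_shift P n B = distr (uniform_measure P B) borel (shift_seq n)"

lemma cond_shift_measure:
  assumes P: "P \<in> prob_measures" and B: "B \<in> sets borel" "measure P B > 0" and A: "A \<in> sets borel"
  shows "measure (cond_shift P n B) A = measure P (B \<inter> shift_seq n -` A) / measure P B"
proof -
  interpret prob_space P using P by (simp add: prob_measures_def)
  have sP [measurable_cong]: "sets P = sets borel" using P by (simp add: prob_measures_def)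
  have "shift_seq n -` A \<in> sets borel"
    using measurable_sets[OF measurable_shift_seq A, of n] by simp
  then show ?thesis
    unfolding cond_shift_def using B A prob_measures_space[OF P]
    by (subst measure_distr) (auto simp: sP emeasure_eq_measure intro!: measure_uniform_measure)
qed

lemma cond_shift_prob:
  assumes P: "P \<in> prob_measures" and B: "B \<in> sets borel" "measure P B > 0"
  shows "cond_shift P n B \<in> prob_measures"
proof -
  interpret prob_space P using P by (simp add: prob_measures_def)
  have sP [measurable_cong]: "sets P = sets borel" using P by (simp add: prob_measures_def)
  interpret U: prob_space "uniform_measure P B"
    using B by (intro prob_space_uniform_measure) (auto simp: emeasure_eq_measure)
  have "shift_seq n \<in> measurable (uniform_measure P B) borel" by measurable
  then have "prob_space (cond_shift P n B)" unfolding cond_shift_def by (rule U.prob_space_distr)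
  then show ?thesis by (simp add: prob_measures_def cond_shift_def)
qed

text \<open>
  No information about the past improves the bounds on the future: this is the form in which
  independence under \<open>E\<close> is used for individual measures.
\<close>

lemma cond_shift_max_repr:
  assumes P: "P \<in> max_repr E" and B: "B \<in> past n" "measure P B > 0"
  shows "cond_shift P n B \<in> max_repr E"
  unfolding max_repr_def
proof (intro CollectI conjI ballI)
  note Pp = max_repr_prob[OF P]
  interpret prob_space P using Pp by (simp add: prob_measures_def)
  have sP [measurable_cong]: "sets P = sets borel" using Pp by (simp add: prob_measures_def)
  have Bm [measurable]: "B \<in> sets borel" using B(1) by (rule past_borel)
  show "cond_shift P n B \<in> prob_measures" by (rule cond_shift_prob[OF Pp Bm B(2)])
  fix X :: "seq_space \<Rightarrow> real" assume X: "X \<in> Cb"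
  then have [measurable]: "X \<in> borel_measurable borel" by (rule Cb_measurable)
  have U: "uniform_measure P B = density P (\<lambda>\<omega>. ennreal (indicator B \<omega> / measure P B))"
    unfolding uniform_measure_def using B(2)
    by (intro arg_cong[of _ _ "density P"] ext) (simp add: emeasure_eq_measure divide_ennreal ennreal_indicator[symmetric] del: ennreal_indicator)
  have "integral\<^sup>L (cond_shift P n B) X = (\<integral>\<omega>. X (shift_seq n \<omega>) \<partial>uniform_measure P B)"
    unfolding cond_shift_def by (rule integral_distr) auto
  also have "\<dots> = (\<integral>\<omega>. (indicator B \<omega> / measure P B) *\<^sub>R X (shift_seq n \<omega>) \<partial>P)"
    unfolding U by (rule integral_density) auto
  also have "\<dots> = (\<integral>\<omega>. indicator B \<omega> * X (shift_seq n \<omega>) \<partial>P) / measure P B"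
    by simp
  also have "\<dots> \<le> E X"
    using past_shift_le[OF P B(1) X] B(2) by (simp add: field_simps)
  finally show "integral\<^sup>L (cond_shift P n B) X \<le> E X" .
qed

end

section \<open>Sampling with adaptively chosen laws\<close>

text \<open>
  The coordinate at time \<open>k\<close> is taken from row \<open>k\<close> of the array \<open>Z\<close>, at the position that \<open>s\<close> selects on
  the basis of the earlier coordinates.
\<close>

fun adaptive_seq :: "(nat \<Rightarrow> seq_space \<Rightarrow> nat) \<Rightarrow> (nat \<times> nat \<Rightarrow> real) \<Rightarrow> nat \<Rightarrow> real"
  where "adaptive_seq s Z k = Z (k, s k (\<lambda>j. if j < k then adaptive_seq s Z j else 0))"

declare adaptive_seq.simps [simp del]

lemma adaptive_seq_truncate: "adaptive_seq s Z k = Z (k, s k (truncate_seq k (adaptive_seq s Z)))"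
  by (simp add: truncate_seq_def adaptive_seq.simps[of s Z k])

text \<open>
  The choice ranges over countably many laws in each step, so that its measurability is that of a map
  into a discrete space.
\<close>

locale adaptive_choice =
  fixes \<mu> :: "nat \<Rightarrow> nat \<Rightarrow> real measure" and s :: "nat \<Rightarrow> seq_space \<Rightarrow> nat"
  assumes laws: "real_distribution (\<mu> k i)"
    and choice_measurable [measurable]: "s k \<in> measurable borel (count_space UNIV)"
    and choice_past: "s k (truncate_seq k \<omega>) = s k \<omega>"
begin

sublocale mu: real_distribution "\<mu> k i" for k i
  by (rule laws)

definition array :: "(nat \<times> nat \<Rightarrow> real) measure"
  where "array = Pi\<^sub>M UNIV (\<lambda>p. \<mu> (fst p) (snd p))"

sublocale array: prob_space array
  unfolding array_def by (intro prob_space_PiM mu.prob_space_axioms)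

abbreviation X :: "(nat \<times> nat \<Rightarrow> real) \<Rightarrow> seq_space"
  where "X \<equiv> adaptive_seq s"

lemma X_eq: "X Z k = Z (k, s k (X Z))"
  by (subst adaptive_seq_truncate) (simp add: choice_past)

lemma array_component [measurable]: "(\<lambda>Z. Z p) \<in> borel_measurable array"
proof -
  have "(\<lambda>Z. Z p) \<in> measurable array (\<mu> (fst p) (snd p))"
    unfolding array_def by (rule measurable_component_singleton) simp
  then show ?thesis by (simp cong: measurable_cong_sets)
qed

lemma X_measurable [measurable]: "X \<in> measurable array borel"
proof (rule measurable_seqI)
  show "(\<lambda>Z. X Z k) \<in> borel_measurable array" for k
  proof (induction k rule: less_induct)
    case (less k)
    have "(\<lambda>Z. truncate_seq k (X Z)) \<in> measurable array borel"
    proof (rule measurable_seqI)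
      show "(\<lambda>Z. truncate_seq k (X Z) j) \<in> borel_measurable array" for j
        using less by (cases "j < k") (simp_all add: truncate_seq_def)
    qed
    then have "(\<lambda>Z. s k (truncate_seq k (X Z))) \<in> measurable array (count_space UNIV)"
      by (rule measurable_compose) (rule choice_measurable)
    then have "(\<lambda>Z. Z (k, s k (truncate_seq k (X Z)))) \<in> borel_measurable array"
      by (rule measurable_compose_countable[rotated]) (rule array_component)
    then show ?case by (simp only: adaptive_seq_truncate[symmetric])
  qed
qed

definition law :: "seq_space measure"
  where "law = distr array borel X"

sublocale law: prob_space law
  unfolding law_def by (rule array.prob_space_distr) simp

lemma sets_law [measurable_cong, simp]: "sets law = sets borel"
  by (simp add: law_def)

lemma space_law [simp]: "space law = UNIV"
  by (simp add: law_def)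

lemma law_prob: "law \<in> prob_measures"
  by (simp add: prob_measures_def law.prob_space_axioms)

lemma X_update_before: "j < k \<Longrightarrow> X (Z((k, i) := x)) j = X Z j"
proof (induction j rule: less_induct)
  case (less j)
  then have "truncate_seq j (X (Z((k, i) := x))) = truncate_seq j (X Z)"
    by (simp add: truncate_seq_def fun_eq_iff del: fun_upd_apply)
  moreover have "(Z((k, i) := x)) (j, m) = Z (j, m)" for m using less.prems by simp
  ultimately show ?case by (simp add: adaptive_seq_truncate del: fun_upd_apply)
qed

lemma choice_X_update: "s k (X (Z((k, i) := x))) = s k (X Z)"
proof -
  have "truncate_seq k (X (Z((k, i) := x))) = truncate_seq k (X Z)"
    by (auto simp: truncate_seq_def X_update_before)
  then show ?thesis by (metis choice_past)
qed

lemma measurable_join_const [measurable]: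
  "(\<lambda>(\<omega>, x). join_vec k \<omega> (\<lambda>_. x)) \<in> measurable (borel \<Otimes>\<^sub>M borel) (borel :: seq_space measure)"
proof (rule measurable_seqI)
  show "(\<lambda>x. (case x of (\<omega>, x) \<Rightarrow> join_vec k \<omega> (\<lambda>_. x)) j) \<in> borel_measurable (borel \<Otimes>\<^sub>M borel)" for j
    by (cases "j < k") (simp_all add: join_vec_def split_def)
qed

text \<open>
  Replacing the entry \<open>Z (k, i)\<close> by an independent copy changes neither the law of the array nor the
  coordinates before \<open>k\<close>, while on the event that index \<open>i\<close> is selected the coordinate at time \<open>k\<close>
  becomes the fresh copy.
\<close>

lemma resample:
  fixes \<phi> :: "seq_space \<Rightarrow> real"
  assumes [measurable]: "\<phi> \<in> borel_measurable borel" and bd: "\<And>\<omega>. \<bar>\<phi> \<omega>\<bar> \<le> C"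
    and past: "\<And>\<omega>. \<phi> (truncate_seq (Suc k) \<omega>) = \<phi> \<omega>"
  shows "(\<integral>\<omega>. indicator {\<omega>. s k \<omega> = i} \<omega> * \<phi> \<omega> \<partial>law) =
    (\<integral>\<omega>. indicator {\<omega>. s k \<omega> = i} \<omega> * (\<integral>x. \<phi> (join_vec k \<omega> (\<lambda>_. x)) \<partial>\<mu> k i) \<partial>law)"
proof -
  let ?I = "\<lambda>\<omega>. indicator {\<omega>. s k \<omega> = i} \<omega> :: real"
  have I [measurable]: "?I \<in> borel_measurable borel" by measurable
  define up where "up = (\<lambda>(x, Z). Z((k, i) := x) :: nat \<times> nat \<Rightarrow> real)"
  have D: "distr (\<mu> k i \<Otimes>\<^sub>M array) array up = array"
    using distr_pair_PiM_eq_PiM[of UNIV "\<lambda>p. \<mu> (fst p) (snd p)" "(k, i)"]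
    by (simp add: array_def up_def mu.prob_space_axioms)
  have up [measurable]: "up \<in> measurable (\<mu> k i \<Otimes>\<^sub>M array) array"
  proof -
    have "(\<lambda>(x, Z). Z((k, i) := x)) \<in> measurable (\<mu> k i \<Otimes>\<^sub>M array) (Pi\<^sub>M (insert (k, i) UNIV) (\<lambda>p. \<mu> (fst p) (snd p)))"
      unfolding array_def
      using measurable_add_dim[of "(k, i)" UNIV "\<lambda>p. \<mu> (fst p) (snd p)"] measurable_pair_swap
      by (simp add: measurable_split_conv split_def measurable_fun_upd[where J = UNIV])
    then show ?thesis by (simp add: up_def array_def)
  qed
  interpret pair: pair_prob_space "\<mu> k i" array ..
  have jm [measurable]: "(\<lambda>p. \<phi> (join_vec k (X (snd p)) (\<lambda>_. fst p))) \<in> borel_measurable (\<mu> k i \<Otimes>\<^sub>M array)"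
    by (rule measurable_compose[OF _ assms(1)],
        rule measurable_compose[OF _ measurable_join_const[of k], of "\<lambda>p. (X (snd p), fst p)", simplified]) measurable
  have "(\<integral>\<omega>. ?I \<omega> * \<phi> \<omega> \<partial>law) = (\<integral>Z. ?I (X Z) * \<phi> (X Z) \<partial>array)"
    unfolding law_def by (rule integral_distr) auto
  also have "\<dots> = (\<integral>p. ?I (X (up p)) * \<phi> (X (up p)) \<partial>(\<mu> k i \<Otimes>\<^sub>M array))"
    by (subst D[symmetric]) (rule integral_distr; measurable)
  also have "\<dots> = (\<integral>p. ?I (X (snd p)) * \<phi> (join_vec k (X (snd p)) (\<lambda>_. fst p)) \<partial>(\<mu> k i \<Otimes>\<^sub>M array))"
  proof (rule Bochner_Integration.integral_cong[OF refl])
    fix p :: "real \<times> (nat \<times> nat \<Rightarrow> real)"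
    obtain x Z where p: "p = (x, Z)" by (cases p)
    have "\<phi> (X (Z((k, i) := x))) = \<phi> (join_vec k (X Z) (\<lambda>_. x))" if "s k (X Z) = i"
    proof -
      have "X (Z((k, i) := x)) k = x" using that by (subst X_eq) (simp add: choice_X_update)
      then have "truncate_seq (Suc k) (X (Z((k, i) := x))) = truncate_seq (Suc k) (join_vec k (X Z) (\<lambda>_. x))"
        by (auto simp: truncate_seq_def join_vec_def fun_eq_iff less_Suc_eq X_update_before)
      then show ?thesis by (metis past)
    qed
    then show "?I (X (up p)) * \<phi> (X (up p)) = ?I (X (snd p)) * \<phi> (join_vec k (X (snd p)) (\<lambda>_. fst p))"
      by (simp add: p up_def choice_X_update indicator_def)
  qed
  also have "\<dots> = (\<integral>Z. (\<integral>x. ?I (X Z) * \<phi> (join_vec k (X Z) (\<lambda>_. x)) \<partial>\<mu> k i) \<partial>array)"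
  proof -
    have "integrable (\<mu> k i \<Otimes>\<^sub>M array) (\<lambda>p. ?I (X (snd p)) * \<phi> (join_vec k (X (snd p)) (\<lambda>_. fst p)))"
      using bd by (intro pair.P.integrable_const_bound[where B = C]) 
        (auto simp: abs_mult indicator_def intro: order_trans[OF abs_ge_zero bd])
    then show ?thesis
      using pair.integral_snd[of "\<lambda>x Z. ?I (X Z) * \<phi> (join_vec k (X Z) (\<lambda>_. x))"]
      unfolding split_def by simp
  qed
  also have "\<dots> = (\<integral>Z. ?I (X Z) * (\<integral>x. \<phi> (join_vec k (X Z) (\<lambda>_. x)) \<partial>\<mu> k i) \<partial>array)" by simp
  also have "\<dots> = (\<integral>\<omega>. ?I \<omega> * (\<integral>x. \<phi> (join_vec k \<omega> (\<lambda>_. x)) \<partial>\<mu> k i) \<partial>law)"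
  proof -
    have "(\<lambda>\<omega>. \<integral>x. \<phi> (join_vec k \<omega> (\<lambda>_. x)) \<partial>\<mu> k i) \<in> borel_measurable borel"
      by (rule mu.borel_measurable_lebesgue_integral)
         (simp add: split_def measurable_compose[OF measurable_join_const[unfolded split_def] assms(1)] cong: measurable_cong_sets sets_pair_measure_cong)
    then show ?thesis unfolding law_def by (subst integral_distr) auto
  qed
  finally show ?thesis .
qed

lemma integral_eq_0_by_choice:
  fixes h :: "seq_space \<Rightarrow> real"
  assumes [measurable]: "h \<in> borel_measurable borel" and bd: "\<And>\<omega>. \<bar>h \<omega>\<bar> \<le> C"
    and zero: "\<And>i. (\<integral>\<omega>. indicator {\<omega>. s k \<omega> = i} \<omega> * h \<omega> \<partial>law) = 0"
  shows "(\<integral>\<omega>. h \<omega> \<partial>law) = 0"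
proof -
  have int: "integrable law (\<lambda>\<omega>. indicator A \<omega> * h \<omega>)" if [measurable]: "A \<in> sets borel" for A
    using bd by (intro law.integrable_const_bound[where B = C])
      (auto simp: abs_mult indicator_def intro: order_trans[OF abs_ge_zero bd])
  have "(\<integral>\<omega>. indicator {\<omega>. s k \<omega> < m} \<omega> * h \<omega> \<partial>law) = 0" for m
  proof (induction m)
    case (Suc m)
    have "(\<integral>\<omega>. indicator {\<omega>. s k \<omega> < Suc m} \<omega> * h \<omega> \<partial>law) =
        (\<integral>\<omega>. indicator {\<omega>. s k \<omega> < m} \<omega> * h \<omega> + indicator {\<omega>. s k \<omega> = m} \<omega> * h \<omega> \<partial>law)"
      by (intro Bochner_Integration.integral_cong) (auto simp: indicator_def)
    also have "\<dots> = 0"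
      by (subst Bochner_Integration.integral_add) (auto intro!: int simp: Suc zero)
    finally show ?case .
  qed simp
  moreover have "(\<lambda>m. \<integral>\<omega>. indicator {\<omega>. s k \<omega> < m} \<omega> * h \<omega> \<partial>law) \<longlonglongrightarrow> (\<integral>\<omega>. h \<omega> \<partial>law)"
  proof (rule integral_dominated_convergence[where w = "\<lambda>_. C"])
    have "(\<lambda>m. indicator {\<omega>. s k \<omega> < m} \<omega> * h \<omega>) \<longlonglongrightarrow> h \<omega>" for \<omega>
      by (rule tendsto_eventually) (use eventually_gt_at_top[of "s k \<omega>"] in eventually_elim, simp)
    then show "AE \<omega> in law. (\<lambda>m. indicator {\<omega>. s k \<omega> < m} \<omega> * h \<omega>) \<longlonglongrightarrow> h \<omega>" by simp
    show "AE \<omega> in law. norm (indicator {\<omega>. s k \<omega> < m} \<omega> * h \<omega>) \<le> C" for m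
      using bd by (intro AE_I2) (auto simp: abs_mult indicator_def intro: order_trans[OF abs_ge_zero bd])
  qed auto
  ultimately show ?thesis by (simp add: LIMSEQ_const_iff)
qed

lemma kernel_measurable:
  fixes \<phi> :: "seq_space \<Rightarrow> real"
  assumes "\<phi> \<in> borel_measurable borel"
  shows "(\<lambda>\<omega>. \<integral>x. \<phi> (join_vec k \<omega> (\<lambda>_. x)) \<partial>\<mu> k i) \<in> borel_measurable borel"
  by (rule mu.borel_measurable_lebesgue_integral)
     (simp add: split_def measurable_compose[OF measurable_join_const[unfolded split_def] assms] cong: measurable_cong_sets sets_pair_measure_cong)

lemma measurable_join_const_right:
  fixes \<phi> :: "seq_space \<Rightarrow> real"
  assumes "\<phi> \<in> borel_measurable borel"
  shows "(\<lambda>x. \<phi> (join_vec k \<omega> (\<lambda>_. x))) \<in> borel_measurable borel"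
  using measurable_compose[OF _ measurable_compose[OF measurable_join_const[of k] assms], of "\<lambda>x. (\<omega>, x)" borel]
  by simp

text \<open>
  The conditional law of coordinate \<open>k\<close>, given the earlier coordinates \<open>\<omega>\<close>, is \<open>\<mu> k (s k \<omega>)\<close>.
\<close>

lemma tower:
  fixes \<phi> :: "seq_space \<Rightarrow> real"
  assumes [measurable]: "\<phi> \<in> borel_measurable borel" and bd: "\<And>\<omega>. \<bar>\<phi> \<omega>\<bar> \<le> C"
    and past: "\<And>\<omega>. \<phi> (truncate_seq (Suc k) \<omega>) = \<phi> \<omega>"
  shows "(\<lambda>\<omega>. \<integral>x. \<phi> (join_vec k \<omega> (\<lambda>_. x)) \<partial>\<mu> k (s k \<omega>)) \<in> borel_measurable borel" (is ?m)
    and "\<bar>\<integral>x. \<phi> (join_vec k \<omega> (\<lambda>_. x)) \<partial>\<mu> k (s k \<omega>)\<bar> \<le> C" (is ?b)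
    and "(\<integral>\<omega>. \<phi> \<omega> \<partial>law) = (\<integral>\<omega>. (\<integral>x. \<phi> (join_vec k \<omega> (\<lambda>_. x)) \<partial>\<mu> k (s k \<omega>)) \<partial>law)" (is ?e)
proof -
  define K where "K i \<omega> = (\<integral>x. \<phi> (join_vec k \<omega> (\<lambda>_. x)) \<partial>\<mu> k i)" for i \<omega>
  have Ki [measurable]: "K i \<in> borel_measurable borel" for i
    using kernel_measurable[OF assms(1), of k i] by (simp add: K_def[abs_def])
  have KC: "\<bar>K i \<omega>\<bar> \<le> C" for i \<omega>
  proof -
    have [measurable]: "(\<lambda>x. \<phi> (join_vec k \<omega> (\<lambda>_. x))) \<in> borel_measurable borel"
      by (rule measurable_join_const_right) fact
    have i: "integrable (\<mu> k i) (\<lambda>x. \<phi> (join_vec k \<omega> (\<lambda>_. x)))"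
      by (rule mu.integrable_const_bound[where B = C]) (use bd in auto)
    have "\<bar>K i \<omega>\<bar> \<le> (\<integral>x. \<bar>\<phi> (join_vec k \<omega> (\<lambda>_. x))\<bar> \<partial>\<mu> k i)"
      unfolding K_def by (rule integral_abs_bound)
    also have "\<dots> \<le> C" using bd i by (intro mu.integral_le_const) auto
    finally show ?thesis .
  qed
  have m: "(\<lambda>\<omega>. K (s k \<omega>) \<omega>) \<in> borel_measurable borel"
    by (rule measurable_compose_countable[OF Ki choice_measurable])
  then show ?m by (simp add: K_def)
  show ?b using KC[of "s k \<omega>" \<omega>] by (simp add: K_def)
  note [measurable] = m
  have "(\<integral>\<omega>. \<phi> \<omega> - K (s k \<omega>) \<omega> \<partial>law) = 0"
  proof (rule integral_eq_0_by_choice[where C = "C + C" and k = k])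
    show "\<bar>\<phi> \<omega> - K (s k \<omega>) \<omega>\<bar> \<le> C + C" for \<omega> using bd[of \<omega>] KC[of "s k \<omega>" \<omega>] by linarith
    fix i
    have int: "integrable law (\<lambda>\<omega>. indicator {\<omega>. s k \<omega> = i} \<omega> * h \<omega>)"
      if [measurable]: "h \<in> borel_measurable borel" and "\<And>\<omega>. \<bar>h \<omega>\<bar> \<le> C" for h
      using that(2) by (intro law.integrable_const_bound[where B = C])
        (auto simp: abs_mult indicator_def intro: order_trans[OF abs_ge_zero that(2)])
    have "(\<integral>\<omega>. indicator {\<omega>. s k \<omega> = i} \<omega> * (\<phi> \<omega> - K (s k \<omega>) \<omega>) \<partial>law) =
        (\<integral>\<omega>. indicator {\<omega>. s k \<omega> = i} \<omega> * \<phi> \<omega> - indicator {\<omega>. s k \<omega> = i} \<omega> * K i \<omega> \<partial>law)"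
      by (intro Bochner_Integration.integral_cong) (auto simp: indicator_def)
    also have "\<dots> = (\<integral>\<omega>. indicator {\<omega>. s k \<omega> = i} \<omega> * \<phi> \<omega> \<partial>law) - (\<integral>\<omega>. indicator {\<omega>. s k \<omega> = i} \<omega> * K i \<omega> \<partial>law)"
      by (intro Bochner_Integration.integral_diff int bd KC) auto
    also have "\<dots> = 0" using resample[OF assms(1) bd past, of i] by (simp add: K_def)
    finally show "(\<integral>\<omega>. indicator {\<omega>. s k \<omega> = i} \<omega> * (\<phi> \<omega> - K (s k \<omega>) \<omega>) \<partial>law) = 0" .
  qed measurable
  moreover have "integrable law \<phi>" using bd by (intro law.integrable_const_bound[where B = C]) auto
  moreover have "integrable law (\<lambda>\<omega>. K (s k \<omega>) \<omega>)" using KC by (intro law.integrable_const_bound[where B = C]) auto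
  ultimately show ?e by (simp add: K_def)
qed

lemma law_past_coord:
  assumes B: "B \<in> past k" "B \<subseteq> {\<omega>. s k \<omega> = i}" and A: "A \<in> sets borel"
  shows "measure law (B \<inter> {\<omega>. \<omega> k \<in> A}) = measure law B * measure (\<mu> k i) A"
proof -
  have [measurable]: "B \<in> sets borel" using B(1) by (rule past_borel)
  have [measurable]: "{\<omega> :: seq_space. \<omega> k \<in> A} \<in> sets borel" using past_coord[of k "Suc k"] A by (auto simp: past_def)
  define \<phi> :: "seq_space \<Rightarrow> real" where "\<phi> = indicator (B \<inter> {\<omega>. \<omega> k \<in> A})"
  have past: "B \<inter> {\<omega>. \<omega> k \<in> A} \<in> past (Suc k)"
    using B A by (intro past_Int past_coord past_mono[OF B(1)]) auto
  have "measure law (B \<inter> {\<omega>. \<omega> k \<in> A}) = (\<integral>\<omega>. \<phi> \<omega> \<partial>law)" by (simp add: \<phi>_def)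
  also have "\<dots> = (\<integral>\<omega>. (\<integral>x. \<phi> (join_vec k \<omega> (\<lambda>_. x)) \<partial>\<mu> k (s k \<omega>)) \<partial>law)"
  proof (rule tower(3)[where C = 1])
    show "\<phi> \<in> borel_measurable borel" unfolding \<phi>_def by measurable
    show "\<phi> (truncate_seq (Suc k) \<omega>) = \<phi> \<omega>" for \<omega>
      using past unfolding \<phi>_def past_def by (simp add: indicator_def)
  qed (auto simp: \<phi>_def indicator_def)
  also have "\<dots> = (\<integral>\<omega>. indicator B \<omega> * measure (\<mu> k i) A \<partial>law)"
  proof (rule Bochner_Integration.integral_cong[OF refl])
    fix \<omega>
    have "join_vec k \<omega> (\<lambda>_. x) \<in> B \<longleftrightarrow> \<omega> \<in> B" for x
    proof -
      have "truncate_seq k (join_vec k \<omega> (\<lambda>_. x)) = truncate_seq k \<omega>"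
        by (auto simp: truncate_seq_def join_vec_def)
      then show ?thesis using B(1) unfolding past_def by (metis (mono_tags, lifting) mem_Collect_eq)
    qed
    then have "\<phi> (join_vec k \<omega> (\<lambda>_. x)) = indicator B \<omega> * indicator A x" for x
      by (auto simp: \<phi>_def indicator_def join_vec_def)
    then have "(\<integral>x. \<phi> (join_vec k \<omega> (\<lambda>_. x)) \<partial>\<mu> k (s k \<omega>)) = indicator B \<omega> * measure (\<mu> k (s k \<omega>)) A"
      using A by simp
    then show "(\<integral>x. \<phi> (join_vec k \<omega> (\<lambda>_. x)) \<partial>\<mu> k (s k \<omega>)) = indicator B \<omega> * measure (\<mu> k i) A"
      using B(2) by (auto simp: indicator_def)
  qed
  also have "\<dots> = measure law B * measure (\<mu> k i) A" by simp
  finally show ?thesis .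
qed

text \<open>
  The construction commutes with shifting the rows of the array, and the array is invariant under
  such a shift.
\<close>

lemma law_stationary:
  assumes s_per: "\<And>k \<omega>. s (k + n) \<omega> = s k (shift_seq n \<omega>)" and mu_per: "\<And>k i. \<mu> (k + n) i = \<mu> k i"
  shows "distr law borel (shift_seq n) = law"
proof -
  define f where "f = (\<lambda>(k, i). (k + n, i :: nat))"
  have inj: "inj f" by (auto simp: f_def inj_on_def)
  have re: "distr array array (\<lambda>Z p. Z (f p)) = array"
    using distr_PiM_reindex[of UNIV "\<lambda>p. \<mu> (fst p) (snd p)" f UNIV] inj
    by (simp add: array_def mu.prob_space_axioms f_def split_def mu_per restrict_def)
  have shift: "shift_seq n (X Z) = X (\<lambda>p. Z (f p))" for Z
  proof
    show "shift_seq n (X Z) k = X (\<lambda>p. Z (f p)) k" for k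
    proof (induction k rule: less_induct)
      case (less k)
      then have "truncate_seq k (shift_seq n (X Z)) = truncate_seq k (X (\<lambda>p. Z (f p)))"
        by (auto simp: truncate_seq_def)
      then have "s k (shift_seq n (X Z)) = s k (X (\<lambda>p. Z (f p)))" by (metis choice_past)
      then show ?case by (subst (2) X_eq, simp add: shift_seq_def, subst X_eq) (simp add: s_per f_def shift_seq_def)
    qed
  qed
  have fm: "(\<lambda>Z p. Z (f p)) \<in> measurable array array"
  proof -
    have "(\<lambda>Z. \<lambda>p\<in>UNIV. Z (f p)) \<in> measurable array (Pi\<^sub>M UNIV (\<lambda>p. \<mu> (fst p) (snd p)))"
      by (intro measurable_restrict) (simp cong: measurable_cong_sets)
    then show ?thesis by (simp add: array_def restrict_def)
  qed
  have "distr law borel (shift_seq n) = distr array borel (shift_seq n \<circ> X)"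
    unfolding law_def by (rule distr_distr) auto
  also have "\<dots> = distr array borel (X \<circ> (\<lambda>Z p. Z (f p)))" by (simp add: shift comp_def)
  also have "\<dots> = distr (distr array array (\<lambda>Z p. Z (f p))) borel X"
    by (rule distr_distr[symmetric]) (auto intro: fm)
  finally show ?thesis by (simp add: re law_def)
qed

end

text \<open>
  The \<open>\<sigma>\<close>-algebra of the first \<open>Suc k\<close> coordinates is generated by the past up to \<open>k\<close> and the coordinate
  \<open>k\<close>. The uniqueness theorem for measures is applied to the images under truncation, with products
  of Borel sets as a generator that is stable under intersection.
\<close>

lemma measure_eq_on_past_Suc:
  fixes P Q :: "seq_space measure"
  assumes P: "prob_space P" "sets P = sets borel" and Q: "prob_space Q" "sets Q = sets borel"
    and eq: "\<And>B A. B \<in> past k \<Longrightarrow> A \<in> sets borel \<Longrightarrow> measure P (B \<inter> {\<omega>. \<omega> k \<in> A}) = measure Q (B \<inter> {\<omega>. \<omega> k \<in> A})"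
    and B: "B \<in> past (Suc k)"
  shows "measure P B = measure Q B"
proof -
  interpret P: prob_space P by fact
  interpret Q: prob_space Q by fact
  let ?t = "truncate_seq (Suc k)"
  note [measurable_cong] = P(2) Q(2)
  have sp: "space P = UNIV" "space Q = UNIV" using P(2) Q(2) by (auto dest: sets_eq_imp_space_eq)
  have box_measurable: "{\<omega> :: seq_space. \<forall>j. \<omega> j \<in> A j} \<in> sets borel" if "\<And>j. A j \<in> sets borel" for A
  proof -
    have "{\<omega> :: seq_space. \<omega> j \<in> A j} \<in> sets borel" for j
      using past_coord[of j "Suc j"] that by (auto simp: past_def)
    then have "(\<Inter>j. {\<omega> :: seq_space. \<omega> j \<in> A j}) \<in> sets borel" by auto
    then show ?thesis by (simp add: Collect_all_eq)
  qed
  let ?E = "{{\<omega> :: seq_space. \<forall>j. \<omega> j \<in> A j} | A. \<forall>j. A j \<in> sets borel}"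
  have gen: "sigma_sets UNIV ?E = sets (borel :: seq_space measure)"
  proof
    have "?E \<subseteq> sets borel" using box_measurable by auto
    then show "sigma_sets UNIV ?E \<subseteq> sets borel" using sets.sigma_sets_subset[of ?E borel] by auto
    show "sets borel \<subseteq> sigma_sets UNIV ?E"
      unfolding borel_seq_eq_sigma_coord
    proof (rule sigma_sets_mono', clarify)
      fix j and A :: "real set" assume "A \<in> sets borel"
      then show "\<exists>A'. {\<omega>. \<omega> j \<in> A} = {\<omega> :: seq_space. \<forall>i. \<omega> i \<in> A' i} \<and> (\<forall>i. A' i \<in> sets borel)"
        by (intro exI[of _ "\<lambda>i. if i = j then A else UNIV"]) auto
    qed
  qed
  have distr_eq: "distr P borel ?t = distr Q borel ?t"
  proof (rule measure_eqI_generator_eq[where E = ?E and \<Omega> = UNIV and A = "\<lambda>_. UNIV"])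
    show "Int_stable ?E"
    proof (rule Int_stableI)
      fix a b assume "a \<in> ?E" "b \<in> ?E"
      then obtain A A' where "a = {\<omega>. \<forall>j. \<omega> j \<in> A j}" "\<forall>j. A j \<in> sets borel"
        "b = {\<omega>. \<forall>j. \<omega> j \<in> A' j}" "\<forall>j. A' j \<in> sets borel" by auto
      then show "a \<inter> b \<in> ?E" by (intro CollectI exI[of _ "\<lambda>j. A j \<inter> A' j"]) auto
    qed
    fix C assume "C \<in> ?E"
    then obtain A where A: "C = {\<omega>. \<forall>j. \<omega> j \<in> A j}" "\<And>j. A j \<in> sets borel" by auto
    have C [measurable]: "C \<in> sets borel" using A box_measurable by simp
    \<comment> \<open>The conditions on the coordinates other than \<open>k\<close>; those beyond \<open>k\<close> are tested at the filler zero.\<close>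
    define D where "D = truncate_seq k -` {\<omega>. \<forall>j. \<omega> j \<in> (if j = k then UNIV else A j)}"
    have D: "D \<in> past k"
      unfolding D_def using A(2) by (intro past_vimage_truncate box_measurable) auto
    have "?t -` C = D \<inter> {\<omega>. \<omega> k \<in> A k}"
    proof -
      have "?t \<omega> j = truncate_seq k \<omega> j" if "j \<noteq> k" for \<omega> j using that by (auto simp: truncate_seq_def less_Suc_eq)
      moreover have "?t \<omega> k = \<omega> k" for \<omega> by (simp add: truncate_seq_def)
      ultimately have "(\<forall>j. ?t \<omega> j \<in> A j) \<longleftrightarrow> (\<forall>j. truncate_seq k \<omega> j \<in> (if j = k then UNIV else A j)) \<and> \<omega> k \<in> A k" for \<omega>
        by (metis UNIV_I)
      then show ?thesis by (auto simp: A D_def)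
    qed
    then have "measure P (?t -` C) = measure Q (?t -` C)" using eq[OF D A(2)] by simp
    then show "emeasure (distr P borel ?t) C = emeasure (distr Q borel ?t) C"
      by (simp add: emeasure_distr P.emeasure_eq_measure Q.emeasure_eq_measure sp)
  next
    show "emeasure (distr P borel ?t) UNIV \<noteq> \<infinity>" by (simp add: emeasure_distr P.emeasure_eq_measure)
    show "range (\<lambda>_ :: nat. UNIV) \<subseteq> ?E"
      by (auto intro!: exI[of _ "\<lambda>_. UNIV"])
  qed (auto simp: gen intro!: exI[of _ "\<lambda>_. UNIV"])
  have Bm: "B \<in> sets borel" using B by (rule past_borel)
  have v: "?t -` B = B" using B by (auto simp: past_def)
  have "measure P B = measure (distr P borel ?t) B" using Bm by (subst measure_distr) (auto simp: v sp)
  also have "\<dots> = measure Q B" unfolding distr_eq using Bm by (subst measure_distr) (auto simp: v sp)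
  finally show ?thesis .
qed

section \<open>Extreme stationary measures have independent blocks\<close>

lemma shift_seq_shift_seq: "shift_seq m (shift_seq n \<omega>) = shift_seq (m + n) \<omega>"
  by (simp add: shift_seq_def add.assoc)

lemma shift_seq_0 [simp]: "shift_seq 0 \<omega> = \<omega>"
  by (simp add: shift_seq_def)

lemma shift_seq_funpow: "(shift_seq n ^^ j) \<omega> = shift_seq (j * n) \<omega>"
  by (induction j) (simp_all add: shift_seq_shift_seq)

lemma vimage_shift_borel: "A \<in> sets borel \<Longrightarrow> shift_seq n -` A \<in> sets borel"
  using measurable_sets[OF measurable_shift_seq, of A n] by simp

locale stationary_measure =
  fixes P :: "seq_space measure" and n :: nat
  assumes P_prob: "P \<in> prob_measures" and stationary: "distr P borel (shift_seq n) = P"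
begin

sublocale prob_space P
  using P_prob by (simp add: prob_measures_def)

lemma sets_P [measurable_cong, simp]: "sets P = sets borel"
  using P_prob by (simp add: prob_measures_def)

lemma space_P [simp]: "space P = UNIV"
  using P_prob by (rule prob_measures_space)

lemma stationary_multiple: "distr P borel (shift_seq (k * n)) = P"
proof (induction k)
  case 0
  have "distr P borel (shift_seq 0) = distr P P (\<lambda>x. x)" by (intro distr_cong) auto
  also have "\<dots> = P" by (rule distr_id)
  finally show ?case by (simp only: mult_0)
next
  case (Suc k)
  have "distr P borel (shift_seq (Suc k * n)) = distr P borel (shift_seq (k * n) \<circ> shift_seq n)"
    by (intro distr_cong) (auto simp: shift_seq_shift_seq add.commute)
  also have "\<dots> = distr (distr P borel (shift_seq n)) borel (shift_seq (k * n))"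
    by (rule distr_distr[symmetric]) auto
  finally show ?case by (simp add: stationary Suc)
qed

lemma stationary_measure: "A \<in> sets borel \<Longrightarrow> measure P (shift_seq (k * n) -` A) = measure P A"
  using measure_distr[of "shift_seq (k * n)" P borel A] by (simp add: stationary_multiple)

sublocale measure_preserving P "shift_seq n"
proof
  show "shift_seq n \<in> measurable P P" by measurable
  show "distr P P (shift_seq n) = P" using stationary by (simp cong: distr_cong)
qed

end

locale extreme_stationary = iid_sublinear E + stationary_measure P n for E P n +
  assumes extreme: "P \<in> extreme_measures (max_repr E)" and n_pos: "1 \<le> n"
begin

lemma P_max_repr: "P \<in> max_repr E"
  using extreme by (simp add: extreme_measures_def)

text \<open>
  By invariance, \<open>P\<close> is the mixture of the conditional laws of the shifted sequence given \<open>B\<close> and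
  given its complement. Both are representing measures, so they equal \<open>P\<close> by extremality.
\<close>

lemma past_future_indep:
  assumes B: "B \<in> past (k * n)" and A: "A \<in> sets borel"
  shows "measure P (B \<inter> shift_seq (k * n) -` A) = measure P B * measure P A"
proof -
  let ?s = "shift_seq (k * n)"
  have Bm [measurable]: "B \<in> sets borel" using B by (rule past_borel)
  have Am [measurable]: "?s -` A \<in> sets borel" using A by (rule vimage_shift_borel)
  have cB: "measure P (UNIV - B) = 1 - measure P B" using prob_compl[of B] by simp
  consider "measure P B = 0" | "measure P (UNIV - B) = 0" | "0 < measure P B" "0 < measure P (UNIV - B)"
    using measure_nonneg[of P B] measure_nonneg[of P "UNIV - B"] by linarith
  then show ?thesis
  proof cases
    case 1
    then have "measure P (B \<inter> ?s -` A) \<le> 0" using finite_measure_mono[of "B \<inter> ?s -` A" B] by simp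
    with 1 show ?thesis by (simp add: measure_le_0_iff)
  next
    case 2
    have "measure P (B \<inter> ?s -` A) = measure P (?s -` A)"
    proof (rule finite_measure_eq_AE)
      have "AE x in P. x \<notin> UNIV - B" using 2 by (subst prob_eq_0[symmetric]) auto
      then show "AE x in P. x \<in> B \<inter> ?s -` A \<longleftrightarrow> x \<in> ?s -` A" by eventually_elim auto
    qed auto
    with 2 cB show ?thesis using A by (simp add: stationary_measure)
  next
    case 3
    let ?Q = "cond_shift P (k * n) B" and ?R = "cond_shift P (k * n) (UNIV - B)"
    have QR: "?Q \<in> max_repr E" "?R \<in> max_repr E"
      using 3 by (intro cond_shift_max_repr P_max_repr B past_Compl; simp)+
    note mQ = cond_shift_measure[OF P_prob Bm 3(1), of _ "k * n"]
    have mR: "measure ?R C = measure P ((UNIV - B) \<inter> ?s -` C) / measure P (UNIV - B)"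
      if "C \<in> sets borel" for C
      by (rule cond_shift_measure[OF P_prob _ 3(2) that]) simp
    have comb: "measure P C = measure P B * measure ?Q C + (1 - measure P B) * measure ?R C"
      if C: "C \<in> sets borel" for C
    proof -
      have [measurable]: "?s -` C \<in> sets borel" using C by (rule vimage_shift_borel)
      have "measure P C = measure P (?s -` C)" using C by (simp add: stationary_measure)
      also have "\<dots> = measure P (B \<inter> ?s -` C) + measure P ((UNIV - B) \<inter> ?s -` C)"
        by (subst finite_measure_Union[symmetric]) (auto intro!: arg_cong[of _ _ "measure P"])
      finally show ?thesis using 3 C by (simp add: mQ mR cB[symmetric])
    qed
    have "\<And>Q R t. Q \<in> max_repr E \<Longrightarrow> R \<in> max_repr E \<Longrightarrow> 0 < t \<Longrightarrow> t < 1 \<Longrightarrow>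
        (\<And>C. C \<in> sets borel \<Longrightarrow> measure P C = t * measure Q C + (1 - t) * measure R C) \<Longrightarrow> Q = P"
      using extreme by (auto simp: extreme_measures_def)
    from this[OF QR 3(1) _ comb] have "?Q = P" using 3(2) cB by simp
    then have "measure P A = measure P (B \<inter> ?s -` A) / measure P B" using mQ[OF A] by simp
    then show ?thesis using 3(1) by (simp add: field_simps)
  qed
qed

text \<open>
  An event that can be shifted away arbitrarily far is independent of every past, and therefore of
  itself. Shifting by multiples of \<open>n\<close> covers both the tail events and the events that are invariant
  under the \<open>n\<close>-shift.
\<close>

lemma zero_one_law:
  assumes tail: "\<And>k. \<exists>C\<in>sets borel. A = shift_seq (k * n) -` C"
  shows "measure P A = 0 \<or> measure P A = 1"
proof (rule disjCI)
  assume "measure P A \<noteq> 1"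
  have Am [measurable]: "A \<in> sets borel" using tail[of 0] vimage_shift_borel by auto
  show "measure P A = 0"
  proof (rule ccontr)
    assume "measure P A \<noteq> 0"
    then have pos: "measure P A > 0" using measure_nonneg[of P A] by linarith
    \<comment> \<open>Conditioning on \<open>A\<close> changes the probability of no past event.\<close>
    have indep: "measure P (A \<inter> B) = measure P A * measure P B" if "B \<in> past m" for m B
    proof -
      have B: "B \<in> past (m * n)" using that n_pos by (auto intro: past_mono)
      obtain C where C: "C \<in> sets borel" "A = shift_seq (m * n) -` C" using tail by blast
      have "measure P A = measure P C" using C by (simp add: stationary_measure)
      then show ?thesis using past_future_indep[OF B C(1)] C(2) by (simp add: Int_commute mult.commute)
    qed
    have mU: "measure (uniform_measure P A) B = measure P (A \<inter> B) / measure P A" if "B \<in> sets borel" for B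
      using pos that by (intro measure_uniform_measure) (auto simp: emeasure_eq_measure)
    have "uniform_measure P A = P"
    proof (rule prob_eq_on_pastI)
      show "prob_space (uniform_measure P A)"
        using pos by (intro prob_space_uniform_measure) (auto simp: emeasure_eq_measure)
      show "measure (uniform_measure P A) B = measure P B" if "B \<in> past m" for m B
        using mU[OF past_borel[OF that]] indep[OF that] pos by simp
    qed (auto intro: prob_space_axioms)
    then have "measure P A = 1" using mU[OF Am] pos by simp
    with \<open>measure P A \<noteq> 1\<close> show False ..
  qed
qed

sublocale ergodic P "shift_seq n"
proof
  fix A assume A: "A \<in> sets P" "shift_seq n -` A \<inter> space P = A"
  have "shift_seq (k * n) -` A = A" for k
  proof (induction k)
    case (Suc k)
    have "shift_seq (Suc k * n) -` A = shift_seq n -` (shift_seq (k * n) -` A)"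
      by (auto simp: shift_seq_shift_seq add.commute)
    then show ?case using Suc A(2) by simp
  qed simp
  then show "measure P A = 0 \<or> measure P A = 1" using A(1) by (intro zero_one_law) auto
qed

end

lemma tail_event_shift:
  assumes "A \<in> tail_sigma"
  shows "\<exists>C\<in>sets borel. A = shift_seq n -` C"
proof -
  have "A \<in> sigma_sets UNIV {coord k -` B |k B. n \<le> k \<and> B \<in> sets borel}"
    using assms by (simp add: tail_sigma_def)
  then show ?thesis
  proof induction
    case (Basic a)
    then obtain k B where a: "a = coord k -` B" "n \<le> k" "B \<in> sets borel" by blast
    have "coord (k - n) -` B \<in> sets borel"
      using measurable_sets[OF measurable_coord' a(3), of "k - n"] by simp
    moreover have "a = shift_seq n -` (coord (k - n) -` B)" using a by (auto simp: shift_seq_def coord_def)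
    ultimately show ?case by blast
  next
    case Empty
    show ?case by (rule bexI[of _ "{}"]) auto
  next
    case (Compl a)
    then obtain C where "C \<in> sets borel" "a = shift_seq n -` C" by blast
    then show ?case using sets.compl_sets[of C borel] by (intro bexI[of _ "UNIV - C"]) auto
  next
    case (Union a)
    then obtain C where "\<And>i. C i \<in> sets borel" "\<And>i. a i = shift_seq n -` C i" by metis
    then show ?case by (intro bexI[of _ "\<Union>i. C i"]) auto
  qed
qed

section \<open>Convergence of averages\<close>

lemma div_over_self_tendsto:
  assumes "1 \<le> n"
  shows "(\<lambda>N. real (N div n) / real N) \<longlonglongrightarrow> 1 / real n"
proof (rule tendsto_sandwich)
  have eq: "real N / real n = real (N div n) + real (N mod n) / real n" for N
  proof -
    have "real N = real (N div n) * real n + real (N mod n)"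
      by (metis div_mult_mod_eq of_nat_add of_nat_mult)
    then show ?thesis using assms by (simp add: field_simps)
  qed
  have m: "real (N mod n) / real n \<le> 1" for N using assms by simp
  show "\<forall>\<^sub>F N in sequentially. 1 / real n - 1 / real N \<le> real (N div n) / real N"
    using eventually_gt_at_top[of 0]
  proof eventually_elim
    case (elim N)
    have "(real N / real n - 1) / real N \<le> real (N div n) / real N"
      using eq[of N] m[of N] elim by (intro divide_right_mono) auto
    then show ?case using elim by (simp add: diff_divide_distrib)
  qed
  show "\<forall>\<^sub>F N in sequentially. real (N div n) / real N \<le> 1 / real n"
    using eventually_gt_at_top[of 0]
  proof eventually_elim
    case (elim N)
    have "real (N div n) / real N \<le> (real N / real n) / real N"
      using eq[of N] elim by (intro divide_right_mono) auto
    then show ?case using elim by simp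
  qed
  show "(\<lambda>N. 1 / real n - 1 / real N) \<longlonglongrightarrow> 1 / real n"
    using tendsto_diff[OF tendsto_const lim_1_over_n] by simp
qed simp

text \<open>
  Up to an incomplete block, the sum of \<open>N\<close> terms is the sum of \<open>N div n\<close> blocks. The incomplete block
  is bounded by an increment of the block sums of absolute values, and such increments are
  negligible because the averages of these sums converge.
\<close>

lemma averages_tendsto_if_block_averages:
  fixes x :: "nat \<Rightarrow> real" and a b :: real
  assumes n: "1 \<le> n"
    and lim: "(\<lambda>J. (\<Sum>k<J * n. x k) / J) \<longlonglongrightarrow> n * a"
    and lim_abs: "(\<lambda>J. (\<Sum>k<J * n. \<bar>x k\<bar>) / J) \<longlonglongrightarrow> b"
  shows "(\<lambda>N. (\<Sum>k<N. x k) / N) \<longlonglongrightarrow> a"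
proof -
  define J where "J N = N div n" for N
  define S where "S j = (\<Sum>k<j * n. x k)" for j
  define G where "G j = (\<Sum>k<j * n. \<bar>x k\<bar>)" for j
  have Jtop: "filterlim J sequentially sequentially"
    unfolding J_def filterlim_at_top
  proof
    fix Z
    show "\<forall>\<^sub>F N in sequentially. Z \<le> N div n"
      using eventually_ge_at_top[of "Z * n"]
      by eventually_elim (use n in \<open>auto simp: less_eq_div_iff_mult_less_eq\<close>)
  qed
  have JN: "(\<lambda>N. real (J N) / N) \<longlonglongrightarrow> 1 / n" unfolding J_def by (rule div_over_self_tendsto[OF n])
  have SJN: "(\<lambda>N. S (J N) / N) \<longlonglongrightarrow> a"
  proof -
    have "(\<lambda>N. S (J N) / J N * (real (J N) / N)) \<longlonglongrightarrow> (n * a) * (1 / n)"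
      by (intro tendsto_mult JN filterlim_compose[OF lim[folded S_def] Jtop])
    moreover have "S (J N) / J N * (real (J N) / N) = S (J N) / N" for N
      by (cases "J N = 0") (auto simp: S_def)
    ultimately show ?thesis using n by (simp only:) simp
  qed
  have GJN: "(\<lambda>N. G (J N) / N) \<longlonglongrightarrow> b * (1 / n)"
  proof -
    have "(\<lambda>N. G (J N) / J N * (real (J N) / N)) \<longlonglongrightarrow> b * (1 / n)"
      by (intro tendsto_mult JN filterlim_compose[OF lim_abs[folded G_def] Jtop])
    moreover have "G (J N) / J N * (real (J N) / N) = G (J N) / N" for N
      by (cases "J N = 0") (auto simp: G_def)
    ultimately show ?thesis by (simp only:)
  qed
  have GSJN: "(\<lambda>N. G (Suc (J N)) / N) \<longlonglongrightarrow> b * (1 / n)"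
  proof -
    have "(\<lambda>N. real (J N) / N + 1 / N) \<longlonglongrightarrow> 1 / n + 0" by (intro tendsto_add JN lim_1_over_n)
    then have "(\<lambda>N. G (Suc (J N)) / Suc (J N) * (real (J N) / N + 1 / N)) \<longlonglongrightarrow> b * (1 / n)"
      using filterlim_compose[OF LIMSEQ_Suc[OF lim_abs[folded G_def]] Jtop]
      by (intro tendsto_mult) auto
    moreover have "G (Suc (J N)) / Suc (J N) * (real (J N) / N + 1 / N) = G (Suc (J N)) / N" for N
    proof -
      have "real (J N) / N + 1 / N = Suc (J N) / N" by (simp add: add_divide_distrib)
      then show ?thesis by (simp del: of_nat_Suc)
    qed
    ultimately show ?thesis by (simp only:)
  qed
  have err: "\<bar>(\<Sum>k<N. x k) - S (J N)\<bar> \<le> G (Suc (J N)) - G (J N)" for N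
  proof -
    have le: "J N * n \<le> N" "N \<le> Suc (J N) * n"
      using n div_times_less_eq_dividend[of N n] dividend_less_div_times[of n N]
      by (auto simp: J_def)
    have "(\<Sum>k<N. x k) - S (J N) = (\<Sum>k\<in>{J N * n..<N}. x k)"
      using sum_diff_nat_ivl[of 0 "J N * n" N x] le by (simp add: S_def lessThan_atLeast0)
    then have "\<bar>(\<Sum>k<N. x k) - S (J N)\<bar> \<le> (\<Sum>k\<in>{J N * n..<N}. \<bar>x k\<bar>)" by simp
    also have "\<dots> \<le> (\<Sum>k\<in>{J N * n..<Suc (J N) * n}. \<bar>x k\<bar>)" using le by (intro sum_mono2) auto
    also have "\<dots> = G (Suc (J N)) - G (J N)"
      using sum_diff_nat_ivl[of 0 "J N * n" "Suc (J N) * n" "\<lambda>k. \<bar>x k\<bar>"] by (simp add: G_def lessThan_atLeast0)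
    finally show ?thesis .
  qed
  have "(\<lambda>N. G (Suc (J N)) / N - G (J N) / N) \<longlonglongrightarrow> 0"
    using tendsto_diff[OF GSJN GJN] by simp
  then have "(\<lambda>N. (\<Sum>k<N. x k) / N - S (J N) / N) \<longlonglongrightarrow> 0"
    by (rule Lim_null_comparison[rotated])
       (use err in \<open>auto intro!: always_eventually divide_right_mono simp flip: diff_divide_distrib\<close>)
  from tendsto_add[OF this SJN] show ?thesis by simp
qed

lemma (in extreme_stationary) averages_tendsto:
  assumes int: "\<And>k. integrable P (coord k)"
  shows "AE \<omega> in P. (\<lambda>N. avg N \<omega>) \<longlonglongrightarrow> (\<integral>\<omega>. avg n \<omega> \<partial>P)"
proof -
  define f where "f \<omega> = (\<Sum>k<n. \<omega> k)" for \<omega> :: seq_space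
  define g where "g \<omega> = (\<Sum>k<n. \<bar>\<omega> k\<bar>)" for \<omega> :: seq_space
  have int': "integrable P (\<lambda>\<omega>. \<omega> k)" for k using int[of k] by (simp add: coord_def[abs_def])
  have f: "integrable P f" unfolding f_def by (intro Bochner_Integration.integrable_sum int')
  have g: "integrable P g" unfolding g_def by (intro Bochner_Integration.integrable_sum integrable_abs int')
  have block: "(\<Sum>j<J. \<Sum>k<n. h (shift_seq (j * n) \<omega> k)) = (\<Sum>k<J * n. h (\<omega> k))" for J \<omega> and h :: "real \<Rightarrow> real"
    by (induction J) (simp_all add: sum_lessThan_add add.commute[of n] shift_seq_def add.commute[of _ "_ * n"])
  have fa: "(\<integral>\<omega>. f \<omega> \<partial>P) = n * (\<integral>\<omega>. avg n \<omega> \<partial>P)"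
    using n_pos by (simp add: avg_def f_def coord_def)
  have "AE \<omega> in P. (\<lambda>J. birkhoff_sum (shift_seq n) f J \<omega> / J) \<longlonglongrightarrow> (\<integral>\<omega>. f \<omega> \<partial>P)"
    by (rule birkhoff_average_tendsto[OF f])
  moreover have "AE \<omega> in P. (\<lambda>J. birkhoff_sum (shift_seq n) g J \<omega> / J) \<longlonglongrightarrow> (\<integral>\<omega>. g \<omega> \<partial>P)"
    by (rule birkhoff_average_tendsto[OF g])
  ultimately show ?thesis
  proof eventually_elim
    case (elim \<omega>)
    have "birkhoff_sum (shift_seq n) f J \<omega> = (\<Sum>k<J * n. \<omega> k)" for J
      using block[of "\<lambda>x. x"] by (simp add: birkhoff_sum_def shift_seq_funpow f_def)
    moreover have "birkhoff_sum (shift_seq n) g J \<omega> = (\<Sum>k<J * n. \<bar>\<omega> k\<bar>)" for J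
      using block[of abs] by (simp add: birkhoff_sum_def shift_seq_funpow g_def)
    ultimately show ?case
      using averages_tendsto_if_block_averages[OF n_pos, of \<omega>] elim by (simp only: fa avg_def coord_def)
  qed
qed

lemma upper_lower_avg_eq:
  assumes "(\<lambda>N. avg N \<omega>) \<longlonglongrightarrow> m"
  shows "upper_avg \<omega> = ereal m" "lower_avg \<omega> = ereal m"
proof -
  have lim: "(\<lambda>N. ereal (avg N \<omega>)) \<longlonglongrightarrow> ereal m" using assms by simp
  show "upper_avg \<omega> = ereal m" unfolding upper_avg_def by (rule lim_imp_Limsup[OF _ lim]) simp
  show "lower_avg \<omega> = ereal m" unfolding lower_avg_def by (rule lim_imp_Liminf[OF _ lim]) simp
qed

section \<open>Truncation of functions in \<open>Lp_space\<close>\<close>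

text \<open>
  Convergence in \<open>p\<close>-th mean, uniform over the representing measures, implies uniform convergence in
  mean. It is used to exchange \<open>X\<close> for functions in \<^const>\<open>Cb\<close> under all these measures at once.
\<close>

lemma Lp_space_L1_approx:
  fixes X :: "'a::topological_space \<Rightarrow> real"
  assumes X: "X \<in> Lp_space E p" and p: "1 < p" and "0 < \<epsilon>"
  obtains Y where "Y \<in> Cb" "\<And>P. P \<in> max_repr E \<Longrightarrow> integrable P X"
    "\<And>P. P \<in> max_repr E \<Longrightarrow> (\<integral>\<omega>. \<bar>X \<omega> - Y \<omega>\<bar> \<partial>P) \<le> \<epsilon>"
proof -
  define \<delta> where "\<delta> = \<epsilon> / 2"
  have \<delta>: "\<delta> > 0" using assms by (simp add: \<delta>_def)
  have [measurable]: "X \<in> borel_measurable borel" using X by (simp add: Lp_space_def)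
  obtain Z where Z: "\<And>n. Z n \<in> Cb"
    "(\<lambda>n. SUP P\<in>max_repr E. \<integral>\<^sup>+\<omega>. ennreal (\<bar>X \<omega> - Z n \<omega>\<bar> powr p) \<partial>P) \<longlonglongrightarrow> 0"
    using X by (auto simp: Lp_space_def)
  have "\<forall>\<^sub>F n in sequentially. (SUP P\<in>max_repr E. \<integral>\<^sup>+\<omega>. ennreal (\<bar>X \<omega> - Z n \<omega>\<bar> powr p) \<partial>P) < ennreal (\<delta> powr p)"
    using Z(2) by (rule order_tendstoD) (use \<delta> in simp)
  then obtain n where n: "(SUP P\<in>max_repr E. \<integral>\<^sup>+\<omega>. ennreal (\<bar>X \<omega> - Z n \<omega>\<bar> powr p) \<partial>P) < ennreal (\<delta> powr p)"
    by (auto simp: eventually_sequentially)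
  \<comment> \<open>Values above \<open>\<delta>\<close> are controlled by their \<open>p\<close>-th power, as in Markov's inequality.\<close>
  have elem: "a \<le> \<delta> + \<delta> powr (1 - p) * a powr p" if "0 \<le> a" for a :: real
  proof (cases "a \<le> \<delta>")
    case True then show ?thesis using \<delta> by (intro add_increasing2) auto
  next
    case False
    then have "a = a powr (1 - p) * a powr p" using that \<delta> by (simp flip: powr_add)
    also have "\<dots> \<le> \<delta> powr (1 - p) * a powr p"
      using False \<delta> p by (intro mult_right_mono powr_mono2') auto
    finally show ?thesis using \<delta> by linarith
  qed
  have main: "integrable P (\<lambda>\<omega>. X \<omega> - Z n \<omega>) \<and> (\<integral>\<omega>. \<bar>X \<omega> - Z n \<omega>\<bar> \<partial>P) \<le> \<epsilon>"
    if P: "P \<in> max_repr E" for P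
  proof -
    interpret prob_space P using max_repr_prob[OF P] by (simp add: prob_measures_def)
    have [measurable_cong]: "sets P = sets borel" using max_repr_prob[OF P] by (simp add: prob_measures_def)
    have [measurable]: "Z n \<in> borel_measurable borel" by (rule Cb_measurable[OF Z(1)])
    have "(\<integral>\<^sup>+\<omega>. ennreal (\<bar>X \<omega> - Z n \<omega>\<bar> powr p) \<partial>P) \<le> ennreal (\<delta> powr p)"
      using SUP_upper[OF P, of "\<lambda>P. \<integral>\<^sup>+\<omega>. ennreal (\<bar>X \<omega> - Z n \<omega>\<bar> powr p) \<partial>P"] n by (meson le_less_trans less_imp_le)
    then have 1: "ennreal (\<delta> powr (1 - p)) * (\<integral>\<^sup>+\<omega>. ennreal (\<bar>X \<omega> - Z n \<omega>\<bar> powr p) \<partial>P) \<le> ennreal (\<delta> powr (1 - p)) * ennreal (\<delta> powr p)"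
      by (rule mult_left_mono) simp
    have "(\<integral>\<^sup>+\<omega>. ennreal \<bar>X \<omega> - Z n \<omega>\<bar> \<partial>P) \<le>
        (\<integral>\<^sup>+\<omega>. ennreal \<delta> + ennreal (\<delta> powr (1 - p)) * ennreal (\<bar>X \<omega> - Z n \<omega>\<bar> powr p) \<partial>P)"
      using elem \<delta> by (intro nn_integral_mono) (simp flip: ennreal_mult ennreal_plus)
    also have "\<dots> = ennreal \<delta> + ennreal (\<delta> powr (1 - p)) * (\<integral>\<^sup>+\<omega>. ennreal (\<bar>X \<omega> - Z n \<omega>\<bar> powr p) \<partial>P)"
      by (simp add: nn_integral_add nn_integral_cmult emeasure_space_1)
    also have "\<dots> \<le> ennreal \<delta> + ennreal (\<delta> powr (1 - p)) * ennreal (\<delta> powr p)"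
      using 1 by (rule add_left_mono)
    also have "\<dots> = ennreal \<epsilon>"
      using \<delta> by (simp add: \<delta>_def flip: ennreal_mult ennreal_plus powr_add)
    finally have le: "(\<integral>\<^sup>+\<omega>. ennreal \<bar>X \<omega> - Z n \<omega>\<bar> \<partial>P) \<le> ennreal \<epsilon>" .
    have i: "integrable P (\<lambda>\<omega>. X \<omega> - Z n \<omega>)"
      using le by (intro integrableI_bounded) (auto intro: le_less_trans)
    have "ennreal (\<integral>\<omega>. \<bar>X \<omega> - Z n \<omega>\<bar> \<partial>P) \<le> ennreal \<epsilon>"
      using le nn_integral_eq_integral[OF integrable_abs[OF i]] by simp
    then show ?thesis using i \<open>0 < \<epsilon>\<close> by simp
  qed
  show thesis
  proof (rule that[OF Z(1)[of n]])
    fix P assume P: "P \<in> max_repr E"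
    show "(\<integral>\<omega>. \<bar>X \<omega> - Z n \<omega>\<bar> \<partial>P) \<le> \<epsilon>" using main[OF P] ..
    show "integrable P X"
      using Bochner_Integration.integrable_add[OF conjunct1[OF main[OF P]] integrable_Cb[OF max_repr_prob[OF P] Z(1)[of n]]]
      by simp
  qed
qed

definition clamp_real :: "real \<Rightarrow> real \<Rightarrow> real"
  where "clamp_real L x = max (- L) (min L x)"

text \<open>
  An approximating function \<open>Y\<close> is bounded by some \<open>L\<close>, and no value between \<open>- L\<close> and \<open>L\<close> is closer to
  \<open>X \<omega>\<close> than the clamped value.
\<close>

lemma Lp_space_truncation:
  fixes X :: "'a::topological_space \<Rightarrow> real"
  assumes X: "X \<in> Lp_space E p" and p: "1 < p" and "0 < \<epsilon>"
  obtains L where "0 \<le> L" "\<And>P. P \<in> max_repr E \<Longrightarrow> (\<integral>\<omega>. \<bar>X \<omega> - clamp_real L (X \<omega>)\<bar> \<partial>P) \<le> \<epsilon>"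
proof -
  obtain Y where Y: "Y \<in> Cb" "\<And>P. P \<in> max_repr E \<Longrightarrow> integrable P X"
    "\<And>P. P \<in> max_repr E \<Longrightarrow> (\<integral>\<omega>. \<bar>X \<omega> - Y \<omega>\<bar> \<partial>P) \<le> \<epsilon>"
    using Lp_space_L1_approx[OF assms] by metis
  obtain L where L: "0 \<le> L" "\<And>\<omega>. \<bar>Y \<omega>\<bar> \<le> L" using CbE[OF Y(1)] by metis
  show thesis
  proof (rule that[OF L(1)])
    fix P assume P: "P \<in> max_repr E"
    have [measurable_cong]: "sets P = sets borel" using max_repr_prob[OF P] by (simp add: prob_measures_def)
    have [measurable]: "X \<in> borel_measurable borel" using X by (simp add: Lp_space_def)
    have le: "\<bar>X \<omega> - clamp_real L (X \<omega>)\<bar> \<le> \<bar>X \<omega> - Y \<omega>\<bar>" for \<omega>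
      using L(2)[of \<omega>] by (auto simp: clamp_real_def max_def min_def abs_if split: if_splits)
    have i: "integrable P (\<lambda>\<omega>. \<bar>X \<omega> - Y \<omega>\<bar>)"
      by (intro integrable_abs Bochner_Integration.integrable_diff Y(2)[OF P] integrable_Cb[OF max_repr_prob[OF P] Y(1)])
    have "integrable P (\<lambda>\<omega>. \<bar>X \<omega> - clamp_real L (X \<omega>)\<bar>)"
      by (rule Bochner_Integration.integrable_bound[OF i]) (use le in \<open>auto simp: clamp_real_def\<close>)
    then have "(\<integral>\<omega>. \<bar>X \<omega> - clamp_real L (X \<omega>)\<bar> \<partial>P) \<le> (\<integral>\<omega>. \<bar>X \<omega> - Y \<omega>\<bar> \<partial>P)"
      using i le by (intro integral_mono)
    then show "(\<integral>\<omega>. \<bar>X \<omega> - clamp_real L (X \<omega>)\<bar> \<partial>P) \<le> \<epsilon>" using Y(3)[OF P] by linarith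
  qed
qed

section \<open>The laws of a single coordinate\<close>

context iid_sublinear
begin

text \<open>
  The possible laws of a single coordinate, given the past.
\<close>

definition coord_laws :: "real measure set"
  where "coord_laws = {\<mu>. real_distribution \<mu> \<and> (\<forall>\<psi>\<in>Cb. integral\<^sup>L \<mu> \<psi> \<le> E (\<lambda>\<omega>. \<psi> (\<omega> 0)))}"

lemma Cb_coord: "\<psi> \<in> Cb \<Longrightarrow> (\<lambda>\<omega> :: seq_space. \<psi> (\<omega> k)) \<in> Cb"
  by (rule Cb_comp[of \<psi> "\<lambda>\<omega>. \<omega> k"]) (simp_all add: continuous_coord)

lemma coord_law_in_coord_laws:
  assumes P: "P \<in> max_repr E" shows "distr P borel (\<lambda>\<omega>. \<omega> 0) \<in> coord_laws"
proof -
  interpret prob_space P using max_repr_prob[OF P] by (simp add: prob_measures_def)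
  have [measurable_cong]: "sets P = sets borel" using max_repr_prob[OF P] by (simp add: prob_measures_def)
  have "integral\<^sup>L (distr P borel (\<lambda>\<omega>. \<omega> 0)) \<psi> \<le> E (\<lambda>\<omega>. \<psi> (\<omega> 0))" if "\<psi> \<in> Cb" for \<psi>
    using max_repr_le[OF P Cb_coord[OF that]] Cb_measurable[OF that] by (subst integral_distr) auto
  then show ?thesis by (simp add: coord_laws_def)
qed

lemma coord_laws_SUP:
  assumes \<psi>: "\<psi> \<in> Cb" shows "(SUP \<mu>\<in>coord_laws. integral\<^sup>L \<mu> \<psi>) = E (\<lambda>\<omega>. \<psi> (\<omega> 0))"
proof (rule antisym)
  have ne: "coord_laws \<noteq> {}" using max_repr_nonempty coord_law_in_coord_laws by auto
  then show "(SUP \<mu>\<in>coord_laws. integral\<^sup>L \<mu> \<psi>) \<le> E (\<lambda>\<omega>. \<psi> (\<omega> 0))"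
    using \<psi> by (intro cSUP_least) (auto simp: coord_laws_def)
  have bdd: "bdd_above ((\<lambda>\<mu>. integral\<^sup>L \<mu> \<psi>) ` coord_laws)"
    using \<psi> by (intro bdd_aboveI[of _ "E (\<lambda>\<omega>. \<psi> (\<omega> 0))"]) (auto simp: coord_laws_def)
  show "E (\<lambda>\<omega>. \<psi> (\<omega> 0)) \<le> (SUP \<mu>\<in>coord_laws. integral\<^sup>L \<mu> \<psi>)"
  proof (rule E_least[OF Cb_coord[OF \<psi>]])
    fix P assume P: "P \<in> max_repr E"
    have [measurable_cong]: "sets P = sets borel" using max_repr_prob[OF P] by (simp add: prob_measures_def)
    have "(\<integral>\<omega>. \<psi> (\<omega> 0) \<partial>P) = integral\<^sup>L (distr P borel (\<lambda>\<omega>. \<omega> 0)) \<psi>"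
      using Cb_measurable[OF \<psi>] by (subst integral_distr) auto
    also have "\<dots> \<le> (SUP \<mu>\<in>coord_laws. integral\<^sup>L \<mu> \<psi>)"
      by (rule cSUP_upper[OF coord_law_in_coord_laws[OF P] bdd])
    finally show "(\<integral>\<omega>. \<psi> (\<omega> 0) \<partial>P) \<le> (SUP \<mu>\<in>coord_laws. integral\<^sup>L \<mu> \<psi>)" .
  qed
qed

text \<open>
  Tightness is regularity, applied to continuous functions that decrease to zero and dominate the
  indicators of complements of growing intervals.
\<close>

lemma coord_laws_uniformly_tight:
  assumes "\<epsilon> > 0"
  obtains a b :: real where "a < b" "\<And>\<mu>. \<mu> \<in> coord_laws \<Longrightarrow> measure \<mu> {a<..b} > 1 - \<epsilon>"
proof -
  \<comment> \<open>A continuous majorant of the indicator of the complement of \<open>[- (K + 1), K + 1]\<close>.\<close>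
  define h where "h K x = min 1 (max 0 (\<bar>x\<bar> - real K))" for K and x :: real
  have h: "h K \<in> Cb" for K unfolding h_def by (rule CbI[of _ 1]) (auto intro!: continuous_intros)
  have "(\<lambda>K. E (\<lambda>\<omega>. h K (\<omega> 0))) \<longlonglongrightarrow> E (\<lambda>_. 0)"
  proof (rule E_decseq_tendsto)
    show "(\<lambda>\<omega> :: seq_space. h K (\<omega> 0)) \<in> Cb" for K by (rule Cb_coord[OF h])
    show "decseq (\<lambda>K. h K (\<omega> 0))" for \<omega> :: seq_space by (auto simp: decseq_def h_def)
    show "(\<lambda>K. h K (\<omega> 0)) \<longlonglongrightarrow> 0" for \<omega> :: seq_space
    proof (rule tendsto_eventually)
      obtain N :: nat where N: "\<bar>\<omega> 0\<bar> \<le> N" using real_arch_simple by blast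
      show "\<forall>\<^sub>F K in sequentially. h K (\<omega> 0) = 0"
        using eventually_ge_at_top[of N] by eventually_elim (use N in \<open>auto simp: h_def\<close>)
    qed
  qed simp
  then have "\<forall>\<^sub>F K in sequentially. E (\<lambda>\<omega>. h K (\<omega> 0)) < \<epsilon>"
    using assms by (intro order_tendstoD) auto
  then obtain K where K: "E (\<lambda>\<omega>. h K (\<omega> 0)) < \<epsilon>" by (auto simp: eventually_sequentially)
  show thesis
  proof (rule that[of "- (real K + 1)" "real K + 1"])
    fix \<mu> assume \<mu>: "\<mu> \<in> coord_laws"
    then interpret real_distribution \<mu> by (simp add: coord_laws_def)
    let ?I = "{- (real K + 1)<..real K + 1}"
    have [measurable]: "h K \<in> borel_measurable borel" by (rule Cb_measurable[OF h])
    have "prob (UNIV - ?I) = (\<integral>x. indicator (UNIV - ?I) x \<partial>\<mu>)" by simp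
    also have "\<dots> \<le> (\<integral>x. h K x \<partial>\<mu>)"
    proof (rule integral_mono)
      show "integrable \<mu> (h K)" by (rule integrable_const_bound[where B = 1]) (auto simp: h_def)
      show "indicator (UNIV - ?I) x \<le> h K x" for x by (auto simp: indicator_def h_def)
    qed (simp add: emeasure_eq_measure)
    also have "\<dots> \<le> E (\<lambda>\<omega>. h K (\<omega> 0))" using \<mu> h by (simp add: coord_laws_def)
    finally have "prob (UNIV - ?I) < \<epsilon>" using K by linarith
    then show "prob ?I > 1 - \<epsilon>" using prob_compl[of ?I] by simp
  qed simp
qed

lemma coord_laws_weakly_compact: "weakly_compact coord_laws"
  unfolding weakly_compact_def
proof (intro conjI ballI allI impI)
  show rd: "real_distribution \<mu>" if "\<mu> \<in> coord_laws" for \<mu> using that by (simp add: coord_laws_def)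
  fix u :: "nat \<Rightarrow> real measure" assume u: "\<forall>n. u n \<in> coord_laws"
  have "tight u" unfolding tight_def
  proof (intro conjI allI impI)
    show "real_distribution (u n)" for n using u rd by blast
    fix \<epsilon> :: real assume "0 < \<epsilon>"
    then obtain a b where "a < b" "\<And>\<mu>. \<mu> \<in> coord_laws \<Longrightarrow> measure \<mu> {a<..b} > 1 - \<epsilon>"
      using coord_laws_uniformly_tight by metis
    then show "\<exists>a b. a < b \<and> (\<forall>n. 1 - \<epsilon> < measure (u n) {a<..b})" using u by blast
  qed
  from tight_imp_convergent_subsubsequence[OF this strict_mono_id]
  obtain r \<mu> where r: "strict_mono (r :: nat \<Rightarrow> nat)" "real_distribution \<mu>" "weak_conv_m (\<lambda>n. u (r n)) \<mu>"
    by (auto simp: comp_def id_def)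
  have "integral\<^sup>L \<mu> \<psi> \<le> E (\<lambda>\<omega>. \<psi> (\<omega> 0))" if \<psi>: "\<psi> \<in> Cb" for \<psi>
  proof (rule LIMSEQ_le_const2)
    show "(\<lambda>n. integral\<^sup>L (u (r n)) \<psi>) \<longlonglongrightarrow> integral\<^sup>L \<mu> \<psi>"
      by (rule weak_conv_m_integral[OF _ r(2,3) \<psi>]) (use u rd in blast)
    show "\<exists>N. \<forall>n\<ge>N. integral\<^sup>L (u (r n)) \<psi> \<le> E (\<lambda>\<omega>. \<psi> (\<omega> 0))"
      using u \<psi> by (auto simp: coord_laws_def)
  qed
  then have "\<mu> \<in> coord_laws" using r(2) by (simp add: coord_laws_def)
  then show "\<exists>r \<mu>. strict_mono (r :: nat \<Rightarrow> nat) \<and> \<mu> \<in> coord_laws \<and> weak_conv_m (\<lambda>n. u (r n)) \<mu>"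
    using r by blast
qed

lemma ex_extreme_coord_law:
  assumes "\<psi> \<in> Cb"
  obtains \<mu> where "\<mu> \<in> extreme_measures coord_laws" "integral\<^sup>L \<mu> \<psi> = E (\<lambda>\<omega>. \<psi> (\<omega> 0))"
proof -
  have "coord_laws \<noteq> {}" using max_repr_nonempty coord_law_in_coord_laws by auto
  then show thesis
    using ex_extreme_maximizer[OF coord_laws_weakly_compact _ assms] that coord_laws_SUP[OF assms] by metis
qed

lemma cond_law_in_coord_laws:
  assumes P: "P \<in> max_repr E" and B: "B \<in> past k" "measure P B > 0"
  obtains \<nu> where "\<nu> \<in> coord_laws"
    "\<And>A. A \<in> sets borel \<Longrightarrow> measure \<nu> A = measure P (B \<inter> {\<omega>. \<omega> k \<in> A}) / measure P B"
proof (rule that[OF coord_law_in_coord_laws[OF cond_shift_max_repr[OF P B]]])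
  fix A :: "real set" assume A: "A \<in> sets borel"
  have [measurable_cong]: "sets (cond_shift P k B) = sets borel" by (simp add: cond_shift_def)
  have sp: "space (cond_shift P k B) = UNIV" by (simp add: cond_shift_def)
  have m: "{\<omega> :: seq_space. \<omega> 0 \<in> A} \<in> sets borel" using past_coord[of 0 1] A by (auto simp: past_def)
  have "measure (distr (cond_shift P k B) borel (\<lambda>\<omega>. \<omega> 0)) A = measure (cond_shift P k B) {\<omega>. \<omega> 0 \<in> A}"
    using A by (subst measure_distr) (auto simp: sp vimage_def)
  also have "\<dots> = measure P (B \<inter> {\<omega>. \<omega> k \<in> A}) / measure P B"
    using cond_shift_measure[OF max_repr_prob[OF P] past_borel[OF B(1)] B(2) m, of k]
    by (simp add: vimage_def shift_seq_def)
  finally show "measure (distr (cond_shift P k B) borel (\<lambda>\<omega>. \<omega> 0)) A = measure P (B \<inter> {\<omega>. \<omega> k \<in> A}) / measure P B" .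
qed

lemma continuous_join_const: "continuous_on UNIV (\<lambda>x. join_vec k y (\<lambda>_. x) :: nat \<Rightarrow> real)"
  unfolding join_vec_def
proof (rule continuous_on_coordinatewise_then_product)
  show "continuous_on UNIV (\<lambda>x. if j < k then y j else x)" for j
    by (cases "j < k") (auto intro: continuous_intros)
qed

text \<open>
  The value of \<open>\<phi>\<close> under \<open>E\<close> when the first \<open>k\<close> coordinates are frozen at those of \<open>y\<close>, as in dynamic
  programming.
\<close>

definition value_after :: "nat \<Rightarrow> (seq_space \<Rightarrow> real) \<Rightarrow> seq_space \<Rightarrow> real"
  where "value_after k \<phi> y = E (\<lambda>\<omega>. \<phi> (join_vec k y \<omega>))"

lemma value_after_one:
  assumes "\<phi> \<in> Cb_Lip (Suc k)"
  shows "value_after k \<phi> y = E (\<lambda>\<omega>. \<phi> (join_vec k y (\<lambda>_. \<omega> 0)))"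
  unfolding value_after_def
  by (intro arg_cong[of _ _ E] HOL.ext Cb_Lip_cong[OF assms]) (auto simp: join_vec_def less_Suc_eq)

lemma Cb_join_const: "\<phi> \<in> Cb_Lip n \<Longrightarrow> (\<lambda>x. \<phi> (join_vec k y (\<lambda>_. x))) \<in> Cb"
  by (rule Cb_comp[OF Cb_Lip_imp_Cb continuous_join_const])

end

section \<open>Adaptive choices of extreme laws give extreme measures\<close>

text \<open>
  Only extreme laws are offered to the choice.
\<close>

locale adaptive_extreme = iid_sublinear E + adaptive_choice \<mu> s for E \<mu> s +
  assumes laws_extreme: "\<mu> k i \<in> extreme_measures coord_laws"
begin

lemma laws_coord_laws: "\<mu> k i \<in> coord_laws"
  using laws_extreme by (simp add: extreme_measures_def)

lemma Cb_Lip_truncate: "\<phi> \<in> Cb_Lip n \<Longrightarrow> \<phi> (truncate_seq n \<omega>) = \<phi> \<omega>"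
  by (rule Cb_Lip_cong) (auto simp: truncate_seq_def)

lemma law_integral_step_le:
  assumes \<phi>: "\<phi> \<in> Cb_Lip (Suc k)"
  shows "integral\<^sup>L law \<phi> \<le> integral\<^sup>L law (value_after k \<phi>)"
proof -
  obtain C where C: "\<And>\<omega>. \<bar>\<phi> \<omega>\<bar> \<le> C" using CbE[OF Cb_Lip_imp_Cb[OF \<phi>]] by metis
  have meas [measurable]: "\<phi> \<in> borel_measurable borel" by (rule Cb_measurable[OF Cb_Lip_imp_Cb[OF \<phi>]])
  note tw = tower[OF meas C Cb_Lip_truncate[OF \<phi>]]
  have V: "value_after k \<phi> \<in> Cb_Lip k"
    unfolding value_after_def[abs_def] by (rule Cb_Lip_partial_E[of _ k 1]) (use \<phi> in simp)
  have "integral\<^sup>L law \<phi> = (\<integral>\<omega>. (\<integral>x. \<phi> (join_vec k \<omega> (\<lambda>_. x)) \<partial>\<mu> k (s k \<omega>)) \<partial>law)" by (rule tw(3))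
  also have "\<dots> \<le> integral\<^sup>L law (value_after k \<phi>)"
  proof (rule integral_mono)
    show "integrable law (\<lambda>\<omega>. \<integral>x. \<phi> (join_vec k \<omega> (\<lambda>_. x)) \<partial>\<mu> k (s k \<omega>))"
      using tw(1,2) by (intro law.integrable_const_bound[where B = C]) auto
    show "integrable law (value_after k \<phi>)" by (rule integrable_Cb[OF law_prob Cb_Lip_imp_Cb[OF V]])
    show "(\<integral>x. \<phi> (join_vec k \<omega> (\<lambda>_. x)) \<partial>\<mu> k (s k \<omega>)) \<le> value_after k \<phi> \<omega>" for \<omega>
      using laws_coord_laws[of k "s k \<omega>"] Cb_join_const[OF \<phi>, of k \<omega>]
      unfolding coord_laws_def value_after_one[OF \<phi>] by blast
  qed
  finally show ?thesis .
qed

lemma law_integral_step_ge: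
  assumes \<phi>: "\<phi> \<in> Cb_Lip (Suc k)"
    and near: "\<And>\<omega>. value_after k \<phi> \<omega> - \<epsilon> \<le> (\<integral>x. \<phi> (join_vec k \<omega> (\<lambda>_. x)) \<partial>\<mu> k (s k \<omega>))"
  shows "integral\<^sup>L law (value_after k \<phi>) - \<epsilon> \<le> integral\<^sup>L law \<phi>"
proof -
  obtain C where C: "\<And>\<omega>. \<bar>\<phi> \<omega>\<bar> \<le> C" using CbE[OF Cb_Lip_imp_Cb[OF \<phi>]] by metis
  have meas [measurable]: "\<phi> \<in> borel_measurable borel" by (rule Cb_measurable[OF Cb_Lip_imp_Cb[OF \<phi>]])
  note tw = tower[OF meas C Cb_Lip_truncate[OF \<phi>]]
  have V: "value_after k \<phi> \<in> Cb_Lip k"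
    unfolding value_after_def[abs_def] by (rule Cb_Lip_partial_E[of _ k 1]) (use \<phi> in simp)
  have iV: "integrable law (value_after k \<phi>)" by (rule integrable_Cb[OF law_prob Cb_Lip_imp_Cb[OF V]])
  have "integral\<^sup>L law (value_after k \<phi>) - \<epsilon> = (\<integral>\<omega>. value_after k \<phi> \<omega> - \<epsilon> \<partial>law)"
    using iV law.prob_space by simp
  also have "\<dots> \<le> (\<integral>\<omega>. (\<integral>x. \<phi> (join_vec k \<omega> (\<lambda>_. x)) \<partial>\<mu> k (s k \<omega>)) \<partial>law)"
  proof (rule integral_mono)
    show "integrable law (\<lambda>\<omega>. \<integral>x. \<phi> (join_vec k \<omega> (\<lambda>_. x)) \<partial>\<mu> k (s k \<omega>))"
      using tw(1,2) by (intro law.integrable_const_bound[where B = C]) auto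
    show "integrable law (\<lambda>\<omega>. value_after k \<phi> \<omega> - \<epsilon>)" using iV by simp
  qed (rule near)
  also have "\<dots> = integral\<^sup>L law \<phi>" by (rule tw(3)[symmetric])
  finally show ?thesis .
qed

text \<open>
  Backward induction: integrating out the last coordinate gives at most what \<open>E\<close> gives in the same
  step.
\<close>

lemma law_max_repr: "law \<in> max_repr E"
proof (rule max_repr_if_le_on_Cb_Lip[OF law_prob])
  show "integral\<^sup>L law \<phi> \<le> E \<phi>" if "\<phi> \<in> Cb_Lip n" for n \<phi>
    using that
  proof (induction n arbitrary: \<phi>)
    case 0
    define c where "c = \<phi> undefined"
    have "\<phi> = (\<lambda>_. c)" unfolding c_def using Cb_Lip_cong[OF 0] by auto
    then show ?case using law.prob_space by simp
  next
    case (Suc n)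
    have V: "value_after n \<phi> \<in> Cb_Lip n"
      unfolding value_after_def[abs_def] by (rule Cb_Lip_partial_E[of _ n 1]) (use Suc.prems in simp)
    have "integral\<^sup>L law \<phi> \<le> integral\<^sup>L law (value_after n \<phi>)" by (rule law_integral_step_le[OF Suc.prems])
    also have "\<dots> \<le> E (value_after n \<phi>)" by (rule Suc.IH[OF V])
    also have "\<dots> = E \<phi>" using one_step_indep[OF Suc.prems] by (simp add: value_after_def[abs_def])
    finally show ?case .
  qed
qed

text \<open>
  If the measure is a mixture of \<open>Q\<close> and \<open>R\<close> that agree with it up to time \<open>k\<close>, then its conditional law
  at time \<open>k\<close>, which is extreme, is a mixture with the same weights of the conditional laws under \<open>Q\<close>
  and \<open>R\<close>. So the three also agree at time \<open>k\<close>.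
\<close>

lemma law_mixture_on_past:
  assumes Q: "Q \<in> max_repr E" and R: "R \<in> max_repr E" and t: "0 < t" "t < 1"
    and comb: "\<And>A. A \<in> sets borel \<Longrightarrow> measure law A = t * measure Q A + (1 - t) * measure R A"
  shows "B \<in> past k \<Longrightarrow> measure Q B = measure law B \<and> measure R B = measure law B"
proof (induction k arbitrary: B)
  case 0
  have Qp: "measure Q UNIV = 1" "measure R UNIV = 1" "measure law UNIV = 1"
    using prob_measures_measure_space[OF max_repr_prob[OF Q]] prob_measures_measure_space[OF max_repr_prob[OF R]]
      law.prob_space unfolding prob_measures_space[OF max_repr_prob[OF Q]] prob_measures_space[OF max_repr_prob[OF R]]
    by simp_all
  have "truncate_seq 0 \<omega> = (\<lambda>_. 0)" for \<omega> by (simp add: truncate_seq_def)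
  then have "(\<lambda>_. 0) \<in> B \<longleftrightarrow> \<omega> \<in> B" for \<omega> using 0 by (simp add: past_def)
  then have "B = {} \<or> B = UNIV" by blast
  then show ?case using Qp by auto
next
  case (Suc k)
  interpret Q: prob_space Q using max_repr_prob[OF Q] by (simp add: prob_measures_def)
  interpret R: prob_space R using max_repr_prob[OF R] by (simp add: prob_measures_def)
  have sets: "sets Q = sets borel" "sets R = sets borel"
    using max_repr_prob[OF Q] max_repr_prob[OF R] by (simp_all add: prob_measures_def)
  have piece: "measure Q (C \<inter> {\<omega>. \<omega> k \<in> A}) = measure law (C \<inter> {\<omega>. \<omega> k \<in> A}) \<and>
      measure R (C \<inter> {\<omega>. \<omega> k \<in> A}) = measure law (C \<inter> {\<omega>. \<omega> k \<in> A})"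
    if C: "C \<in> past k" "C \<subseteq> {\<omega>. s k \<omega> = i}" and A: "A \<in> sets borel" for C A i
  proof -
    have Cm: "C \<in> sets borel" using C(1) by (rule past_borel)
    have Am: "{\<omega> :: seq_space. \<omega> k \<in> A} \<in> sets borel" using past_coord[of k "Suc k"] A by (auto simp: past_def)
    have eqC: "measure Q C = measure law C" "measure R C = measure law C" using Suc.IH[OF C(1)] by auto
    show ?thesis
    proof (cases "measure law C = 0")
      case True
      have "measure M (C \<inter> {\<omega>. \<omega> k \<in> A}) = 0" if "finite_measure M" "sets M = sets borel" "measure M C = 0" for M
        using finite_measure.finite_measure_mono[OF that(1), of "C \<inter> {\<omega>. \<omega> k \<in> A}" C] that Cm
        by (simp add: measure_le_0_iff)
      then show ?thesis using True eqC sets Q.finite_measure_axioms R.finite_measure_axioms law.finite_measure_axioms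
        by (metis sets_law)
    next
      case False
      then have pos: "measure law C > 0" using measure_nonneg[of law C] by linarith
      obtain \<nu> where \<nu>: "\<nu> \<in> coord_laws"
        "\<And>A. A \<in> sets borel \<Longrightarrow> measure \<nu> A = measure Q (C \<inter> {\<omega>. \<omega> k \<in> A}) / measure Q C"
        using cond_law_in_coord_laws[OF Q C(1)] pos eqC by metis
      obtain \<rho> where \<rho>: "\<rho> \<in> coord_laws"
        "\<And>A. A \<in> sets borel \<Longrightarrow> measure \<rho> A = measure R (C \<inter> {\<omega>. \<omega> k \<in> A}) / measure R C"
        using cond_law_in_coord_laws[OF R C(1)] pos eqC by metis
      have mix: "measure (\<mu> k i) D = t * measure \<nu> D + (1 - t) * measure \<rho> D" if D: "D \<in> sets borel" for D
      proof -
        have "{\<omega> :: seq_space. \<omega> k \<in> D} \<in> sets borel" using past_coord[of k "Suc k"] D by (auto simp: past_def)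
        then have "measure law (C \<inter> {\<omega>. \<omega> k \<in> D}) = t * measure Q (C \<inter> {\<omega>. \<omega> k \<in> D}) + (1 - t) * measure R (C \<inter> {\<omega>. \<omega> k \<in> D})"
          using Cm by (intro comb) auto
        then have "measure (\<mu> k i) D * measure law C = t * measure Q (C \<inter> {\<omega>. \<omega> k \<in> D}) + (1 - t) * measure R (C \<inter> {\<omega>. \<omega> k \<in> D})"
          using law_past_coord[OF C D] by (simp add: mult.commute)
        then show ?thesis using pos by (simp add: \<nu>(2)[OF D] \<rho>(2)[OF D] eqC field_simps)
      qed
      have "\<nu> = \<mu> k i" "\<rho> = \<mu> k i"
        using laws_extreme[of k i] \<nu>(1) \<rho>(1) t mix unfolding extreme_measures_def by auto
      then show ?thesis using \<nu>(2)[OF A] \<rho>(2)[OF A] law_past_coord[OF C A] pos eqC by (simp add: field_simps)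
    qed
  qed
  have split: "(\<lambda>i. measure M (C \<inter> {\<omega>. s k \<omega> = i} \<inter> {\<omega>. \<omega> k \<in> A})) sums measure M (C \<inter> {\<omega>. \<omega> k \<in> A})"
    if "prob_space M" "sets M = sets borel" and C: "C \<in> sets borel" and A: "A \<in> sets borel" for M C A
  proof -
    interpret prob_space M by fact
    have Am: "{\<omega> :: seq_space. \<omega> k \<in> A} \<in> sets borel" using past_coord[of k "Suc k"] A by (auto simp: past_def)
    have U: "(\<Union>i. C \<inter> {\<omega>. s k \<omega> = i} \<inter> {\<omega>. \<omega> k \<in> A}) = C \<inter> {\<omega>. \<omega> k \<in> A}" by auto
    have "{\<omega>. s k \<omega> = i} \<in> sets borel" for i by measurable
    then have r: "range (\<lambda>i. C \<inter> {\<omega>. s k \<omega> = i} \<inter> {\<omega>. \<omega> k \<in> A}) \<subseteq> sets M"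
      unfolding that(2) using C Am by (intro image_subsetI sets.Int)
    have d: "disjoint_family (\<lambda>i. C \<inter> {\<omega>. s k \<omega> = i} \<inter> {\<omega>. \<omega> k \<in> A})"
      unfolding disjoint_family_on_def by blast
    show ?thesis using finite_measure_UNION[OF r d] unfolding U .
  qed
  have slice: "C \<inter> {\<omega>. s k \<omega> = i} \<in> past k" if "C \<in> past k" for C i
  proof (rule past_Int[OF that])
    have "{\<omega>. s k \<omega> = i} \<in> sets borel" by measurable
    then show "{\<omega>. s k \<omega> = i} \<in> past k" by (simp add: past_def choice_past)
  qed
  have step: "measure Q (C \<inter> {\<omega>. \<omega> k \<in> A}) = measure law (C \<inter> {\<omega>. \<omega> k \<in> A})"
    "measure R (C \<inter> {\<omega>. \<omega> k \<in> A}) = measure law (C \<inter> {\<omega>. \<omega> k \<in> A})"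
    if C: "C \<in> past k" and A: "A \<in> sets borel" for C A
  proof -
    note p = piece[OF slice[OF C] Int_lower2 A]
    note L = split[OF law.prob_space_axioms sets_law past_borel[OF C] A]
    show "measure Q (C \<inter> {\<omega>. \<omega> k \<in> A}) = measure law (C \<inter> {\<omega>. \<omega> k \<in> A})"
      using split[OF Q.prob_space_axioms sets(1) past_borel[OF C] A] L
      unfolding conjunct1[OF p] by (rule sums_unique2)
    show "measure R (C \<inter> {\<omega>. \<omega> k \<in> A}) = measure law (C \<inter> {\<omega>. \<omega> k \<in> A})"
      using split[OF R.prob_space_axioms sets(2) past_borel[OF C] A] L
      unfolding conjunct2[OF p] by (rule sums_unique2)
  qed
  show ?case
  proof
    show "measure Q B = measure law B"
      by (rule measure_eq_on_past_Suc[OF Q.prob_space_axioms sets(1) law.prob_space_axioms sets_law _ Suc.prems])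
        (rule step(1))
    show "measure R B = measure law B"
      by (rule measure_eq_on_past_Suc[OF R.prob_space_axioms sets(2) law.prob_space_axioms sets_law _ Suc.prems])
        (rule step(2))
  qed
qed

lemma law_extreme: "law \<in> extreme_measures (max_repr E)"
  unfolding extreme_measures_def
proof (intro CollectI conjI ballI allI impI law_max_repr)
  fix Q R :: "seq_space measure" and t :: real
  assume Q: "Q \<in> max_repr E" and R: "R \<in> max_repr E"
  assume t: "0 < t \<and> t < 1 \<and> (\<forall>A\<in>sets law. measure law A = t * measure Q A + (1 - t) * measure R A)"
  have eq: "measure Q B = measure law B \<and> measure R B = measure law B" if "B \<in> past k" for B k
    by (rule law_mixture_on_past[OF Q R _ _ _ that]) (use t in auto)
  show "Q = law" "R = law"
    by (rule prob_eq_on_pastI;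
        use eq max_repr_prob[OF Q] max_repr_prob[OF R] law_prob in \<open>auto simp: prob_measures_def\<close>)+
qed

end

section \<open>Extreme periodic measures represent the expectation\<close>

context iid_sublinear
begin

lemma value_after_Cb_Lip:
  assumes "\<phi> \<in> Cb_Lip n" "j \<le> n" shows "value_after j \<phi> \<in> Cb_Lip j"
  unfolding value_after_def[abs_def] by (rule Cb_Lip_partial_E[of _ j "n - j"]) (use assms in simp)

lemma value_after_Suc:
  assumes \<phi>: "\<phi> \<in> Cb_Lip n" and j: "j < n"
  shows "value_after j (value_after (Suc j) \<phi>) = value_after j \<phi>"
proof
  fix y
  have "\<phi> \<in> Cb_Lip (j + (1 + (n - j - 1)))" using \<phi> j by simp
  then have "(\<lambda>\<omega>. \<phi> (join_vec j y \<omega>)) \<in> Cb_Lip (1 + (n - j - 1))" by (rule Cb_Lip_join_right)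
  from block_indep[OF this]
  show "value_after j (value_after (Suc j) \<phi>) y = value_after j \<phi> y"
    by (simp add: value_after_def join_vec_assoc)
qed

text \<open>
  A law that is optimal for the past \<open>z\<close> is still optimal up to \<open>\<epsilon>\<close> in a neighbourhood of \<open>z\<close>. By
  Lindeloef's theorem countably many such neighbourhoods cover the space, and the first one that
  contains \<open>y\<close> determines the choice.
\<close>

lemma countable_near_optimal_laws:
  assumes \<psi>: "\<psi> \<in> Cb_Lip (Suc j)" and "\<epsilon> > 0"
  shows "\<exists>m sel. (\<forall>i :: nat. m i \<in> extreme_measures coord_laws) \<and>
    sel \<in> measurable borel (count_space UNIV) \<and> (\<forall>y. sel (truncate_seq j y) = sel y) \<and>
    (\<forall>y. value_after j \<psi> y - \<epsilon> \<le> (\<integral>x. \<psi> (join_vec j y (\<lambda>_. x)) \<partial>m (sel y)))"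
proof -
  define K where "K \<mu> y = (\<integral>x. \<psi> (join_vec j y (\<lambda>_. x)) \<partial>\<mu>)" for \<mu> y
  have "\<exists>\<mu>\<in>extreme_measures coord_laws. K \<mu> y = value_after j \<psi> y" for y
    using ex_extreme_coord_law[OF Cb_join_const[OF \<psi>, of j y]]
    unfolding K_def value_after_one[OF \<psi>] by metis
  then obtain opt where opt: "\<And>y. opt y \<in> extreme_measures coord_laws" "\<And>y. K (opt y) y = value_after j \<psi> y"
    by metis
  obtain B L where BL: "\<And>\<omega>. \<bar>\<psi> \<omega>\<bar> \<le> B" "0 \<le> L" "\<And>x y. \<bar>\<psi> x - \<psi> y\<bar> \<le> L * prefix_dist (j + 1) x y"
    using Cb_LipE[OF \<psi>] by (metis Suc_eq_plus1)
  have K_Lip: "K (opt z) \<in> Cb_Lip j" for z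
  proof -
    interpret real_distribution "opt z"
      using opt(1)[of z] by (simp add: extreme_measures_def coord_laws_def)
    have meas [measurable]: "(\<lambda>x. \<psi> (join_vec j y (\<lambda>_. x))) \<in> borel_measurable borel" for y
      by (rule Cb_measurable[OF Cb_join_const[OF \<psi>]])
    have int: "integrable (opt z) (\<lambda>x. \<psi> (join_vec j y (\<lambda>_. x)))" for y
      by (rule integrable_const_bound[where B = B]) (use BL in auto)
    have le: "\<bar>\<integral>x. g x \<partial>opt z\<bar> \<le> C" if "integrable (opt z) g" "\<And>x. \<bar>g x\<bar> \<le> C" for g :: "real \<Rightarrow> real" and C
    proof -
      have "\<bar>\<integral>x. g x \<partial>opt z\<bar> \<le> (\<integral>x. \<bar>g x\<bar> \<partial>opt z)" by (rule integral_abs_bound)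
      also have "\<dots> \<le> C" using that by (intro integral_le_const) auto
      finally show ?thesis .
    qed
    show ?thesis
    proof (rule Cb_LipI[of _ B L])
      show "\<bar>K (opt z) y\<bar> \<le> B" for y unfolding K_def by (rule le[OF int]) (rule BL)
      fix y y'
      have "K (opt z) y - K (opt z) y' = (\<integral>x. \<psi> (join_vec j y (\<lambda>_. x)) - \<psi> (join_vec j y' (\<lambda>_. x)) \<partial>opt z)"
        unfolding K_def by (rule Bochner_Integration.integral_diff[symmetric]) (rule int)+
      also have "\<bar>\<dots>\<bar> \<le> L * prefix_dist j y y'"
        using BL(3) by (intro le Bochner_Integration.integrable_diff int) (metis prefix_dist_join_left)
      finally show "\<bar>K (opt z) y - K (opt z) y'\<bar> \<le> L * prefix_dist j y y'" .
    qed
  qed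
  have V: "value_after j \<psi> \<in> Cb_Lip j" using value_after_Cb_Lip[OF \<psi>, of j] by simp
  define U where "U z = {y. value_after j \<psi> y - \<epsilon> < K (opt z) y}" for z
  have cont: "continuous_on UNIV (value_after j \<psi>)" "continuous_on UNIV (K (opt z))" for z
    using Cb_Lip_imp_Cb[OF V] Cb_Lip_imp_Cb[OF K_Lip] by (auto elim!: CbE)
  have U_open: "open (U z)" for z
    unfolding U_def by (intro open_Collect_less continuous_intros cont)
  have U_self: "z \<in> U z" for z using opt(2) \<open>\<epsilon> > 0\<close> by (simp add: U_def)
  obtain \<F> where F: "\<F> \<subseteq> range U" "countable \<F>" "\<Union>\<F> = \<Union>(range U)"
  proof (rule Lindelof_openin[of "range U" UNIV])
    show "openin (top_of_set UNIV) S" if "S \<in> range U" for S using that U_open by auto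
  qed blast
  obtain D where D: "countable D" "\<F> = U ` D"
    using F(1,2) by (metis countable_subset_image subset_UNIV)
  have cover: "\<exists>z\<in>D. y \<in> U z" for y using F(3) D U_self by blast
  then have "D \<noteq> {}" by blast
  define d where "d = from_nat_into D"
  have range_d: "range d = D" unfolding d_def using \<open>D \<noteq> {}\<close> D(1) by (rule range_from_nat_into)
  then have cover': "\<exists>i. y \<in> U (d i)" for y using cover by (metis imageE)
  define sel where "sel y = (LEAST i. y \<in> U (d i))" for y
  have "sel \<in> measurable borel (count_space UNIV)"
  proof -
    have [measurable]: "U (d i) \<in> sets borel" for i using U_open by simp
    show ?thesis unfolding sel_def[abs_def] by measurable
  qed
  moreover have "sel (truncate_seq j y) = sel y" for y
  proof -
    have "value_after j \<psi> (truncate_seq j y) = value_after j \<psi> y"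
      by (rule Cb_Lip_cong[OF V]) (simp add: truncate_seq_def)
    moreover have "K (opt z) (truncate_seq j y) = K (opt z) y" for z
      by (rule Cb_Lip_cong[OF K_Lip]) (simp add: truncate_seq_def)
    ultimately show ?thesis by (simp add: sel_def U_def)
  qed
  moreover have "value_after j \<psi> y - \<epsilon> \<le> (\<integral>x. \<psi> (join_vec j y (\<lambda>_. x)) \<partial>opt (d (sel y)))" for y
    using LeastI_ex[OF cover'[of y]] unfolding sel_def[symmetric] by (simp add: U_def K_def)
  ultimately show ?thesis using opt(1) by (intro exI[of _ "\<lambda>i. opt (d i)"] exI[of _ sel]) auto
qed

text \<open>
  The choice at time \<open>k\<close> sees only the coordinates of the block that contains \<open>k\<close>, moved to the
  beginning of the sequence. It thus restarts every \<open>n\<close> steps.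
\<close>

lemma periodic_adaptive_extreme:
  assumes n: "1 \<le> n" and ext: "\<And>j i. m j i \<in> extreme_measures coord_laws"
    and sel: "\<And>j. sel j \<in> measurable borel (count_space UNIV)" "\<And>j y. sel j (truncate_seq j y) = sel j y"
  defines "\<mu> \<equiv> \<lambda>k. m (k mod n)" and "s \<equiv> \<lambda>k \<omega>. sel (k mod n) (shift_seq (k - k mod n) \<omega>)"
  shows "adaptive_extreme E \<mu> s" and "adaptive_choice.law \<mu> s \<in> extreme_periodic_repr E"
proof -
  show ae: "adaptive_extreme E \<mu> s"
  proof (intro adaptive_extreme.intro adaptive_choice.intro adaptive_extreme_axioms.intro iid_sublinear_axioms)
    show "real_distribution (\<mu> k i)" for k i
      using ext[of "k mod n" i] by (simp add: \<mu>_def extreme_measures_def coord_laws_def)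
    show "s k \<in> measurable borel (count_space UNIV)" for k
      unfolding s_def by (rule measurable_compose[OF measurable_shift_seq sel(1)])
    show "s k (truncate_seq k \<omega>) = s k \<omega>" for k \<omega>
    proof -
      have "j + (k - k mod n) < k" if "j < k mod n" for j
        using that mod_less_eq_dividend[of k n] by linarith
      then have "truncate_seq (k mod n) (shift_seq (k - k mod n) (truncate_seq k \<omega>)) =
          truncate_seq (k mod n) (shift_seq (k - k mod n) \<omega>)"
        by (simp add: truncate_seq_def shift_seq_def fun_eq_iff)
      then show ?thesis unfolding s_def by (metis sel(2))
    qed
    show "\<mu> k i \<in> extreme_measures coord_laws" for k i by (simp add: \<mu>_def ext)
  qed
  interpret adaptive_extreme E \<mu> s by (rule ae)
  have "distr law borel (shift_seq n) = law"
  proof (rule law_stationary)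
    fix k \<omega>
    have "k + n - k mod n = k - k mod n + n" by simp
    then show "s (k + n) \<omega> = s k (shift_seq n \<omega>)" by (simp add: s_def shift_seq_shift_seq)
  qed (simp add: \<mu>_def)
  then show "law \<in> extreme_periodic_repr E"
    using law_extreme law_max_repr n
    by (auto simp: extreme_periodic_repr_def periodic_repr_def stationary_repr_def)
qed

text \<open>
  Each of the \<open>n\<close> choices within the first block loses at most \<open>\<epsilon> / n\<close> compared with the optimal value.
\<close>

lemma extreme_periodic_near_optimal:
  assumes \<phi>: "\<phi> \<in> Cb_Lip n" and n: "1 \<le> n" and "\<epsilon> > 0"
  obtains P where "P \<in> extreme_periodic_repr E" "E \<phi> - \<epsilon> \<le> integral\<^sup>L P \<phi>"
proof -
  define \<delta> where "\<delta> = \<epsilon> / n"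
  have \<delta>: "\<delta> > 0" "n * \<delta> = \<epsilon>" using n \<open>\<epsilon> > 0\<close> by (simp_all add: \<delta>_def)
  \<comment> \<open>The value \<open>V 0\<close> is \<open>E \<phi>\<close>, the value \<open>V n\<close> is \<open>\<phi>\<close>.\<close>
  define V where "V j = value_after j \<phi>" for j
  \<comment> \<open>Positions \<open>j \<ge> n\<close> do not occur in a block; any function serves there.\<close>
  define \<psi> where "\<psi> j = (if j < n then V (Suc j) else (\<lambda>_. 0))" for j
  have \<psi>: "\<psi> j \<in> Cb_Lip (Suc j)" for j
    using value_after_Cb_Lip[OF \<phi>, of "Suc j"] by (simp add: \<psi>_def V_def)
  from countable_near_optimal_laws[OF this \<delta>(1)]
  obtain m :: "nat \<Rightarrow> nat \<Rightarrow> real measure" and sel :: "nat \<Rightarrow> seq_space \<Rightarrow> nat" where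
    m: "\<And>j i. m j i \<in> extreme_measures coord_laws" and
    sel: "\<And>j. sel j \<in> measurable borel (count_space UNIV)" "\<And>j y. sel j (truncate_seq j y) = sel j y" and
    near: "\<And>j y. value_after j (\<psi> j) y - \<delta> \<le> (\<integral>x. \<psi> j (join_vec j y (\<lambda>_. x)) \<partial>m j (sel j y))"
    by metis
  define \<mu> where "\<mu> = (\<lambda>k. m (k mod n))"
  define s where "s = (\<lambda>k \<omega>. sel (k mod n) (shift_seq (k - k mod n) \<omega>))"
  have per: "adaptive_extreme E \<mu> s" "adaptive_choice.law \<mu> s \<in> extreme_periodic_repr E"
    unfolding \<mu>_def s_def by (rule periodic_adaptive_extreme[OF n m sel])+
  interpret adaptive_extreme E \<mu> s by (rule per(1))
  have "E \<phi> - k * \<delta> \<le> integral\<^sup>L law (V k)" if "k \<le> n" for k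
    using that
  proof (induction k)
    case 0
    have "V 0 = (\<lambda>_. E \<phi>)" by (simp add: V_def value_after_def[abs_def] join_vec_def)
    then show ?case using law.prob_space by simp
  next
    case (Suc k)
    then have k: "k < n" by simp
    have "value_after k (V (Suc k)) = V k" unfolding V_def by (rule value_after_Suc[OF \<phi> k])
    moreover have "integral\<^sup>L law (value_after k (V (Suc k))) - \<delta> \<le> integral\<^sup>L law (V (Suc k))"
    proof (rule law_integral_step_ge)
      show "V (Suc k) \<in> Cb_Lip (Suc k)" using \<psi>[of k] k by (simp add: \<psi>_def)
      show "value_after k (V (Suc k)) \<omega> - \<delta> \<le> (\<integral>x. V (Suc k) (join_vec k \<omega> (\<lambda>_. x)) \<partial>\<mu> k (s k \<omega>))" for \<omega>
        using near[of k \<omega>] k by (simp add: \<psi>_def \<mu>_def s_def)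
    qed
    ultimately show ?case using Suc by (simp add: algebra_simps)
  qed
  from this[of n] have "E \<phi> - \<epsilon> \<le> integral\<^sup>L law (V n)" using \<delta>(2) by simp
  moreover have "V n = \<phi>"
  proof
    fix y
    have "\<phi> (join_vec n y \<omega>) = \<phi> y" for \<omega>
      by (rule Cb_Lip_cong[OF \<phi>]) (simp add: join_vec_def)
    then show "V n y = \<phi> y" by (simp add: V_def value_after_def)
  qed
  ultimately show thesis using that[OF per(2)] by simp
qed

lemma extreme_periodic_max_repr: "P \<in> extreme_periodic_repr E \<Longrightarrow> P \<in> max_repr E"
  by (auto simp: extreme_periodic_repr_def extreme_measures_def)

lemma extreme_periodic_represents: "represents (extreme_periodic_repr E) E"
  unfolding represents_def
proof (intro conjI ballI)
  let ?S = "extreme_periodic_repr E"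
  show "?S \<subseteq> prob_measures" using extreme_periodic_max_repr max_repr_prob by blast
  show ne: "?S \<noteq> {}"
    using extreme_periodic_near_optimal[OF Cb_Lip_const[of 0 1], of 1] by auto
  fix X :: "seq_space \<Rightarrow> real" assume X: "X \<in> Cb"
  show "E X = (SUP P\<in>?S. integral\<^sup>L P X)"
  proof (rule antisym)
    show "(SUP P\<in>?S. integral\<^sup>L P X) \<le> E X"
      using ne X by (intro cSUP_least max_repr_le extreme_periodic_max_repr)
    have bdd: "bdd_above ((\<lambda>P. integral\<^sup>L P X) ` ?S)"
      using X by (intro bdd_aboveI[of _ "E X"]) (auto intro: max_repr_le extreme_periodic_max_repr)
    show "E X \<le> (SUP P\<in>?S. integral\<^sup>L P X)"
    proof (rule field_le_epsilon)
      fix e :: real assume "e > 0"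
      then have e: "e / 2 > 0" by simp
      obtain n \<phi> where \<phi>: "\<phi> \<in> Cb_Lip n" "\<And>\<omega>. \<phi> \<omega> \<le> X \<omega>" "E X \<le> E \<phi> + e / 2"
        using Cb_Lip_approx_below[OF X e] by metis
      have \<phi>': "\<phi> \<in> Cb_Lip (max 1 n)" using \<phi>(1) by (rule Cb_Lip_mono) simp
      obtain P where P: "P \<in> ?S" "E \<phi> - e / 2 \<le> integral\<^sup>L P \<phi>"
        using extreme_periodic_near_optimal[OF \<phi>' _ e] by (metis max.cobounded1)
      have "integral\<^sup>L P \<phi> \<le> integral\<^sup>L P X"
        by (rule integral_Cb_mono[OF max_repr_prob[OF extreme_periodic_max_repr[OF P(1)]]
              Cb_Lip_imp_Cb[OF \<phi>(1)] X \<phi>(2)])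
      also have "\<dots> \<le> (SUP P\<in>?S. integral\<^sup>L P X)" by (rule cSUP_upper[OF P(1) bdd])
      finally show "E X \<le> (SUP P\<in>?S. integral\<^sup>L P X) + e" using P(2) \<phi>(3) by simp
    qed
  qed
qed

lemma extreme_periodic_stationary:
  assumes "P \<in> extreme_periodic_repr E"
  obtains n where "extreme_stationary E P n"
proof -
  obtain n where n: "n \<ge> 1" "distr P borel (shift_seq n) = P" "P \<in> extreme_measures (max_repr E)"
    using assms by (auto simp: extreme_periodic_repr_def periodic_repr_def stationary_repr_def)
  have "extreme_stationary E P n"
    by standard (use n assms in \<open>auto intro: max_repr_prob extreme_periodic_max_repr\<close>)
  then show thesis by (rule that)
qed

lemma extreme_periodic_tail_trivial:
  assumes P: "P \<in> extreme_periodic_repr E" and A: "A \<in> tail_sigma"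
  shows "measure P A = 0 \<or> measure P A = 1"
proof -
  obtain n where "extreme_stationary E P n" using extreme_periodic_stationary[OF P] .
  then interpret extreme_stationary E P n .
  show ?thesis by (rule zero_one_law) (rule tail_event_shift[OF A])
qed

lemma shift_max_repr:
  assumes P: "P \<in> max_repr E" shows "distr P borel (shift_seq k) \<in> max_repr E"
proof -
  note Pp = max_repr_prob[OF P]
  interpret prob_space P using Pp by (simp add: prob_measures_def)
  have sP [measurable_cong]: "sets P = sets borel" using Pp by (simp add: prob_measures_def)
  have one: "measure P UNIV = 1" using prob_space prob_measures_space[OF Pp] by simp
  have C: "cond_shift P k UNIV \<in> max_repr E" by (rule cond_shift_max_repr[OF P past_UNIV]) (simp add: one)
  interpret C: prob_space "cond_shift P k UNIV" using max_repr_prob[OF C] by (simp add: prob_measures_def)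
  interpret D: prob_space "distr P borel (shift_seq k)" by (rule prob_space_distr) simp
  have "distr P borel (shift_seq k) = cond_shift P k UNIV"
  proof (rule measure_eqI)
    fix A assume "A \<in> sets (distr P borel (shift_seq k))"
    then have A: "A \<in> sets borel" by simp
    have "measure (distr P borel (shift_seq k)) A = measure (cond_shift P k UNIV) A"
      using A cond_shift_measure[OF Pp _ _ A, of UNIV k] one prob_measures_space[OF Pp]
      by (subst measure_distr) auto
    then show "emeasure (distr P borel (shift_seq k)) A = emeasure (cond_shift P k UNIV) A"
      by (simp add: C.emeasure_eq_measure D.emeasure_eq_measure)
  qed (simp add: cond_shift_def)
  then show ?thesis using C by simp
qed

end

section \<open>Density of the limits of averages\<close>

text \<open>
  When all laws offered at time \<open>k\<close> coincide, coordinate \<open>k\<close> has this law, whatever is chosen.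
\<close>

lemma (in adaptive_extreme) law_coord_integral:
  assumes \<psi>: "\<psi> \<in> Cb" and const: "\<And>i. \<mu> k i = \<nu>"
  shows "(\<integral>\<omega>. \<psi> (\<omega> k) \<partial>law) = integral\<^sup>L \<nu> \<psi>"
proof -
  obtain C where C: "\<And>x. \<bar>\<psi> x\<bar> \<le> C" using CbE[OF \<psi>] by metis
  have [measurable]: "\<psi> \<in> borel_measurable borel" by (rule Cb_measurable[OF \<psi>])
  have "(\<integral>\<omega>. \<psi> (\<omega> k) \<partial>law) = (\<integral>\<omega>. (\<integral>x. \<psi> (join_vec k \<omega> (\<lambda>_. x) k) \<partial>\<mu> k (s k \<omega>)) \<partial>law)"
    by (rule tower(3)[where C = C]) (auto simp: C truncate_seq_def)
  then show ?thesis using law.prob_space by (simp add: const join_vec_def)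
qed

locale iid_sublinear_Lp = iid_sublinear +
  fixes \<gamma> :: real
  assumes gamma: "\<gamma> > 1" and coord_Lp: "coord k \<in> Lp_space E \<gamma>"
begin

lemma coord_integrable: "P \<in> max_repr E \<Longrightarrow> integrable P (\<lambda>\<omega>. \<omega> k)"
  using Lp_space_L1_approx[OF coord_Lp[of k] gamma zero_less_one] unfolding coord_def[abs_def] by metis

lemma integral_coord_shift:
  assumes P: "P \<in> max_repr E"
  shows "(\<integral>\<omega>. \<omega> k \<partial>P) = (\<integral>\<omega>. \<omega> 0 \<partial>distr P borel (shift_seq k))"
proof -
  have [measurable_cong]: "sets P = sets borel" using max_repr_prob[OF P] by (simp add: prob_measures_def)
  show ?thesis by (subst integral_distr) (auto simp: shift_seq_def)
qed

lemma clamp_Cb: "clamp_real L \<in> Cb"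
  unfolding clamp_real_def[abs_def] by (rule CbI[of _ "\<bar>L\<bar>"]) (auto intro!: continuous_intros)

lemma coord_truncation:
  assumes "\<epsilon> > 0"
  obtains L where "0 \<le> L" "\<And>P k. P \<in> max_repr E \<Longrightarrow> \<bar>(\<integral>\<omega>. \<omega> k \<partial>P) - (\<integral>\<omega>. clamp_real L (\<omega> k) \<partial>P)\<bar> \<le> \<epsilon>"
proof -
  obtain L where L: "0 \<le> L"
    "\<And>P. P \<in> max_repr E \<Longrightarrow> (\<integral>\<omega>. \<bar>\<omega> 0 - clamp_real L (\<omega> 0)\<bar> \<partial>P) \<le> \<epsilon>"
    using Lp_space_truncation[OF coord_Lp[of 0] gamma assms] unfolding coord_def by metis
  show thesis
  proof (rule that[OF L(1)])
    fix P k assume P: "P \<in> max_repr E"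
    have [measurable_cong]: "sets P = sets borel" using max_repr_prob[OF P] by (simp add: prob_measures_def)
    have [measurable]: "clamp_real L \<in> borel_measurable borel" by (rule Cb_measurable[OF clamp_Cb])
    let ?Q = "distr P borel (shift_seq k)"
    have Q: "?Q \<in> max_repr E" by (rule shift_max_repr[OF P])
    have "(\<integral>\<omega>. \<omega> k \<partial>P) - (\<integral>\<omega>. clamp_real L (\<omega> k) \<partial>P) = (\<integral>\<omega>. \<omega> 0 \<partial>?Q) - (\<integral>\<omega>. clamp_real L (\<omega> 0) \<partial>?Q)"
      unfolding integral_coord_shift[OF P] by (subst (2) integral_distr) (auto simp: shift_seq_def)
    also have "\<dots> = (\<integral>\<omega>. \<omega> 0 - clamp_real L (\<omega> 0) \<partial>?Q)"
      by (rule Bochner_Integration.integral_diff[symmetric])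
         (rule coord_integrable[OF Q] integrable_Cb[OF max_repr_prob[OF Q] Cb_coord[OF clamp_Cb]])+
    finally show "\<bar>(\<integral>\<omega>. \<omega> k \<partial>P) - (\<integral>\<omega>. clamp_real L (\<omega> k) \<partial>P)\<bar> \<le> \<epsilon>"
      using order_trans[OF integral_abs_bound L(2)[OF Q]] by simp
  qed
qed

abbreviation upper_mean :: real where "upper_mean \<equiv> ext_expectation E (coord 0)"
abbreviation lower_mean :: real where "lower_mean \<equiv> - ext_expectation E (\<lambda>\<omega>. - coord 0 \<omega>)"

lemma coord_mean_bdd: "\<exists>C. \<forall>P\<in>max_repr E. \<bar>\<integral>\<omega>. \<omega> 0 \<partial>P\<bar> \<le> C"
proof -
  obtain L where L: "0 \<le> L" "\<And>P k. P \<in> max_repr E \<Longrightarrow> \<bar>(\<integral>\<omega>. \<omega> k \<partial>P) - (\<integral>\<omega>. clamp_real L (\<omega> k) \<partial>P)\<bar> \<le> 1"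
    using coord_truncation[of 1] by auto
  have "\<bar>\<integral>\<omega>. \<omega> 0 \<partial>P\<bar> \<le> L + 1" if P: "P \<in> max_repr E" for P
  proof -
    note Pp = max_repr_prob[OF P]
    have "\<bar>\<integral>\<omega>. clamp_real L (\<omega> 0) \<partial>P\<bar> \<le> (\<integral>\<omega>. \<bar>clamp_real L (\<omega> 0)\<bar> \<partial>P)" by (rule integral_abs_bound)
    also have "\<dots> \<le> (\<integral>_. L \<partial>P)"
    proof (rule integral_mono)
      show "integrable P (\<lambda>\<omega>. \<bar>clamp_real L (\<omega> 0)\<bar>)"
        by (intro integrable_abs integrable_Cb[OF Pp Cb_coord[OF clamp_Cb]])
      show "integrable P (\<lambda>_. L)" by (rule integrable_Cb[OF Pp Cb_const])
      show "\<bar>clamp_real L (\<omega> 0)\<bar> \<le> L" for \<omega> :: seq_space using L(1) by (auto simp: clamp_real_def)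
    qed
    finally show ?thesis using L(2)[OF P, of 0] Pp by simp
  qed
  then show ?thesis by blast
qed

lemma signed_mean_le_sup:
  assumes "\<sigma> = 1 \<or> \<sigma> = - 1" "P \<in> max_repr E"
  shows "(\<integral>\<omega>. \<sigma> * \<omega> 0 \<partial>P) \<le> ext_expectation E (\<lambda>\<omega>. \<sigma> * coord 0 \<omega>)"
proof -
  obtain C where C: "\<And>P. P \<in> max_repr E \<Longrightarrow> \<bar>\<integral>\<omega>. \<omega> 0 \<partial>P\<bar> \<le> C" using coord_mean_bdd by blast
  have "(\<integral>\<omega>. \<sigma> * \<omega> 0 \<partial>P) \<le> C" if "P \<in> max_repr E" for P
    using C[OF that] assms(1) by auto
  then show ?thesis unfolding ext_expectation_def coord_def
    by (intro cSUP_upper assms bdd_aboveI[of _ C]) auto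
qed

text \<open>
  The sign \<open>\<sigma>\<close> treats the upper and the lower mean together. The identity function is unbounded, so an
  extreme law is chosen that maximizes the mean of its truncation.
\<close>

lemma ex_extreme_law_extreme_mean:
  assumes \<sigma>: "\<sigma> = 1 \<or> \<sigma> = - 1" and "\<epsilon> > 0"
  obtains \<nu> where "\<nu> \<in> extreme_measures coord_laws"
    "\<And>P k. P \<in> max_repr E \<Longrightarrow> (\<And>\<psi>. \<psi> \<in> Cb \<Longrightarrow> (\<integral>\<omega>. \<psi> (\<omega> k) \<partial>P) = integral\<^sup>L \<nu> \<psi>) \<Longrightarrow>
      \<bar>\<sigma> * (\<integral>\<omega>. \<omega> k \<partial>P) - ext_expectation E (\<lambda>\<omega>. \<sigma> * coord 0 \<omega>)\<bar> \<le> \<epsilon>"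
proof -
  obtain L where L: "0 \<le> L" "\<And>P k. P \<in> max_repr E \<Longrightarrow> \<bar>(\<integral>\<omega>. \<omega> k \<partial>P) - (\<integral>\<omega>. clamp_real L (\<omega> k) \<partial>P)\<bar> \<le> \<epsilon> / 2"
    using coord_truncation[of "\<epsilon> / 2"] \<open>\<epsilon> > 0\<close> by auto
  let ?\<psi> = "\<lambda>x. \<sigma> * clamp_real L x"
  have \<psi>: "?\<psi> \<in> Cb" by (rule Cb_cmult[OF clamp_Cb])
  obtain \<nu> where \<nu>: "\<nu> \<in> extreme_measures coord_laws" "integral\<^sup>L \<nu> ?\<psi> = E (\<lambda>\<omega>. ?\<psi> (\<omega> 0))"
    using ex_extreme_coord_law[OF \<psi>] by metis
  have near: "\<bar>(\<integral>\<omega>. \<sigma> * \<omega> k \<partial>P) - (\<integral>\<omega>. ?\<psi> (\<omega> k) \<partial>P)\<bar> \<le> \<epsilon> / 2" if "P \<in> max_repr E" for P k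
    using L(2)[OF that, of k] \<sigma> by (auto simp: abs_minus_commute)
  have "ext_expectation E (\<lambda>\<omega>. \<sigma> * coord 0 \<omega>) \<le> E (\<lambda>\<omega>. ?\<psi> (\<omega> 0)) + \<epsilon> / 2"
    unfolding ext_expectation_def coord_def
  proof (rule cSUP_least[OF max_repr_nonempty])
    show "(\<integral>\<omega>. \<sigma> * \<omega> 0 \<partial>P) \<le> E (\<lambda>\<omega>. ?\<psi> (\<omega> 0)) + \<epsilon> / 2" if P: "P \<in> max_repr E" for P
      using near[OF P, of 0] max_repr_le[OF P Cb_coord[OF \<psi>], of 0] by linarith
  qed
  moreover have "E (\<lambda>\<omega>. ?\<psi> (\<omega> 0)) \<le> ext_expectation E (\<lambda>\<omega>. \<sigma> * coord 0 \<omega>) + \<epsilon> / 2"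
  proof (rule E_least[OF Cb_coord[OF \<psi>]])
    show "(\<integral>\<omega>. ?\<psi> (\<omega> 0) \<partial>P) \<le> ext_expectation E (\<lambda>\<omega>. \<sigma> * coord 0 \<omega>) + \<epsilon> / 2" if P: "P \<in> max_repr E" for P
      using near[OF P, of 0] signed_mean_le_sup[OF \<sigma> P] by linarith
  qed
  ultimately have top: "\<bar>E (\<lambda>\<omega>. ?\<psi> (\<omega> 0)) - ext_expectation E (\<lambda>\<omega>. \<sigma> * coord 0 \<omega>)\<bar> \<le> \<epsilon> / 2"
    by linarith
  show thesis
  proof (rule that[OF \<nu>(1)])
    fix P k assume P: "P \<in> max_repr E" "\<And>\<psi>. \<psi> \<in> Cb \<Longrightarrow> (\<integral>\<omega>. \<psi> (\<omega> k) \<partial>P) = integral\<^sup>L \<nu> \<psi>"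
    have "(\<integral>\<omega>. ?\<psi> (\<omega> k) \<partial>P) = E (\<lambda>\<omega>. ?\<psi> (\<omega> 0))" by (rule trans[OF P(2)[OF \<psi>] \<nu>(2)])
    then have "\<bar>\<sigma> * (\<integral>\<omega>. \<omega> k \<partial>P) - E (\<lambda>\<omega>. ?\<psi> (\<omega> 0))\<bar> \<le> \<epsilon> / 2"
      using near[OF P(1), of k] by simp
    then show "\<bar>\<sigma> * (\<integral>\<omega>. \<omega> k \<partial>P) - ext_expectation E (\<lambda>\<omega>. \<sigma> * coord 0 \<omega>)\<bar> \<le> \<epsilon>"
      using top by linarith
  qed
qed

lemma coord_mean_bounds:
  assumes P: "P \<in> max_repr E"
  shows "lower_mean \<le> (\<integral>\<omega>. \<omega> k \<partial>P)" "(\<integral>\<omega>. \<omega> k \<partial>P) \<le> upper_mean"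
  using signed_mean_le_sup[of 1, OF _ shift_max_repr[OF P, of k]]
    signed_mean_le_sup[of "-1", OF _ shift_max_repr[OF P, of k]]
  by (simp_all add: integral_coord_shift[OF P])

definition mean_limit :: "seq_space measure \<Rightarrow> real"
  where "mean_limit P = (SOME c. AE \<omega> in P. (\<lambda>N. avg N \<omega>) \<longlonglongrightarrow> c)"

lemma mean_limit:
  assumes P: "P \<in> extreme_periodic_repr E" and n: "1 \<le> n" "distr P borel (shift_seq n) = P"
  shows "AE \<omega> in P. (\<lambda>N. avg N \<omega>) \<longlonglongrightarrow> mean_limit P" "mean_limit P = (\<Sum>k<n. \<integral>\<omega>. \<omega> k \<partial>P) / n"
proof -
  have Pm: "P \<in> max_repr E" by (rule extreme_periodic_max_repr[OF P])
  interpret extreme_stationary E P n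
    by standard (use n P max_repr_prob[OF Pm] in \<open>auto simp: extreme_periodic_repr_def\<close>)
  have lim: "AE \<omega> in P. (\<lambda>N. avg N \<omega>) \<longlonglongrightarrow> (\<integral>\<omega>. avg n \<omega> \<partial>P)"
    by (rule averages_tendsto) (simp add: coord_def[abs_def] coord_integrable[OF Pm])
  then show lim': "AE \<omega> in P. (\<lambda>N. avg N \<omega>) \<longlonglongrightarrow> mean_limit P"
    unfolding mean_limit_def by (rule someI)
  have "AE \<omega> in P. mean_limit P = (\<integral>\<omega>. avg n \<omega> \<partial>P)"
    using lim lim' by eventually_elim (rule LIMSEQ_unique)
  then have "mean_limit P = (\<integral>\<omega>. avg n \<omega> \<partial>P)" by simp
  also have "\<dots> = (\<Sum>k<n. \<integral>\<omega>. \<omega> k \<partial>P) / n"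
    unfolding avg_def coord_def using coord_integrable[OF Pm] by simp
  finally show "mean_limit P = (\<Sum>k<n. \<integral>\<omega>. \<omega> k \<partial>P) / n" .
qed

lemma mean_limit_bounds:
  assumes P: "P \<in> extreme_periodic_repr E"
  shows "mean_limit P \<in> {lower_mean..upper_mean}"
proof -
  obtain n where n: "n \<ge> 1" "distr P borel (shift_seq n) = P"
    using P by (auto simp: extreme_periodic_repr_def periodic_repr_def stationary_repr_def)
  have Pm: "P \<in> max_repr E" by (rule extreme_periodic_max_repr[OF P])
  have "n * lower_mean \<le> (\<Sum>k<n. \<integral>\<omega>. \<omega> k \<partial>P)" "(\<Sum>k<n. \<integral>\<omega>. \<omega> k \<partial>P) \<le> n * upper_mean"
    using sum_mono[of "{..<n}" "\<lambda>_. lower_mean"] sum_mono[of "{..<n}" _ "\<lambda>_. upper_mean"] coord_mean_bounds[OF Pm]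
    by simp_all
  then show ?thesis using n(1) by (simp add: mean_limit(2)[OF P n] field_simps)
qed

text \<open>
  A block in which \<open>p\<close> of \<open>n\<close> positions have a law of nearly maximal mean, and the others one of nearly
  minimal mean, has an average mean close to the convex combination with weight \<open>p / n\<close>.
\<close>

lemma mean_limit_dense:
  assumes x: "x \<in> {lower_mean..upper_mean}" and "e > 0"
  obtains P where "P \<in> extreme_periodic_repr E" "\<bar>mean_limit P - x\<bar> < e"
proof -
  define \<epsilon> where "\<epsilon> = e / 2"
  have \<epsilon>: "\<epsilon> > 0" using \<open>e > 0\<close> by (simp add: \<epsilon>_def)
  obtain \<nu> where \<nu>: "\<nu> \<in> extreme_measures coord_laws"
    "\<And>P k. P \<in> max_repr E \<Longrightarrow> (\<And>\<psi>. \<psi> \<in> Cb \<Longrightarrow> (\<integral>\<omega>. \<psi> (\<omega> k) \<partial>P) = integral\<^sup>L \<nu> \<psi>) \<Longrightarrow>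
      \<bar>1 * (\<integral>\<omega>. \<omega> k \<partial>P) - ext_expectation E (\<lambda>\<omega>. 1 * coord 0 \<omega>)\<bar> \<le> \<epsilon>"
    using ex_extreme_law_extreme_mean[of 1, OF _ \<epsilon>] by blast
  obtain \<rho> where \<rho>: "\<rho> \<in> extreme_measures coord_laws"
    "\<And>P k. P \<in> max_repr E \<Longrightarrow> (\<And>\<psi>. \<psi> \<in> Cb \<Longrightarrow> (\<integral>\<omega>. \<psi> (\<omega> k) \<partial>P) = integral\<^sup>L \<rho> \<psi>) \<Longrightarrow>
      \<bar>-1 * (\<integral>\<omega>. \<omega> k \<partial>P) - ext_expectation E (\<lambda>\<omega>. -1 * coord 0 \<omega>)\<bar> \<le> \<epsilon>"
    using ex_extreme_law_extreme_mean[of "-1", OF _ \<epsilon>] by blast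
  define w where "w = upper_mean - lower_mean"
  have w: "0 \<le> w" using x by (simp add: w_def)
  define l where "l = (if w = 0 then 0 else (x - lower_mean) / w)"
  have l: "0 \<le> l" "l \<le> 1" "x = lower_mean + l * w"
  proof -
    have "l * w = x - lower_mean" using x by (cases "w = 0") (simp_all add: l_def w_def)
    then show "x = lower_mean + l * w" by simp
    have "x - lower_mean \<le> w" "0 \<le> x - lower_mean" using x by (simp_all add: w_def)
    then show "0 \<le> l" "l \<le> 1" using w by (simp_all add: l_def divide_le_eq)
  qed
  obtain N :: nat where N: "real N > w / \<epsilon>" using reals_Archimedean2 by blast
  define n where "n = Suc N"
  have n: "1 \<le> n" "w / n < \<epsilon>"
  proof -
    have "w < \<epsilon> * N" using N \<epsilon> by (simp add: field_simps)
    also have "\<dots> \<le> \<epsilon> * n" using \<epsilon> by (intro mult_left_mono) (auto simp: n_def)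
    finally show "w / n < \<epsilon>" by (simp add: n_def field_simps)
  qed (simp add: n_def)
  \<comment> \<open>The weight \<open>p / n\<close> differs from \<open>l\<close> by at most \<open>1 / n\<close>, which moves the mean by at most \<open>w / n\<close>.\<close>
  define p where "p = nat \<lfloor>l * n\<rfloor>"
  have p: "real p \<le> l * n" "l * n < real p + 1"
    using l(1) by (simp_all add: p_def)
  then have "real p \<le> n" using l(2) mult_right_mono[OF l(2), of "real n"] by simp
  then have pn: "p \<le> n" by simp
  define m where "m j (i :: nat) = (if j < p then \<nu> else \<rho>)" for j i
  define \<mu> where "\<mu> = (\<lambda>k. m (k mod n))"
  define s where "s = (\<lambda>(k::nat) (\<omega> :: seq_space). (0 :: nat))"
  have m: "\<And>j i. m j i \<in> extreme_measures coord_laws" using \<nu>(1) \<rho>(1) by (simp add: m_def)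
  have per: "adaptive_extreme E \<mu> s" "adaptive_choice.law \<mu> s \<in> extreme_periodic_repr E"
    unfolding \<mu>_def s_def
    by (rule periodic_adaptive_extreme[where sel = "\<lambda>_ _. 0", OF n(1) m]; simp)+
  interpret adaptive_extreme E \<mu> s by (rule per(1))
  have Pm: "law \<in> max_repr E" by (rule law_max_repr)
  have st: "distr law borel (shift_seq n) = law" by (rule law_stationary) (simp_all add: s_def \<mu>_def)
  have hi: "\<bar>(\<integral>\<omega>. \<omega> k \<partial>law) - upper_mean\<bar> \<le> \<epsilon>" if "k < p" for k
  proof -
    have "\<mu> k i = \<nu>" for i using that pn by (simp add: \<mu>_def m_def)
    from \<nu>(2)[OF Pm law_coord_integral[OF _ this]] show ?thesis by simp
  qed
  have lo: "\<bar>(\<integral>\<omega>. \<omega> k \<partial>law) - lower_mean\<bar> \<le> \<epsilon>" if "p \<le> k" "k < n" for k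
  proof -
    have "\<mu> k i = \<rho>" for i using that by (simp add: \<mu>_def m_def)
    from \<rho>(2)[OF Pm law_coord_integral[OF _ this]] show ?thesis by (simp add: abs_le_iff)
  qed
  have "\<bar>(\<Sum>k<n. \<integral>\<omega>. \<omega> k \<partial>law) - (\<Sum>k<n. if k < p then upper_mean else lower_mean)\<bar> \<le> (\<Sum>k<n. \<epsilon>)"
    unfolding sum_subtractf[symmetric]
    by (rule order_trans[OF sum_abs sum_mono]) (use hi lo in auto)
  moreover have "(\<Sum>k<n. if k < p then upper_mean else lower_mean) = n * lower_mean + p * w"
  proof -
    have "(\<Sum>k<n. if k < p then upper_mean else lower_mean) = (\<Sum>k<n. lower_mean + (if k < p then w else 0))"
      by (intro sum.cong) (auto simp: w_def)
    also have "\<dots> = (\<Sum>k<n. lower_mean) + (\<Sum>k<n. if k < p then w else 0)"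
      by (rule sum.distrib)
    also have "(\<Sum>k<n. if k < p then w else 0) = (\<Sum>k\<in>{..<p}. w)"
      using pn by (intro sum.mono_neutral_cong_right) auto
    finally show ?thesis by simp
  qed
  ultimately have "\<bar>n * mean_limit law - (n * lower_mean + p * w)\<bar> \<le> n * \<epsilon>"
    using n(1) by (simp add: mean_limit(2)[OF per(2) n(1) st])
  moreover have "\<bar>(n * lower_mean + p * w) - n * x\<bar> \<le> w"
  proof -
    have "(n * lower_mean + p * w) - n * x = - ((l * n - p) * w)" by (simp add: l(3) algebra_simps)
    moreover have "\<bar>(l * n - p) * w\<bar> \<le> 1 * w"
      unfolding abs_mult using p w by (intro mult_mono) auto
    ultimately show ?thesis by simp
  qed
  ultimately have "\<bar>n * mean_limit law - n * x\<bar> \<le> n * \<epsilon> + w" by linarith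
  also have "w < n * \<epsilon>" using n by (simp add: field_simps)
  finally have "n * \<bar>mean_limit law - x\<bar> < n * e"
    by (simp add: \<epsilon>_def abs_mult mult.commute[of _ e] flip: right_diff_distrib)
  then have "\<bar>mean_limit law - x\<bar> < e" using n(1) by simp
  then show thesis using that[OF per(2)] by simp
qed

lemma mean_limit_closure:
  "closure (mean_limit ` extreme_periodic_repr E) = {lower_mean..upper_mean}"
proof
  show "closure (mean_limit ` extreme_periodic_repr E) \<subseteq> {lower_mean..upper_mean}"
    using mean_limit_bounds by (intro closure_minimal) auto
  show "{lower_mean..upper_mean} \<subseteq> closure (mean_limit ` extreme_periodic_repr E)"
    unfolding closure_approachable dist_real_def
    using mean_limit_dense by (metis (no_types, lifting) closure_approachable dist_real_def imageI subsetI)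
qed

lemma mean_limit_upper_lower:
  assumes P: "P \<in> extreme_periodic_repr E"
  shows "AE \<omega> in P. upper_avg \<omega> = ereal (mean_limit P) \<and> lower_avg \<omega> = ereal (mean_limit P)"
proof -
  obtain n where "n \<ge> 1" "distr P borel (shift_seq n) = P"
    using P by (auto simp: extreme_periodic_repr_def periodic_repr_def stationary_repr_def)
  from mean_limit(1)[OF P this] show ?thesis
    by eventually_elim (simp add: upper_lower_avg_eq)
qed

end

section \<open>Zero-one law, averages and representation\<close>

theorem theorem4p6:
  fixes E :: "(seq_space \<Rightarrow> real) \<Rightarrow> real" and \<gamma> :: real
  assumes "sublinear_expectation E"
    and "regular_expectation E"
    and "\<gamma> > 1"
    and "\<And>k. coord k \<in> Lp_space E \<gamma>"
    and "iid_seq E coord"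
  shows "(\<forall>P\<in>extreme_periodic_repr E. \<forall>A\<in>tail_sigma. measure P A = 0 \<or> measure P A = 1) \<and>
    (\<exists>m :: seq_space measure \<Rightarrow> real.
       (\<forall>P\<in>extreme_periodic_repr E.
          AE \<omega> in P. upper_avg \<omega> = ereal (m P) \<and> lower_avg \<omega> = ereal (m P)) \<and>
       closure (m ` extreme_periodic_repr E) =
         {- ext_expectation E (\<lambda>\<omega>. - coord 0 \<omega>) .. ext_expectation E (coord 0)}) \<and>
    represents (extreme_periodic_repr E) E"
proof -
  interpret iid_sublinear_Lp E \<gamma>
    using assms by unfold_locales
  show ?thesis
    using extreme_periodic_tail_trivial mean_limit_upper_lower mean_limit_closure
      extreme_periodic_represents by blast
qed

end
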